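(* Let $\mathcal D=\mathcal D_v^u\times\mathcal D_\varepsilon$, where $$\mathcal D_v^u=\left\{f(\lambda)\ \Big|\ v(\lambda)\le f(\lambda)\le u(\lambda),\ \frac1{2\pi}\int_{-\pi}^{\pi}f(\lambda)d\lambda\le P_1\right\},$$ $$\mathcal D_\varepsilon=\left\{g(\lambda)\ \Big|\ g(\lambda)=(1-\varepsilon)g_1(\lambda)+\varepsilon w(\lambda),\ \frac1{2\pi}\int_{-\pi}^{\pi}g(\lambda)d\lambda\le P_2\right\},$$ where the spectral densities $u,v,g_1$ are known and fixed, $u$ and $v$ are bounded, $P_1,P_2>0$, $0<\varepsilon<1$, and $w$ ranges over spectral densities. Suppose that $f^0\in\mathcal D_v^u$, $g^0\in\mathcal D_\varepsilon$, that $\int_{-\pi}^{\pi}\frac{d\lambda}{f^0(\lambda)+g^0(\lambda)}<\infty$, and that the functions $$h_f(f^0,g^0)=\frac{\left|A(e^{i\lambda})g^0(\lambda)+C^0(\lambda)\right|}{f^0(\lambda)+g^0(\lambda)},\qquad h_g(f^0,g^0)=\frac{\left|A(e^{i\lambda})f^0(\lambda)-C^0(\lambda)\right|}{f^0(\lambda)+g^0(\lambda)},\qquad C^0(\lambda)=\sum_{k=0}^\infty((\mathbf P^0)^{-1}\mathbf R^0\mathbf a)_ke^{i\lambda(k+1)},$$ are bounded. Suppose that $f^0,g^0$ satisfy the equations $$\left|A(e^{i\lambda})g^0(\lambda)+C^0(\lambda)\right|=(f^0(\lambda)+g^0(\lambda))\left(\gamma_1(\lambda)+\gamma_2(\lambda)+\alpha_1^{-1}\right),$$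 $$\left|A(e^{i\lambda})f^0(\lambda)-C^0(\lambda)\right|=(f^0(\lambda)+g^0(\lambda))\left(\varphi(\lambda)+\alpha_2^{-1}\right),$$ where $\alpha_1,\alpha_2>0$ are constants; $\gamma_1(\lambda)\le0$ and $\gamma_1(\lambda)=0$ if $f^0(\lambda)>v(\lambda)$; $\gamma_2(\lambda)\ge0$ and $\gamma_2(\lambda)=0$ if $f^0(\lambda)<u(\lambda)$; $\varphi(\lambda)\le0$ and $\varphi(\lambda)=0$ if $g^0(\lambda)>(1-\varepsilon)g_1(\lambda)$. If $(f^0,g^0)$ determines a solution of the optimization problem $$\max_{(f,g)\in\mathcal D}\left(\langle\mathbf R\mathbf a,\mathbf P^{-1}\mathbf R\mathbf a\rangle+\langle\mathbf Q\mathbf a,\mathbf a\rangle\right)=\langle\mathbf R^0\mathbf a,(\mathbf P^0)^{-1}\mathbf R^0\mathbf a\rangle+\langle\mathbf Q^0\mathbf a,\mathbf a\rangle,$$ then $f^0,g^0$ are least favorable in the class $\mathcal D$ for the optimal linear filtering of $A\xi=\sum_{k=0}^\infty a(k)\xi(-k)$, and the function $h(f^0,g^0)$ is the minimax-robust spectral characteristic of the optimal estimate of $A\xi$.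
   Context: Setting: $\xi,\eta$ are zero-mean, mutually uncorrelated (wide-sense) stationary sequences with spectral densities $f,g\ge0$, integrable on $[-\pi,\pi)$, normalized by $\mathsf E\,\xi(m+k)\overline{\xi(m)}=\frac1{2\pi}\int e^{ik\lambda}f\,d\lambda$ (similarly $\eta,g$); $\xi(m)=\int e^{im\lambda}dZ_\xi(\lambda)$, $\eta(m)=\int e^{im\lambda}dZ_\eta(\lambda)$, $Z_{\xi+\eta}=Z_\xi+Z_\eta$. The functional $A\xi=\sum_{k\ge0}a(k)\xi(-k)$ is estimated by $\int h(\lambda)dZ_{\xi+\eta}(\lambda)$ from observations of $\xi(m)+\eta(m)$, $m=0,-1,-2,\ldots$. The coefficients satisfy $\sum|a(k)|<\infty$, $\sum(k+1)|a(k)|^2<\infty$; $\mathbf a=(a(0),a(1),\ldots)'$, $A(e^{i\lambda})=\sum_{k\ge0}a(k)e^{-i\lambda k}$. Operators: $\langle x,y\rangle=\sum_{k\ge0}x_k\overline{y_k}$ on $\ell_2$. For a pair $(f,g)$ with $\int\frac{d\lambda}{f+g}<\infty$, $\mathbf P,\mathbf R,\mathbf Q$ are the linear operators on $\ell_2$ with matrices ($l,k,m\ge0$) $$(\mathbf P)_{l,k}=\frac1{2\pi}\int_{-\pi}^{\pi}\frac{e^{i\lambda(k-l)}}{f+g}d\lambda,\quad(\mathbf R)_{l,m}=\frac1{2\pi}\int_{-\pi}^{\pi}e^{-i\lambda(l+1+m)}\frac{f}{f+g}d\lambda,\quad(\mathbf Q)_{l,k}=\frac1{2\pi}\int_{-\pi}^{\pi}e^{i\lambda(l-k)}\frac{fg}{f+g}d\lambda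 ;$$ $\mathbf P^0,\mathbf R^0,\mathbf Q^0$ are those built from $(f^0,g^0)$. Expressions involving these operators are considered for pairs with $\int\frac{d\lambda}{f+g}<\infty$ for which the matrices define operators on $\ell_2$ and $\mathbf P$ is invertible. Spectral characteristic and error: the optimal spectral characteristic for $(f,g)$ is $$h(f,g)(\lambda)=A(e^{i\lambda})\frac{f(\lambda)}{f(\lambda)+g(\lambda)}-\frac{\sum_{k\ge0}(\mathbf P^{-1}\mathbf R\mathbf a)_ke^{i\lambda(k+1)}}{f(\lambda)+g(\lambda)},$$ and $\Delta(h;f,g)=\frac1{2\pi}\int_{-\pi}^{\pi}|A(e^{i\lambda})-h(\lambda)|^2f(\lambda)d\lambda+\frac1{2\pi}\int_{-\pi}^{\pi}|h(\lambda)|^2g(\lambda)d\lambda$ is the mean-square error of the estimate with spectral characteristic $h$. Definitions: $(f^0,g^0)\in\mathcal D$ are least favorable in $\mathcal D$ for the optimal linear filtering of $A\xi$ if $\Delta(h(f^0,g^0);f^0,g^0)=\max_{(f,g)\in\mathcal D}\Delta(h(f,g);f,g)$. A spectral characteristic $h^0$ is minimax-robust for $\mathcal D$ if $h^0\in H_{\mathcal D}=\bigcap_{(f,g)\in\mathcal D}L_2^0(f+g)$ and $\min_{h\in H_{\mathcal D}}\max_{(f,g)\in\mathcal D}\Delta(h;f,g)=\sup_{(f,g)\in\mathcal D}\Delta(h^0;f,g)$, where $L_2^0(f+g)$ is the closed subspace of $L_2(f+g)$ generated by $\{e^{im\lambda}:m=0,-1,-2,\ldots\}$. *)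

theory Defs
  imports "HOL-Analysis.Analysis"
begin

text \<open>
  Frequencies range over \<open>[-\<pi>, \<pi>]\<close> with Lebesgue measure. Spectral densities and spectral
  characteristics are determined only up to null sets, so pointwise (in)equalities between them
  are read almost everywhere, and ``bounded'' means essentially bounded.
\<close>

abbreviation freq :: "real measure" where
  "freq \<equiv> lebesgue_on {-pi..pi}"

definition spectral_density :: "(real \<Rightarrow> real) \<Rightarrow> bool" where
  "spectral_density f \<longleftrightarrow> integrable freq f \<and> (AE t in freq. 0 \<le> f t)"

definition ess_bounded :: "(real \<Rightarrow> real) \<Rightarrow> bool" where
  "ess_bounded F \<longleftrightarrow> (\<exists>K. AE t in freq. \<bar>F t\<bar> \<le> K)"

section \<open>Operators on \<open>\<ell>\<^sub>2\<close> given by infinite matrices\<close>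

definition l2 :: "(nat \<Rightarrow> complex) set" where
  "l2 = {x. summable (\<lambda>k. (cmod (x k))\<^sup>2)}"

definition l2_norm :: "(nat \<Rightarrow> complex) \<Rightarrow> real" where
  "l2_norm x = sqrt (\<Sum>k. (cmod (x k))\<^sup>2)"

definition l2_inner :: "(nat \<Rightarrow> complex) \<Rightarrow> (nat \<Rightarrow> complex) \<Rightarrow> complex" where
  "l2_inner x y = (\<Sum>k. x k * cnj (y k))"

definition mat_app :: "(nat \<Rightarrow> nat \<Rightarrow> complex) \<Rightarrow> (nat \<Rightarrow> complex) \<Rightarrow> nat \<Rightarrow> complex" where
  "mat_app M x = (\<lambda>l. \<Sum>k. M l k * x k)"

definition l2_operator :: "(nat \<Rightarrow> nat \<Rightarrow> complex) \<Rightarrow> bool" where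
  "l2_operator M \<longleftrightarrow>
     (\<forall>x\<in>l2. (\<forall>l. summable (\<lambda>k. M l k * x k)) \<and> mat_app M x \<in> l2) \<and>
     (\<exists>K. \<forall>x\<in>l2. l2_norm (mat_app M x) \<le> K * l2_norm x)"

text \<open>Operators are bounded, and so are inverses: the second conjunct bounds the inverse.\<close>

definition l2_invertible :: "(nat \<Rightarrow> nat \<Rightarrow> complex) \<Rightarrow> bool" where
  "l2_invertible M \<longleftrightarrow> bij_betw (mat_app M) l2 l2 \<and>
     (\<exists>K. \<forall>x\<in>l2. l2_norm x \<le> K * l2_norm (mat_app M x))"

definition mat_inv_app :: "(nat \<Rightarrow> nat \<Rightarrow> complex) \<Rightarrow> (nat \<Rightarrow> complex) \<Rightarrow> nat \<Rightarrow> complex" where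
  "mat_inv_app M = inv_into l2 (mat_app M)"

section \<open>The operators of the filtering problem\<close>

definition P_mat :: "(real \<Rightarrow> real) \<Rightarrow> (real \<Rightarrow> real) \<Rightarrow> nat \<Rightarrow> nat \<Rightarrow> complex" where
  "P_mat f g l k = 1 / (2 * pi) *
     (LINT t|freq. cis (t * (real k - real l)) * complex_of_real (1 / (f t + g t)))"

definition R_mat :: "(real \<Rightarrow> real) \<Rightarrow> (real \<Rightarrow> real) \<Rightarrow> nat \<Rightarrow> nat \<Rightarrow> complex" where
  "R_mat f g l m = 1 / (2 * pi) *
     (LINT t|freq. cis (- t * (real l + 1 + real m)) * complex_of_real (f t / (f t + g t)))"

definition Q_mat :: "(real \<Rightarrow> real) \<Rightarrow> (real \<Rightarrow> real) \<Rightarrow> nat \<Rightarrow> nat \<Rightarrow> complex" where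
  "Q_mat f g l k = 1 / (2 * pi) *
     (LINT t|freq. cis (t * (real l - real k)) * complex_of_real (f t * g t / (f t + g t)))"

text \<open>
  The integral is taken in the extended nonnegative reals, where the inverse of \<open>0\<close> is
  \<open>\<infinity>\<close>; hence finiteness forces \<open>f + g > 0\<close> almost everywhere.
\<close>

definition inverse_integrable :: "(real \<Rightarrow> real) \<Rightarrow> (real \<Rightarrow> real) \<Rightarrow> bool" where
  "inverse_integrable f g \<longleftrightarrow> (\<integral>\<^sup>+t. inverse (ennreal (f t + g t)) \<partial>freq) < \<infinity>"

definition operators_defined :: "(real \<Rightarrow> real) \<Rightarrow> (real \<Rightarrow> real) \<Rightarrow> bool" where
  "operators_defined f g \<longleftrightarrow> l2_operator (P_mat f g) \<and> l2_operator (R_mat f g) \<and>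
     l2_operator (Q_mat f g) \<and> l2_invertible (P_mat f g)"

definition admissible :: "(real \<Rightarrow> real) \<Rightarrow> (real \<Rightarrow> real) \<Rightarrow> bool" where
  "admissible f g \<longleftrightarrow> inverse_integrable f g \<and> operators_defined f g"

text \<open>
  For admissible pairs of spectral densities the sum of inner products is real, because the
  operators \<open>P\<close> and \<open>Q\<close> are self-adjoint; \<open>Re\<close> is only a coercion.
\<close>

definition objective :: "(nat \<Rightarrow> complex) \<Rightarrow> (real \<Rightarrow> real) \<Rightarrow> (real \<Rightarrow> real) \<Rightarrow> real" where
  "objective a f g =
     Re (l2_inner (mat_app (R_mat f g) a) (mat_inv_app (P_mat f g) (mat_app (R_mat f g) a))
       + l2_inner (mat_app (Q_mat f g) a) a)"

section \<open>Spectral characteristics and mean-square errors\<close>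

definition A_fun :: "(nat \<Rightarrow> complex) \<Rightarrow> real \<Rightarrow> complex" where
  "A_fun a t = (\<Sum>k. a k * cis (- t * real k))"

text \<open>
  \<open>\<Sum>k. c k * e^(i t (k+1))\<close> with coefficients merely in \<open>\<ell>\<^sub>2\<close>: the sum is the limit in
  \<open>L\<^sub>2\<close> of the partial sums, which exists by Riesz--Fischer and is unique up to null sets.
\<close>

definition l2_series :: "(nat \<Rightarrow> complex) \<Rightarrow> real \<Rightarrow> complex" where
  "l2_series c = (SOME C. C \<in> borel_measurable freq \<and>
     (\<lambda>n. \<integral>\<^sup>+t. ennreal ((cmod (C t - (\<Sum>k<n. c k * cis (t * (real k + 1)))))\<^sup>2) \<partial>freq)
       \<longlonglongrightarrow> 0)"

definition C_fun ::
  "(nat \<Rightarrow> complex) \<Rightarrow> (real \<Rightarrow> real) \<Rightarrow> (real \<Rightarrow> real) \<Rightarrow> real \<Rightarrow> complex" where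
  "C_fun a f g = l2_series (mat_inv_app (P_mat f g) (mat_app (R_mat f g) a))"

definition h_opt ::
  "(nat \<Rightarrow> complex) \<Rightarrow> (real \<Rightarrow> real) \<Rightarrow> (real \<Rightarrow> real) \<Rightarrow> real \<Rightarrow> complex" where
  "h_opt a f g t = A_fun a t * complex_of_real (f t / (f t + g t))
     - C_fun a f g t / complex_of_real (f t + g t)"

text \<open>The mean-square error takes values in \<open>[0, \<infinity>]\<close>, so no integrability side condition is needed.\<close>

definition mse ::
  "(nat \<Rightarrow> complex) \<Rightarrow> (real \<Rightarrow> complex) \<Rightarrow> (real \<Rightarrow> real) \<Rightarrow> (real \<Rightarrow> real) \<Rightarrow> ennreal" where
  "mse a h f g =
     ennreal (1 / (2 * pi)) * (\<integral>\<^sup>+t. ennreal ((cmod (A_fun a t - h t))\<^sup>2 * f t) \<partial>freq) +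
     ennreal (1 / (2 * pi)) * (\<integral>\<^sup>+t. ennreal ((cmod (h t))\<^sup>2 * g t) \<partial>freq)"

text \<open>
  The closed subspace of \<open>L\<^sub>2(w)\<close> generated by \<open>e^(i m t)\<close>, \<open>m = 0, -1, -2, \<dots>\<close>:
  square-integrable functions that are approximable by finite linear combinations.
\<close>

definition L2_past :: "(real \<Rightarrow> real) \<Rightarrow> (real \<Rightarrow> complex) set" where
  "L2_past w = {h \<in> borel_measurable freq.
     (\<integral>\<^sup>+t. ennreal ((cmod (h t))\<^sup>2 * w t) \<partial>freq) < \<infinity> \<and>
     (\<forall>e>0. \<exists>N c. (\<integral>\<^sup>+t. ennreal ((cmod (h t - (\<Sum>k\<le>N. c k * cis (- t * real k))))\<^sup>2 * w t) \<partial>freq)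
        < ennreal e)}"

section \<open>Least favorable densities and minimax-robust characteristics\<close>

type_synonym density_class = "((real \<Rightarrow> real) \<times> (real \<Rightarrow> real)) set"

definition least_favorable ::
  "(nat \<Rightarrow> complex) \<Rightarrow> density_class \<Rightarrow> (real \<Rightarrow> real) \<Rightarrow> (real \<Rightarrow> real) \<Rightarrow> bool" where
  "least_favorable a D f0 g0 \<longleftrightarrow> (f0, g0) \<in> D \<and> admissible f0 g0 \<and>
     (\<forall>(f, g)\<in>D. admissible f g \<longrightarrow> mse a (h_opt a f g) f g \<le> mse a (h_opt a f0 g0) f0 g0)"

definition H_class :: "density_class \<Rightarrow> (real \<Rightarrow> complex) set" where
  "H_class D = (\<Inter>(f, g)\<in>D. L2_past (\<lambda>t. f t + g t))"

text \<open>As \<open>h0\<close> belongs to \<open>H_class D\<close>, the equation says that the infimum is attained at \<open>h0\<close>.\<close>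

definition minimax_robust ::
  "(nat \<Rightarrow> complex) \<Rightarrow> density_class \<Rightarrow> (real \<Rightarrow> complex) \<Rightarrow> bool" where
  "minimax_robust a D h0 \<longleftrightarrow> h0 \<in> H_class D \<and>
     (INF h\<in>H_class D. SUP (f, g)\<in>D. mse a h f g) = (SUP (f, g)\<in>D. mse a h0 f g)"

definition D_band :: "(real \<Rightarrow> real) \<Rightarrow> (real \<Rightarrow> real) \<Rightarrow> real \<Rightarrow> (real \<Rightarrow> real) set" where
  "D_band v u P = {f. spectral_density f \<and> (AE t in freq. v t \<le> f t \<and> f t \<le> u t) \<and>
     1 / (2 * pi) * (LINT t|freq. f t) \<le> P}"

definition D_contam :: "(real \<Rightarrow> real) \<Rightarrow> real \<Rightarrow> real \<Rightarrow> (real \<Rightarrow> real) set" where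
  "D_contam g1 \<epsilon> P = {g. spectral_density g \<and>
     (\<exists>w. spectral_density w \<and> (AE t in freq. g t = (1 - \<epsilon>) * g1 t + \<epsilon> * w t)) \<and>
     1 / (2 * pi) * (LINT t|freq. g t) \<le> P}"

end

theory Submission
  imports Defs
begin

text \<open>
  Fix the past as the space \<open>H\<close> of square-integrable functions on \<open>[-\<pi>, \<pi>]\<close> without positive
  frequencies. For a fixed spectral characteristic \<open>h\<close> the error is linear in \<open>(f, g)\<close>, and for fixed
  \<open>(f, g)\<close> it is a quadratic function of \<open>h\<close> which is smallest over \<open>H\<close> at \<open>h_opt a f g\<close>. So the
  smallest error is concave in \<open>(f, g)\<close>, and a pair that maximizes it over a convex class is a
  saddle point together with its optimal characteristic. This is what has to be proved: the
  error of \<open>h0 = h_opt a f0 g0\<close> at an arbitrary pair of the class is at most its error at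
  \<open>(f0, g0)\<close>. Most of the work lies in connecting the matrices on \<open>\<ell>\<^sub>2\<close> with this picture.

  \<^bold>\<open>The operators.\<close> By Parseval, \<open>P\<close>, \<open>R\<close> and \<open>Q\<close> are multiplications by \<open>1/(f+g)\<close>, \<open>f/(f+g)\<close> and
  \<open>fg/(f+g)\<close> followed by a projection. The equation \<open>P c = R a\<close> says that \<open>h_opt a f g\<close> has no
  positive frequencies (\<open>h_opt_past\<close>); the objective is then the error of \<open>h_opt a f g\<close>
  (\<open>objective_eq_err\<close>), so the maximality hypothesis is least favorability. As
  \<open>(A - h) f - h g\<close> equals the series \<open>C\<close> for \<open>h = h_opt a f g\<close>, and \<open>C\<close> has positive frequencies only,
  the error of any other \<open>h\<close> in \<open>H\<close> exceeds the minimum by the mean square of \<open>h - h_opt a f g\<close> with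
  weight \<open>f + g\<close> (\<open>err_pythagoras\<close>).

  \<^bold>\<open>Admissibility.\<close> A pair is admissible exactly when \<open>f + g\<close> is essentially bounded and bounded away
  from \<open>0\<close> (\<open>admissible_bounded_pair\<close>, \<open>bounded_pair_admissible\<close>). Hence a convex combination of
  \<open>(f0, g0)\<close> with any pair of bounded densities is admissible again, as long as \<open>(f0, g0)\<close> has positive
  weight, and the maximality hypothesis applies along the segment.

  \<^bold>\<open>The saddle point.\<close> Let \<open>h\<close> be optimal for the combination of \<open>(f0, g0)\<close> and \<open>(f, g)\<close> with weights
  \<open>1 - s\<close> and \<open>s\<close>. Maximality and linearity bound
  \<open>(1 - s) err(f0, g0; h) + s err(f, g; h)\<close> by the maximum, and \<open>err_pythagoras\<close> turns this into an
  estimate of \<open>h - h0\<close> together with a bound for \<open>err(f, g; h)\<close>; as \<open>s \<longlonglongrightarrow> 0\<close> the saddle inequality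
  follows (\<open>saddle_bounded\<close>). Unbounded \<open>g\<close> are reached
  by truncating the contaminating density (\<open>D_contam_truncate\<close>) and monotone convergence.

  \<^bold>\<open>Membership in \<open>H_class\<close>.\<close> Since \<open>h0\<close> is bounded and lies in \<open>H\<close>, its Fejer means are polynomials in
  \<open>e\<^sup>-\<^sup>i\<^sup>t\<close> under one common bound that converge almost everywhere along a subsequence, hence in
  \<open>L\<^sub>2(f + g)\<close> for every integrable \<open>f + g\<close> (\<open>past_bounded_imp_L2_past\<close>). Fejer means also carry
  the step from bounded Toeplitz matrices to bounded symbols.
\<close>

section \<open>Square-integrable functions\<close>

definition sqint :: "'a measure \<Rightarrow> ('a \<Rightarrow> complex) set" where
  "sqint M = {f \<in> borel_measurable M. integrable M (\<lambda>t. (cmod (f t))\<^sup>2)}"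

definition L2n :: "'a measure \<Rightarrow> ('a \<Rightarrow> complex) \<Rightarrow> real" where
  "L2n M f = sqrt (\<integral>t. (cmod (f t))\<^sup>2 \<partial>M)"

lemma sqint_measurable [measurable_dest]: "f \<in> sqint M \<Longrightarrow> f \<in> borel_measurable M"
  and sqint_integrable: "f \<in> sqint M \<Longrightarrow> integrable M (\<lambda>t. (cmod (f t))\<^sup>2)"
  by (auto simp: sqint_def)

lemma sqintI:
  "f \<in> borel_measurable M \<Longrightarrow> integrable M (\<lambda>t. (cmod (f t))\<^sup>2) \<Longrightarrow> f \<in> sqint M"
  by (auto simp: sqint_def)

lemma L2n_nonneg [simp]: "0 \<le> L2n M f"
  by (simp add: L2n_def)

lemma L2n_power2: "(L2n M f)\<^sup>2 = (\<integral>t. (cmod (f t))\<^sup>2 \<partial>M)"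
  by (simp add: L2n_def)

lemma sqint_mult_integrable:
  assumes "f \<in> sqint M" "g \<in> sqint M"
  shows "integrable M (\<lambda>t. f t * g t)"
proof (rule Bochner_Integration.integrable_bound)
  show "integrable M (\<lambda>t. (cmod (f t))\<^sup>2 + (cmod (g t))\<^sup>2)"
    using assms by (auto intro: sqint_integrable)
  show "(\<lambda>t. f t * g t) \<in> borel_measurable M" using assms by measurable
  have "cmod (f t) * cmod (g t) \<le> (cmod (f t))\<^sup>2 + (cmod (g t))\<^sup>2" for t
    using sum_squares_bound[of "cmod (f t)" "cmod (g t)"]
          mult_nonneg_nonneg[OF norm_ge_zero[of "f t"] norm_ge_zero[of "g t"]] by linarith
  then show "AE t in M. norm (f t * g t) \<le> norm ((cmod (f t))\<^sup>2 + (cmod (g t))\<^sup>2)"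
    by (simp add: norm_mult)
qed

lemma sqint_cnj: "f \<in> sqint M \<Longrightarrow> (\<lambda>t. cnj (f t)) \<in> sqint M"
  by (auto simp: sqint_def intro!: borel_measurable_continuous_on[of cnj] continuous_intros)

lemma sqint_inner_integrable:
  "f \<in> sqint M \<Longrightarrow> g \<in> sqint M \<Longrightarrow> integrable M (\<lambda>t. f t * cnj (g t))"
  by (intro sqint_mult_integrable sqint_cnj)

lemma sqint_bound:
  assumes "f \<in> sqint M" "g \<in> borel_measurable M" "AE t in M. cmod (g t) \<le> K * cmod (f t)"
  shows "g \<in> sqint M"
proof (rule sqintI)
  show "integrable M (\<lambda>t. (cmod (g t))\<^sup>2)"
  proof (rule Bochner_Integration.integrable_bound)
    show "integrable M (\<lambda>t. K\<^sup>2 * (cmod (f t))\<^sup>2)"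
      using assms(1) by (auto intro: sqint_integrable)
    show "AE t in M. norm ((cmod (g t))\<^sup>2) \<le> norm (K\<^sup>2 * (cmod (f t))\<^sup>2)"
      using assms(3) by eventually_elim (auto simp flip: power_mult_distrib intro!: power_mono)
  qed (use assms(2) in measurable)
qed (use assms in auto)

lemma sqint_cmult: "f \<in> sqint M \<Longrightarrow> (\<lambda>t. c * f t) \<in> sqint M"
  by (rule sqint_bound[where f = f and K = "cmod c"]) (auto simp: norm_mult sqint_measurable)

lemma norm_add_power2_le: "(cmod (x + y))\<^sup>2 \<le> 2 * (cmod x)\<^sup>2 + 2 * (cmod y)\<^sup>2"
proof -
  have "(cmod (x + y))\<^sup>2 \<le> (cmod x + cmod y)\<^sup>2"
    by (intro power_mono norm_triangle_ineq) auto
  also have "\<dots> \<le> 2 * (cmod x)\<^sup>2 + 2 * (cmod y)\<^sup>2"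
    using sum_squares_bound[of "cmod x" "cmod y"] by (simp add: power2_sum)
  finally show ?thesis .
qed

lemma sqint_add:
  assumes "f \<in> sqint M" "g \<in> sqint M"
  shows "(\<lambda>t. f t + g t) \<in> sqint M"
proof (rule sqintI)
  show "integrable M (\<lambda>t. (cmod (f t + g t))\<^sup>2)"
  proof (rule Bochner_Integration.integrable_bound)
    show "integrable M (\<lambda>t. 2 * (cmod (f t))\<^sup>2 + 2 * (cmod (g t))\<^sup>2)"
      by (intro Bochner_Integration.integrable_add integrable_mult_right sqint_integrable assms)
  qed (use assms in \<open>auto simp: norm_add_power2_le\<close>)
qed (use assms in auto)

lemma sqint_minus: "f \<in> sqint M \<Longrightarrow> (\<lambda>t. - f t) \<in> sqint M"
  by (auto simp: sqint_def)

lemma sqint_diff: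
  "f \<in> sqint M \<Longrightarrow> g \<in> sqint M \<Longrightarrow> (\<lambda>t. f t - g t) \<in> sqint M"
  using sqint_add[of f M "\<lambda>t. - g t"] by (simp add: sqint_minus)

lemma sqint_0 [simp]: "(\<lambda>t. 0) \<in> sqint M"
  by (simp add: sqint_def)

lemma sqint_sum: "(\<And>i. i \<in> I \<Longrightarrow> f i \<in> sqint M) \<Longrightarrow> (\<lambda>t. \<Sum>i\<in>I. f i t) \<in> sqint M"
  by (induction I rule: infinite_finite_induct) (auto intro: sqint_add)

lemma sqint_bounded:
  assumes "finite_measure M" "g \<in> borel_measurable M" "AE t in M. cmod (g t) \<le> K"
  shows "g \<in> sqint M"
proof (rule sqint_bound[of "\<lambda>_. 1" M g K])
  show "(\<lambda>_. 1) \<in> sqint M"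
    using assms(1) by (auto simp: sqint_def finite_measure.integrable_const)
qed (use assms in auto)

lemma cauchy_schwarz_L2:
  assumes "f \<in> sqint M" "g \<in> sqint M"
  shows "(\<integral>t. cmod (f t) * cmod (g t) \<partial>M) \<le> L2n M f * L2n M g"
    and "cmod (\<integral>t. f t * g t \<partial>M) \<le> L2n M f * L2n M g"
proof -
  have [measurable]: "f \<in> borel_measurable M" "g \<in> borel_measurable M"
    using assms by auto
  have i: "integrable M (\<lambda>t. cmod (f t) * cmod (g t))"
    using integrable_norm[OF sqint_mult_integrable[OF assms]] by (simp add: norm_mult)
  have eq: "(\<integral>\<^sup>+t. ennreal ((cmod (f t))\<^sup>2) \<partial>M) = ennreal ((L2n M f)\<^sup>2)"
    if "f \<in> sqint M" for f
    using sqint_integrable[OF that]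
    by (simp add: L2n_power2 nn_integral_eq_integral)
  have "(\<integral>\<^sup>+t. ennreal (cmod (f t)) * ennreal (cmod (g t)) \<partial>M)
      = ennreal (\<integral>t. cmod (f t) * cmod (g t) \<partial>M)"
    using i by (simp add: ennreal_mult' [symmetric] nn_integral_eq_integral)
  then have "ennreal ((\<integral>t. cmod (f t) * cmod (g t) \<partial>M)\<^sup>2)
      \<le> ennreal ((L2n M f)\<^sup>2) * ennreal ((L2n M g)\<^sup>2)"
    using Cauchy_Schwarz_nn_integral[of "\<lambda>t. ennreal (cmod (f t))" M "\<lambda>t. ennreal (cmod (g t))"]
    by (simp add: eq[OF assms(1)] eq[OF assms(2)] ennreal_power)
  then have "(\<integral>t. cmod (f t) * cmod (g t) \<partial>M)\<^sup>2 \<le> (L2n M f * L2n M g)\<^sup>2"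
    by (simp add: ennreal_mult' [symmetric] power_mult_distrib)
  then show 1: "(\<integral>t. cmod (f t) * cmod (g t) \<partial>M) \<le> L2n M f * L2n M g"
    by (rule power2_le_imp_le) simp
  have "cmod (\<integral>t. f t * g t \<partial>M) \<le> (\<integral>t. cmod (f t * g t) \<partial>M)"
    by (rule integral_norm_bound)
  with 1 show "cmod (\<integral>t. f t * g t \<partial>M) \<le> L2n M f * L2n M g"
    by (simp add: norm_mult)
qed

lemma L2n_cnj [simp]: "L2n M (\<lambda>t. cnj (f t)) = L2n M f"
  by (simp add: L2n_def)

lemma L2n_mono:
  assumes "f \<in> sqint M" "g \<in> borel_measurable M" "AE t in M. cmod (g t) \<le> K * cmod (f t)" "0 \<le> K"
  shows "L2n M g \<le> K * L2n M f"
proof -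
  have "(\<integral>t. (cmod (g t))\<^sup>2 \<partial>M) \<le> (\<integral>t. K\<^sup>2 * (cmod (f t))\<^sup>2 \<partial>M)"
  proof (rule integral_mono_AE)
    show "AE t in M. (cmod (g t))\<^sup>2 \<le> K\<^sup>2 * (cmod (f t))\<^sup>2"
      using assms(3) by eventually_elim (auto simp flip: power_mult_distrib intro!: power_mono)
  qed (use assms(1) sqint_bound[OF assms(1-3)] in \<open>auto intro: sqint_integrable\<close>)
  then have "(L2n M g)\<^sup>2 \<le> (K * L2n M f)\<^sup>2"
    by (simp add: L2n_power2 power_mult_distrib)
  then show ?thesis by (rule power2_le_imp_le) (simp add: assms(4))
qed

lemma L2n_triangle:
  assumes "f \<in> sqint M" "g \<in> sqint M"
  shows "L2n M (\<lambda>t. f t + g t) \<le> L2n M f + L2n M g"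
proof -
  have i: "integrable M (\<lambda>t. cmod (f t) * cmod (g t))"
    using integrable_norm[OF sqint_mult_integrable[OF assms]] by (simp add: norm_mult)
  have "(L2n M (\<lambda>t. f t + g t))\<^sup>2 \<le>
     (\<integral>t. (cmod (f t))\<^sup>2 + (cmod (g t))\<^sup>2 + 2 * (cmod (f t) * cmod (g t)) \<partial>M)"
    unfolding L2n_power2
  proof (rule integral_mono)
    show "(cmod (f t + g t))\<^sup>2 \<le> (cmod (f t))\<^sup>2 + (cmod (g t))\<^sup>2 + 2 * (cmod (f t) * cmod (g t))" for t
      using power_mono[OF norm_triangle_ineq[of "f t" "g t"], of 2] by (simp add: power2_sum)
  qed (intro Bochner_Integration.integrable_add integrable_mult_right sqint_integrable
      assms i sqint_add)+
  also have "\<dots> = (L2n M f)\<^sup>2 + (L2n M g)\<^sup>2 + 2 * (\<integral>t. cmod (f t) * cmod (g t) \<partial>M)"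
    using assms i by (simp add: sqint_integrable L2n_power2)
  also have "\<dots> \<le> (L2n M f + L2n M g)\<^sup>2"
    using cauchy_schwarz_L2(1)[OF assms] by (simp add: power2_sum)
  finally show ?thesis by (rule power2_le_imp_le) simp
qed

lemma L2n_minus_commute: "L2n M (\<lambda>t. f t - g t) = L2n M (\<lambda>t. g t - f t)"
  by (simp add: L2n_def norm_minus_commute)

lemma L2n_triangle_diff:
  assumes "f \<in> sqint M" "g \<in> sqint M" "h \<in> sqint M"
  shows "L2n M (\<lambda>t. f t - h t) \<le> L2n M (\<lambda>t. f t - g t) + L2n M (\<lambda>t. g t - h t)"
  using L2n_triangle[OF sqint_diff[OF assms(1,2)] sqint_diff[OF assms(2,3)]] by simp

lemma nn_integral_sqint:
  assumes "f \<in> sqint M"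
  shows "(\<integral>\<^sup>+t. ennreal ((cmod (f t))\<^sup>2) \<partial>M) = ennreal ((L2n M f)\<^sup>2)"
  using sqint_integrable[OF assms] by (simp add: L2n_power2 nn_integral_eq_integral)

lemma sqint_nn_integral:
  assumes "f \<in> borel_measurable M" "(\<integral>\<^sup>+t. ennreal ((cmod (f t))\<^sup>2) \<partial>M) < \<infinity>"
  shows "f \<in> sqint M"
  using assms by (auto simp: sqint_def integrable_iff_bounded)

text \<open>
  Fischer's argument: along a subsequence with rapidly decreasing increments the sequence
  converges almost everywhere, and Fatou's lemma identifies the pointwise limit as the limit in
  mean square of the whole sequence.
\<close>

lemma L2_complete:
  assumes F: "\<And>n. F n \<in> sqint M"
    and cau: "\<And>e. e > 0 \<Longrightarrow> \<exists>N. \<forall>m\<ge>N. \<forall>n\<ge>N. L2n M (\<lambda>t. F m t - F n t) < e"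
  shows "\<exists>G\<in>sqint M. (\<lambda>n. L2n M (\<lambda>t. F n t - G t)) \<longlonglongrightarrow> 0"
proof -
  have [measurable]: "F n \<in> borel_measurable M" for n using F by auto
  have "\<forall>k. \<exists>N. \<forall>m\<ge>N. \<forall>n\<ge>N. L2n M (\<lambda>t. F m t - F n t) < (1/4) ^ k"
    using cau by simp
  then obtain N where N: "\<And>k m n. m \<ge> N k \<Longrightarrow> n \<ge> N k \<Longrightarrow> L2n M (\<lambda>t. F m t - F n t) < (1/4) ^ k"
    by metis
  define r where "r k = (\<Sum>i\<le>k. N i)" for k
  have r1: "r k \<ge> N k" for k unfolding r_def by (rule member_le_sum) auto
  have r2: "r (Suc k) \<ge> r k" for k by (simp add: r_def)
  have rm: "mono r" using r2 by (simp add: mono_iff_le_Suc)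
  define d where "d k t = ennreal (4 ^ k * (cmod (F (r (Suc k)) t - F (r k) t))\<^sup>2)" for k t
  have [measurable]: "d k \<in> borel_measurable M" for k unfolding d_def by measurable
  have dint: "(\<integral>\<^sup>+t. d k t \<partial>M) \<le> ennreal ((1/4) ^ k)" for k
  proof -
    have "(\<integral>\<^sup>+t. d k t \<partial>M)
        = ennreal (4 ^ k) * (\<integral>\<^sup>+t. ennreal ((cmod (F (r (Suc k)) t - F (r k) t))\<^sup>2) \<partial>M)"
      unfolding d_def by (subst nn_integral_cmult[symmetric]) (auto simp: ennreal_mult')
    also have "\<dots> = ennreal (4 ^ k * (L2n M (\<lambda>t. F (r (Suc k)) t - F (r k) t))\<^sup>2)"
      by (subst nn_integral_sqint) (auto intro: sqint_diff F simp: ennreal_mult')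
    also have "\<dots> \<le> ennreal (4 ^ k * ((1/4) ^ k)\<^sup>2)"
      using N[of k "r (Suc k)" "r k"] r1[of k] r2[of k]
      by (intro ennreal_leI mult_left_mono power_mono) (auto simp: less_imp_le)
    also have "4 ^ k * ((1/4) ^ k)\<^sup>2 = ((1/4) ^ k :: real)"
      by (simp add: power2_eq_square field_simps)
    finally show ?thesis .
  qed
  have "(\<integral>\<^sup>+t. (\<Sum>k. d k t) \<partial>M) = (\<Sum>k. \<integral>\<^sup>+t. d k t \<partial>M)"
    by (rule nn_integral_suminf) simp
  also have "\<dots> \<le> (\<Sum>k. ennreal ((1/4) ^ k))" by (intro suminf_le dint) auto
  also have "\<dots> < \<infinity>"
    by (subst suminf_ennreal2) (auto intro: summable_geometric)
  finally have "AE t in M. (\<Sum>k. d k t) \<noteq> \<infinity>"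
    by (intro nn_integral_noteq_infinite) auto
  then have AEc: "AE t in M. convergent (\<lambda>k. F (r k) t)"
  proof eventually_elim
    case (elim t)
    then obtain B where B: "0 \<le> B" "(\<Sum>k. d k t) = ennreal B" by (cases "\<Sum>k. d k t") auto
    have le: "cmod (F (r (Suc k)) t - F (r k) t) \<le> sqrt B * (1/2) ^ k" for k
    proof -
      have "d k t \<le> ennreal B"
        unfolding B(2)[symmetric] using sum_le_suminf[of "\<lambda>k. d k t" "{k}"] by auto
      then have "4 ^ k * (cmod (F (r (Suc k)) t - F (r k) t))\<^sup>2 \<le> B"
        using B(1) by (simp add: d_def)
      then have "(cmod (F (r (Suc k)) t - F (r k) t))\<^sup>2 \<le> B * (1/4) ^ k"
        by (simp add: field_simps)
      also have "\<dots> = (sqrt B * (1/2) ^ k)\<^sup>2"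
        using B(1) by (simp add: power_mult_distrib power_mult[of 2 2 k, simplified] power_even_eq[symmetric] power_divide power_mult)
      finally show ?thesis by (rule power2_le_imp_le) (use B(1) in simp)
    qed
    have "summable (\<lambda>k. F (r (Suc k)) t - F (r k) t)"
      by (rule summable_comparison_test'[of "\<lambda>k. sqrt B * (1/2) ^ k" 0])
         (use le in \<open>auto intro!: summable_mult summable_geometric\<close>)
    then have "convergent (\<lambda>n. (\<Sum>k<n. F (r (Suc k)) t - F (r k) t) + F (r 0) t)"
      by (intro convergent_add convergent_const) (simp add: summable_iff_convergent)
    then show ?case by (simp add: sum_lessThan_telescope[of "\<lambda>k. F (r k) t"])
  qed
  define G where "G t = lim (\<lambda>k. F (r k) t)" for t
  have [measurable]: "G \<in> borel_measurable M" unfolding G_def by measurable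
  have conv: "AE t in M. (\<lambda>k. F (r k) t) \<longlonglongrightarrow> G t"
    using AEc by eventually_elim (simp add: G_def convergent_LIMSEQ_iff)
  have fatou: "(\<integral>\<^sup>+t. ennreal ((cmod (F n t - G t))\<^sup>2) \<partial>M) \<le> ennreal (((1/4) ^ k)\<^sup>2)"
    if n: "n \<ge> N k" for n k
  proof -
    have "(\<integral>\<^sup>+t. ennreal ((cmod (F n t - G t))\<^sup>2) \<partial>M)
        = (\<integral>\<^sup>+t. liminf (\<lambda>j. ennreal ((cmod (F n t - F (r j) t))\<^sup>2)) \<partial>M)"
    proof (rule nn_integral_cong_AE)
      show "AE t in M. ennreal ((cmod (F n t - G t))\<^sup>2)
          = liminf (\<lambda>j. ennreal ((cmod (F n t - F (r j) t))\<^sup>2))"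
        using conv by eventually_elim
          (rule lim_imp_Liminf[symmetric], auto intro!: tendsto_intros)
    qed
    also have "\<dots> \<le> liminf (\<lambda>j. \<integral>\<^sup>+t. ennreal ((cmod (F n t - F (r j) t))\<^sup>2) \<partial>M)"
      by (rule nn_integral_liminf) measurable
    also have "\<dots> \<le> ennreal (((1/4) ^ k)\<^sup>2)"
    proof (rule Liminf_le)
      show "\<forall>\<^sub>F j in sequentially.
          (\<integral>\<^sup>+t. ennreal ((cmod (F n t - F (r j) t))\<^sup>2) \<partial>M) \<le> ennreal (((1/4) ^ k)\<^sup>2)"
        using eventually_ge_at_top[of k]
      proof eventually_elim
        case (elim j)
        have "r j \<ge> N k" using r1[of k] monoD[OF rm elim] by simp
        then have "L2n M (\<lambda>t. F n t - F (r j) t) \<le> (1/4) ^ k" using N[OF n, of "r j"] by simp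
        then show ?case
          by (subst nn_integral_sqint) (auto intro!: sqint_diff F ennreal_leI power_mono)
      qed
    qed simp
    finally show ?thesis .
  qed
  have FG: "(\<lambda>t. F (N 0) t - G t) \<in> sqint M"
    using fatou[of 0 "N 0"] by (intro sqint_nn_integral) (auto intro: le_less_trans)
  have G: "G \<in> sqint M"
    using sqint_diff[OF F[of "N 0"] FG] by simp
  have le: "L2n M (\<lambda>t. F n t - G t) \<le> (1/4) ^ k" if "n \<ge> N k" for n k
  proof -
    have "(L2n M (\<lambda>t. F n t - G t))\<^sup>2 \<le> ((1/4) ^ k)\<^sup>2"
      using fatou[OF that] by (subst (asm) nn_integral_sqint) (auto intro: sqint_diff F G)
    then show ?thesis by (rule power2_le_imp_le) simp
  qed
  have "(\<lambda>n. L2n M (\<lambda>t. F n t - G t)) \<longlonglongrightarrow> 0"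
  proof (rule LIMSEQ_I)
    fix e :: real assume "0 < e"
    then obtain k where k: "(1/4) ^ k < e" using real_arch_pow_inv[of e "1/4"] by auto
    show "\<exists>no. \<forall>n\<ge>no. norm (L2n M (\<lambda>t. F n t - G t) - 0) < e"
      using le[of k] k by (intro exI[of _ "N k"]) (auto intro: le_less_trans)
  qed
  with G show ?thesis by blast
qed

lemma L2n_tendsto_inner:
  assumes "\<And>n. F n \<in> sqint M" "G \<in> sqint M" "H \<in> sqint M"
    and "(\<lambda>n. L2n M (\<lambda>t. F n t - G t)) \<longlonglongrightarrow> 0"
  shows "(\<lambda>n. \<integral>t. F n t * cnj (H t) \<partial>M) \<longlonglongrightarrow> (\<integral>t. G t * cnj (H t) \<partial>M)"
proof (rule LIM_zero_cancel, rule Lim_null_comparison)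
  show "\<forall>\<^sub>F n in sequentially. norm ((\<integral>t. F n t * cnj (H t) \<partial>M) - (\<integral>t. G t * cnj (H t) \<partial>M))
      \<le> L2n M (\<lambda>t. F n t - G t) * L2n M H"
  proof (rule always_eventually, rule allI)
    fix n
    have "(\<integral>t. F n t * cnj (H t) \<partial>M) - (\<integral>t. G t * cnj (H t) \<partial>M)
        = (\<integral>t. (F n t - G t) * cnj (H t) \<partial>M)"
      using assms by (simp add: left_diff_distrib sqint_inner_integrable)
    then show "norm ((\<integral>t. F n t * cnj (H t) \<partial>M) - (\<integral>t. G t * cnj (H t) \<partial>M))
      \<le> L2n M (\<lambda>t. F n t - G t) * L2n M H"
      using cauchy_schwarz_L2(2)[OF sqint_diff[OF assms(1)[of n] assms(2)] sqint_cnj[OF assms(3)]]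
      by simp
  qed
  show "(\<lambda>n. L2n M (\<lambda>t. F n t - G t) * L2n M H) \<longlonglongrightarrow> 0"
    using tendsto_mult_right[OF assms(4), of "L2n M H"] by (simp add: mult.commute)
qed

section \<open>The sequence space as a space of square-integrable functions\<close>

lemma l2_eq_sqint: "l2 = sqint (count_space UNIV)"
  by (auto simp: l2_def sqint_def integrable_count_space_nat_iff)

lemma l2_norm_eq_L2n: "x \<in> l2 \<Longrightarrow> l2_norm x = L2n (count_space UNIV) x"
  unfolding l2_norm_def L2n_def
  by (subst integral_count_space_nat) (auto simp: l2_def integrable_count_space_nat_iff)

lemma l2_norm_power2: "x \<in> l2 \<Longrightarrow> (l2_norm x)\<^sup>2 = (\<Sum>k. (cmod (x k))\<^sup>2)"
  by (simp add: l2_norm_def l2_def suminf_nonneg)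

lemma l2_inner_le:
  assumes "x \<in> l2" "y \<in> l2"
  shows "cmod (l2_inner x y) \<le> l2_norm x * l2_norm y"
proof -
  have s: "x \<in> sqint (count_space UNIV)" "y \<in> sqint (count_space UNIV)"
    using assms by (auto simp: l2_eq_sqint)
  show ?thesis
    unfolding l2_inner_def using cauchy_schwarz_L2(2)[OF s(1) sqint_cnj[OF s(2)]]
    by (subst integral_count_space_nat[symmetric])
       (auto simp: l2_norm_eq_L2n assms intro: sqint_inner_integrable s)
qed

text \<open>
  As a complete metric space \<open>\<ell>\<^sub>2\<close> admits Banach's fixed point theorem, which solves the
  matrix equations below.
\<close>

interpretation l2: Metric_space l2 "\<lambda>x y. L2n (count_space UNIV) (\<lambda>k. x k - y k)"
proof
  fix x y z :: "nat \<Rightarrow> complex"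
  show "L2n (count_space UNIV) (\<lambda>k. x k - y k) = L2n (count_space UNIV) (\<lambda>k. y k - x k)"
    by (rule L2n_minus_commute)
  assume x: "x \<in> l2" and y: "y \<in> l2"
  show "(L2n (count_space UNIV) (\<lambda>k. x k - y k) = 0) = (x = y)"
  proof
    assume "L2n (count_space UNIV) (\<lambda>k. x k - y k) = 0"
    moreover have "integrable (count_space UNIV) (\<lambda>k. (cmod (x k - y k))\<^sup>2)"
      using x y by (auto simp: l2_eq_sqint intro: sqint_integrable sqint_diff)
    ultimately have "AE k in count_space UNIV. (cmod (x k - y k))\<^sup>2 = 0"
      by (subst integral_nonneg_eq_0_iff_AE[symmetric]) (auto simp: L2n_def)
    then show "x = y" by (auto simp: AE_count_space)
  qed (simp add: L2n_def)
  assume z: "z \<in> l2"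
  show "L2n (count_space UNIV) (\<lambda>k. x k - z k) \<le> L2n (count_space UNIV) (\<lambda>k. x k - y k)
      + L2n (count_space UNIV) (\<lambda>k. y k - z k)"
    using x y z by (intro L2n_triangle_diff) (auto simp: l2_eq_sqint)
qed simp

lemma l2_mcomplete: "l2.mcomplete"
  unfolding l2.mcomplete_def
proof (intro allI impI)
  fix \<sigma> :: "nat \<Rightarrow> nat \<Rightarrow> complex" assume c: "l2.MCauchy \<sigma>"
  have "range \<sigma> \<subseteq> l2"
    and cau: "\<forall>e>0. \<exists>N. \<forall>n n'. N \<le> n \<longrightarrow> N \<le> n' \<longrightarrow>
      L2n (count_space UNIV) (\<lambda>k. \<sigma> n k - \<sigma> n' k) < e"
    using c unfolding l2.MCauchy_def by blast+
  then have s: "\<sigma> n \<in> sqint (count_space UNIV)" for n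
    unfolding l2_eq_sqint by blast
  obtain G where "G \<in> sqint (count_space UNIV)"
      "(\<lambda>n. L2n (count_space UNIV) (\<lambda>t. \<sigma> n t - G t)) \<longlonglongrightarrow> 0"
    using L2_complete[of \<sigma> "count_space UNIV"] s cau by meson
  then show "\<exists>x. limitin l2.mtopology \<sigma> x sequentially"
    using \<open>range \<sigma> \<subseteq> l2\<close> unfolding l2_eq_sqint[symmetric]
    by (intro exI[of _ G]) (auto simp: l2.limit_metric_sequentially LIMSEQ_def image_subset_iff)
qed

section \<open>Characters and Fourier coefficients\<close>

definition chr :: "int \<Rightarrow> real \<Rightarrow> complex" where
  "chr k t = cis (t * of_int k)"

definition fourier :: "(real \<Rightarrow> complex) \<Rightarrow> int \<Rightarrow> complex" where
  "fourier h k = 1 / (2 * pi) * (LINT t|freq. h t * chr (- k) t)"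

lemma finite_measure_freq [simp]: "finite_measure freq"
  by (rule finite_measure_lebesgue_on) simp

lemma measure_freq [simp]: "measure freq {-pi..pi} = 2 * pi"
  by (simp add: measure_restrict_space)

lemma chr_add: "chr (k + l) t = chr k t * chr l t"
  by (simp add: chr_def cis_mult ring_distribs)

lemma chr_mult: "chr k t * chr l t = chr (k + l) t"
  by (simp add: chr_add)

lemma chr_0 [simp]: "chr 0 t = 1"
  by (simp add: chr_def)

lemma cnj_chr [simp]: "cnj (chr k t) = chr (- k) t"
  by (simp add: chr_def cis_cnj)

lemma norm_chr [simp]: "cmod (chr k t) = 1"
  by (simp add: chr_def)

lemma continuous_on_chr: "continuous_on A (chr k)"
  unfolding chr_def by (intro continuous_intros)

lemma continuous_on_freq_measurable:
  "continuous_on {-pi..pi} h \<Longrightarrow> h \<in> borel_measurable freq"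
  by (rule continuous_imp_measurable_on_sets_lebesgue) auto

lemma chr_measurable [measurable]: "chr k \<in> borel_measurable freq"
  by (intro continuous_on_freq_measurable continuous_on_chr)

lemma sqint_freq_bounded:
  "g \<in> borel_measurable freq \<Longrightarrow> AE t in freq. cmod (g t) \<le> K \<Longrightarrow> g \<in> sqint freq"
  by (rule sqint_bounded) auto

lemma sqint_chr: "chr k \<in> sqint freq"
  by (rule sqint_freq_bounded[where K = 1]) auto

lemma sqint_integrable_freq: "h \<in> sqint freq \<Longrightarrow> integrable freq h"
  using sqint_mult_integrable[OF _ sqint_chr[of 0]] by simp

lemma integrable_mult_chr:
  assumes "integrable freq h"
  shows "integrable freq (\<lambda>t. h t * chr k t)"
  by (rule Bochner_Integration.integrable_bound[OF assms]) (use assms in \<open>auto simp: norm_mult\<close>)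

lemma integral_chr: "(LINT t|freq. chr k t) = (if k = 0 then 2 * pi else 0)"
proof (cases "k = 0")
  case True then show ?thesis by (simp add: complex_eq_iff)
next
  case False
  define F where "F t = cis (t * of_int k) / (\<i> * of_int k)" for t :: real
  have "(chr k has_integral (F pi - F (-pi))) {-pi..pi}"
  proof (rule fundamental_theorem_of_calculus)
    fix x assume "x \<in> {-pi..pi}"
    have "((\<lambda>t. exp (\<i> * of_real (t * of_int k))) has_vector_derivative
        (of_int k * \<i>) * exp (\<i> * of_real (x * of_int k))) (at x within {-pi..pi})"
      by (rule has_vector_derivative_real_field derivative_eq_intros | simp add: algebra_simps)+
    then have "((\<lambda>t. exp (\<i> * of_real (t * of_int k)) / (\<i> * of_int k)) has_vector_derivative
        ((of_int k * \<i>) * exp (\<i> * of_real (x * of_int k))) / (\<i> * of_int k))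
        (at x within {-pi..pi})"
      by (rule has_vector_derivative_divide)
    then show "(F has_vector_derivative chr k x) (at x within {-pi..pi})"
      using False by (simp add: F_def[abs_def] chr_def cis_conv_exp)
  qed simp
  moreover have "F pi = F (-pi)"
  proof -
    have "cis (pi * of_int k) = cis (- (pi * of_int k))"
      by (intro complex_eqI) (auto simp: mult.commute)
    then show ?thesis by (simp add: F_def)
  qed
  ultimately have "integral {-pi..pi} (chr k) = 0"
    by (simp add: integral_unique)
  moreover have "set_integrable lebesgue {-pi..pi} (chr k)"
    using sqint_integrable_freq[OF sqint_chr[of k]]
    by (simp add: set_integrable_def integrable_restrict_space)
  ultimately show ?thesis
    using False set_lebesgue_integral_eq_integral(2)[of "{-pi..pi}" "chr k"]
    by (simp add: integral_restrict_space set_lebesgue_integral_def)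
qed

lemma fourier_chr: "fourier (chr k) l = (if k = l then 1 else 0)"
  by (simp add: fourier_def chr_mult integral_chr)

lemma fourier_add: "integrable freq f \<Longrightarrow> integrable freq g \<Longrightarrow> fourier (\<lambda>t. f t + g t) k = fourier f k + fourier g k"
  by (simp add: fourier_def ring_distribs integrable_mult_chr)

lemma fourier_diff: "integrable freq f \<Longrightarrow> integrable freq g \<Longrightarrow> fourier (\<lambda>t. f t - g t) k = fourier f k - fourier g k"
  by (simp add: fourier_def ring_distribs integrable_mult_chr left_diff_distrib right_diff_distrib)

lemma fourier_cmult: "fourier (\<lambda>t. c * f t) k = c * fourier f k"
  by (simp add: fourier_def mult.assoc)

lemma fourier_0: "fourier (\<lambda>t. 0) k = 0" by (simp add: fourier_def)

lemma fourier_sum: "(\<And>i. i \<in> I \<Longrightarrow> integrable freq (f i)) \<Longrightarrow> fourier (\<lambda>t. \<Sum>i\<in>I. f i t) k = (\<Sum>i\<in>I. fourier (f i) k)"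
  by (induction I rule: infinite_finite_induct) (auto simp: fourier_0 fourier_add)

lemma fourier_inner: "(LINT t|freq. h t * cnj (chr k t)) = 2 * pi * fourier h k"
  by (simp add: fourier_def)

lemma fourier_norm_le:
  assumes "h \<in> sqint freq"
  shows "cmod (fourier h k) \<le> L2n freq h"
proof -
  have "L2n freq (chr k) = sqrt (2 * pi)" by (simp add: L2n_def)
  then have "cmod (LINT t|freq. h t * chr (-k) t) \<le> L2n freq h * sqrt (2 * pi)"
    using cauchy_schwarz_L2(2)[OF assms sqint_chr[of "-k"]] by (simp add: L2n_def)
  also have "sqrt (2 * pi) \<le> 2 * pi"
    using pi_gt3 by (intro real_le_lsqrt) (auto simp: power2_eq_square)
  then have "cmod (LINT t|freq. h t * chr (-k) t) \<le> L2n freq h * (2 * pi)"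
    using calculation by (meson L2n_nonneg mult_left_mono order_trans)
  then show ?thesis
    by (simp add: fourier_def norm_mult norm_divide field_simps)
qed

text \<open>Expanding the square and using orthonormality.\<close>

lemma trig_sum_norm:
  assumes "inj_on \<nu> I" "finite I"
  shows "(LINT t|freq. (cmod (\<Sum>k\<in>I. c k * chr (\<nu> k) t))\<^sup>2) = 2 * pi * (\<Sum>k\<in>I. (cmod (c k))\<^sup>2)"
proof -
  have "complex_of_real (LINT t|freq. (cmod (\<Sum>k\<in>I. c k * chr (\<nu> k) t))\<^sup>2)
      = (LINT t|freq. (\<Sum>k\<in>I. c k * chr (\<nu> k) t) * cnj (\<Sum>k\<in>I. c k * chr (\<nu> k) t))"
    by (simp only: complex_norm_square[symmetric] integral_complex_of_real)
  also have "\<dots> = (LINT t|freq. (\<Sum>k\<in>I. \<Sum>l\<in>I. c k * cnj (c l) * chr (\<nu> k - \<nu> l) t))"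
    by (simp add: sum_product chr_add[of _ "- _", simplified] algebra_simps)
  also have "\<dots> = (\<Sum>k\<in>I. \<Sum>l\<in>I. c k * cnj (c l) * (LINT t|freq. chr (\<nu> k - \<nu> l) t))"
    by (simp add: integrable_sum sqint_integrable_freq sqint_chr)
  also have "\<dots> = (\<Sum>k\<in>I. \<Sum>l\<in>I. if k = l then 2 * pi * (c k * cnj (c k)) else 0)"
    using assms by (intro sum.cong refl) (auto simp: integral_chr inj_on_def)
  also have "\<dots> = complex_of_real (2 * pi * (\<Sum>k\<in>I. (cmod (c k))\<^sup>2))"
    using assms by (simp add: sum_distrib_left complex_norm_square del: of_real_power)
  finally show ?thesis by (simp only: of_real_eq_iff)
qed

text \<open>
  The squared distance of \<open>h\<close> from its partial Fourier sum is nonnegative.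
\<close>

lemma bessel_finite:
  assumes "h \<in> sqint freq" "inj_on \<nu> I" "finite I"
  shows "2 * pi * (\<Sum>k\<in>I. (cmod (fourier h (\<nu> k)))\<^sup>2) \<le> (L2n freq h)\<^sup>2"
proof -
  define S where "S t = (\<Sum>k\<in>I. fourier h (\<nu> k) * chr (\<nu> k) t)" for t
  have S: "S \<in> sqint freq" unfolding S_def by (intro sqint_sum sqint_cmult sqint_chr)
  define E where "E = 2 * pi * (\<Sum>k\<in>I. (cmod (fourier h (\<nu> k)))\<^sup>2)"
  have SS: "(LINT t|freq. (cmod (S t))\<^sup>2) = E"
    unfolding S_def E_def by (rule trig_sum_norm) fact+
  have hS: "(LINT t|freq. h t * cnj (S t)) = of_real E"
  proof -
    have "(LINT t|freq. h t * cnj (S t)) = (LINT t|freq. (\<Sum>k\<in>I. cnj (fourier h (\<nu> k)) * (h t * cnj (chr (\<nu> k) t))))"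
      by (simp add: S_def sum_distrib_left mult_ac)
    also have "\<dots> = (\<Sum>k\<in>I. cnj (fourier h (\<nu> k)) * (2 * pi * fourier h (\<nu> k)))"
      by (subst Bochner_Integration.integral_sum)
         (auto simp: fourier_inner simp del: cnj_chr intro!: integrable_mult_right sqint_inner_integrable assms sqint_chr)
    also have "\<dots> = of_real E"
      by (simp add: E_def sum_distrib_left complex_norm_square mult_ac del: of_real_power)
    finally show ?thesis .
  qed
  define p where "p t = Re (h t * cnj (S t))" for t
  have p: "integrable freq p" "(LINT t|freq. p t) = E"
    unfolding p_def using sqint_inner_integrable[OF assms(1) S] hS
    by (auto simp del: complex_cnj_mult times_complex.sel)
  have "0 \<le> (LINT t|freq. (cmod (h t - S t))\<^sup>2)" by simp
  also have "\<dots> = (LINT t|freq. (cmod (h t))\<^sup>2 - 2 * p t + (cmod (S t))\<^sup>2)"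
    by (intro Bochner_Integration.integral_cong refl)
      (simp add: cmod_power2 p_def, simp add: power2_eq_square algebra_simps)
  also have "\<dots> = (L2n freq h)\<^sup>2 - 2 * E + E"
    using sqint_integrable[OF assms(1)] sqint_integrable[OF S] p SS
    by (simp add: L2n_power2)
  finally show ?thesis unfolding E_def by simp
qed

lemma bessel:
  assumes "h \<in> sqint freq" "inj \<nu>"
  shows "(\<lambda>k. fourier h (\<nu> k)) \<in> l2" "2 * pi * (l2_norm (\<lambda>k. fourier h (\<nu> k)))\<^sup>2 \<le> (L2n freq h)\<^sup>2"
proof -
  have b: "(\<Sum>k\<in>I. (cmod (fourier h (\<nu> k)))\<^sup>2) \<le> (L2n freq h)\<^sup>2 / (2 * pi)" if "finite I" for I
    using bessel_finite[OF assms(1) inj_on_subset[OF assms(2)] that] by (simp add: field_simps)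
  have s: "summable (\<lambda>k. (cmod (fourier h (\<nu> k)))\<^sup>2)"
    by (rule summableI_nonneg_bounded[OF _ b]) auto
  then show l: "(\<lambda>k. fourier h (\<nu> k)) \<in> l2" by (simp add: l2_def)
  have "(\<Sum>k. (cmod (fourier h (\<nu> k)))\<^sup>2) \<le> (L2n freq h)\<^sup>2 / (2 * pi)"
    by (rule suminf_le_const[OF s b]) auto
  then show "2 * pi * (l2_norm (\<lambda>k. fourier h (\<nu> k)))\<^sup>2 \<le> (L2n freq h)\<^sup>2"
    unfolding l2_norm_power2[OF l] by (simp add: field_simps)
qed

section \<open>Riesz--Fischer synthesis\<close>

text \<open>
  The function \<open>F\<close> is the mean-square sum of the terms \<open>c k e\<^sup>i\<^sup>\<nu>\<^sup>(\<^sup>k\<^sup>)\<^sup>t\<close>. Keeping this as a relation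
  covers both \<open>A_fun\<close>, whose series converges pointwise, and \<open>l2_series\<close>, which is only determined up
  to null sets.
\<close>

definition synth :: "(nat \<Rightarrow> int) \<Rightarrow> (nat \<Rightarrow> complex) \<Rightarrow> (real \<Rightarrow> complex) \<Rightarrow> bool" where
  "synth \<nu> c F \<longleftrightarrow> F \<in> sqint freq \<and>
     (\<lambda>n. L2n freq (\<lambda>t. (\<Sum>k<n. c k * chr (\<nu> k) t) - F t)) \<longlonglongrightarrow> 0"

lemma sqint_trig_sum: "(\<lambda>t. \<Sum>k\<in>I. c k * chr (\<nu> k) t) \<in> sqint freq"
  by (intro sqint_sum sqint_cmult sqint_chr)

lemma synth_sqint: "synth \<nu> c F \<Longrightarrow> F \<in> sqint freq"
  by (simp add: synth_def)

text \<open>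
  By orthonormality the partial sums inherit the Cauchy property from the series of the
  \<open>(cmod (c k))\<^sup>2\<close>.
\<close>

lemma synth_exists:
  assumes "c \<in> l2" "inj \<nu>"
  shows "\<exists>F. synth \<nu> c F"
proof -
  define S where "S n t = (\<Sum>k<n. c k * chr (\<nu> k) t)" for n t
  have S: "S n \<in> sqint freq" for n unfolding S_def by (rule sqint_trig_sum)
  have dist: "(L2n freq (\<lambda>t. S n t - S m t))\<^sup>2 = 2 * pi * (\<Sum>k=m..<n. (cmod (c k))\<^sup>2)"
    if "m \<le> n" for m n
  proof -
    have "S n t - S m t = (\<Sum>k=m..<n. c k * chr (\<nu> k) t)" for t
      unfolding S_def using that
      by (metis (no_types, lifting) add_diff_cancel_left' atLeast0LessThan sum.atLeastLessThan_concat zero_le)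
    then show ?thesis
      using trig_sum_norm[of \<nu> "{m..<n}" c] inj_on_subset[OF assms(2)] by (simp add: L2n_power2)
  qed
  have "\<exists>N. \<forall>m\<ge>N. \<forall>n\<ge>N. L2n freq (\<lambda>t. S m t - S n t) < e" if e: "e > 0" for e
  proof -
    have "\<exists>N. \<forall>m\<ge>N. \<forall>n. norm (\<Sum>k=m..<n. (cmod (c k))\<^sup>2) < e\<^sup>2 / (2 * pi)"
      using assms(1) e unfolding l2_def by (simp add: summable_Cauchy)
    then obtain N where N: "\<And>m n. m \<ge> N \<Longrightarrow> (\<Sum>k=m..<n. (cmod (c k))\<^sup>2) < e\<^sup>2 / (2 * pi)"
      by (auto simp: sum_nonneg)
    have "L2n freq (\<lambda>t. S n t - S m t) < e" if "N \<le> m" "m \<le> n" for m n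
    proof (rule power2_less_imp_less)
      show "(L2n freq (\<lambda>t. S n t - S m t))\<^sup>2 < e\<^sup>2"
        using N[OF that(1), of n] dist[OF that(2)] by (simp add: field_simps)
    qed (use e in auto)
    then show ?thesis
      by (intro exI[of _ N]) (metis L2n_minus_commute nle_le)
  qed
  from L2_complete[OF S this] show ?thesis unfolding synth_def S_def by blast
qed

text \<open>
  The identity is plain for partial sums and passes to the limit because the inner product is
  continuous in mean square.
\<close>

lemma synth_inner:
  assumes "synth \<nu> c F" "G \<in> sqint freq"
  shows "(\<lambda>k. c k * (2 * pi * cnj (fourier G (\<nu> k)))) sums (LINT t|freq. F t * cnj (G t))"
proof -
  have "(LINT t|freq. (\<Sum>k<n. c k * chr (\<nu> k) t) * cnj (G t))
      = (\<Sum>k<n. c k * (2 * pi * cnj (fourier G (\<nu> k))))" for n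
  proof -
    have eq: "(LINT t|freq. chr l t * cnj (G t)) = 2 * pi * cnj (fourier G l)" for l
    proof -
      have "(LINT t|freq. chr l t * cnj (G t)) = (LINT t|freq. cnj (G t * cnj (chr l t)))"
        by (simp add: mult.commute)
      also have "\<dots> = cnj (LINT t|freq. G t * cnj (chr l t))" by (rule Bochner_Integration.integral_cnj)
      finally show ?thesis by (simp only: fourier_inner) simp
    qed
    have "(LINT t|freq. (\<Sum>k<n. c k * chr (\<nu> k) t) * cnj (G t))
       = (LINT t|freq. (\<Sum>k<n. c k * (chr (\<nu> k) t * cnj (G t))))"
      by (simp add: sum_distrib_right mult.assoc)
    also have "\<dots> = (\<Sum>k<n. c k * (LINT t|freq. chr (\<nu> k) t * cnj (G t)))"
      by (subst Bochner_Integration.integral_sum)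
         (auto intro!: integrable_mult_right sqint_inner_integrable assms sqint_chr)
    finally show ?thesis by (simp add: eq)
  qed
  moreover have "(\<lambda>n. LINT t|freq. (\<Sum>k<n. c k * chr (\<nu> k) t) * cnj (G t))
       \<longlonglongrightarrow> (LINT t|freq. F t * cnj (G t))"
    using assms by (intro L2n_tendsto_inner sqint_trig_sum) (auto simp: synth_def)
  ultimately show ?thesis by (simp add: sums_def)
qed

lemma synth_fourier:
  assumes "synth \<nu> c F" "inj \<nu>"
  shows "fourier F (\<nu> k) = c k"
proof -
  have "(\<lambda>j. c j * (2 * pi * cnj (fourier (chr (\<nu> k)) (\<nu> j)))) sums (2 * pi * fourier F (\<nu> k))"
    using synth_inner[OF assms(1) sqint_chr[of "\<nu> k"]] by (simp only: fourier_inner)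
  moreover have "(\<lambda>j. c j * (2 * pi * cnj (fourier (chr (\<nu> k)) (\<nu> j)))) = (\<lambda>j. if j = k then 2 * pi * c k else 0)"
    using assms(2) by (auto simp: fourier_chr inj_def)
  ultimately have "(\<lambda>j. if j = k then 2 * pi * c k else 0) sums (2 * pi * fourier F (\<nu> k))" by simp
  moreover have "(\<lambda>j. if j = k then 2 * pi * c k else 0) sums (2 * pi * c k)"
    using sums_single[of k "\<lambda>_. 2 * pi * c k"] by simp
  ultimately show ?thesis using sums_unique2 by fastforce
qed

lemma synth_parseval:
  assumes "synth \<nu> c F" "W \<in> sqint freq" "inj \<nu>"
  shows "l2_inner (\<lambda>k. fourier W (\<nu> k)) c = 1 / (2 * pi) * (LINT t|freq. W t * cnj (F t))"
proof -
  have "(\<lambda>k. cnj (c k * (2 * pi * cnj (fourier W (\<nu> k))))) sums cnj (LINT t|freq. F t * cnj (W t))"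
    using synth_inner[OF assms(1,2)] by (simp only: sums_cnj)
  then have "(\<lambda>k. 1 / (2 * pi) * cnj (c k * (2 * pi * cnj (fourier W (\<nu> k)))))
      sums (1 / (2 * pi) * cnj (LINT t|freq. F t * cnj (W t)))"
    by (rule sums_mult)
  moreover have "cnj (LINT t|freq. F t * cnj (W t)) = (LINT t|freq. W t * cnj (F t))"
    by (subst Bochner_Integration.integral_cnj[symmetric]) (simp add: mult.commute)
  ultimately show ?thesis
    unfolding l2_inner_def by (simp add: sums_iff mult_ac)
qed

lemma synth_norm:
  assumes "synth \<nu> c F" "inj \<nu>"
  shows "c \<in> l2" "2 * pi * (l2_norm c)\<^sup>2 = (L2n freq F)\<^sup>2"
proof -
  have F: "F \<in> sqint freq" using assms by (simp add: synth_def)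
  have c: "(\<lambda>k. fourier F (\<nu> k)) = c" using synth_fourier[OF assms] by auto
  show l: "c \<in> l2" using bessel(1)[OF F assms(2)] c by simp
  have "l2_inner c c = 1 / (2 * pi) * (LINT t|freq. F t * cnj (F t))"
    using synth_parseval[OF assms(1) F assms(2)] c by simp
  moreover have "(LINT t|freq. F t * cnj (F t)) = of_real ((L2n freq F)\<^sup>2)"
    by (simp only: L2n_power2 complex_norm_square[symmetric] integral_complex_of_real)
  moreover have "l2_inner c c = of_real ((l2_norm c)\<^sup>2)"
    using l unfolding l2_inner_def l2_norm_power2[OF l] l2_def
    by (simp add: suminf_of_real flip: complex_norm_square)
  ultimately have "complex_of_real (2 * pi * (l2_norm c)\<^sup>2) = of_real ((L2n freq F)\<^sup>2)"
    by (simp add: field_simps)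
  then show "2 * pi * (l2_norm c)\<^sup>2 = (L2n freq F)\<^sup>2" by (simp only: of_real_eq_iff)
qed

section \<open>Matrices with bounded symbols\<close>

text \<open>
  Depending on the signs of the frequencies \<open>\<mu>\<close> and \<open>\<nu>\<close> these are Toeplitz matrices (\<open>P\<close> and \<open>Q\<close>) or
  Hankel matrices (\<open>R\<close>).
\<close>

definition sym_mat :: "(real \<Rightarrow> real) \<Rightarrow> (nat \<Rightarrow> int) \<Rightarrow> (nat \<Rightarrow> int) \<Rightarrow> nat \<Rightarrow> nat \<Rightarrow> complex" where
  "sym_mat w \<mu> \<nu> l k = fourier (\<lambda>t. of_real (w t)) (\<mu> l - \<nu> k)"

text \<open>
  The functions \<open>A\<close> and \<open>C\<close> are series over \<open>neg_freq\<close> and \<open>pos_freq\<close>; the shift by one in the second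
  makes \<open>pos_freq\<close> enumerate exactly the frequencies that are absent from the past.
\<close>

definition pos_freq :: "nat \<Rightarrow> int" where "pos_freq k = int k + 1"
definition neg_freq :: "nat \<Rightarrow> int" where "neg_freq k = - int k"

lemma inj_pos_freq [simp]: "inj pos_freq" and inj_neg_freq [simp]: "inj neg_freq"
  by (auto simp: inj_def pos_freq_def neg_freq_def)

lemma P_mat_eq: "P_mat f g = sym_mat (\<lambda>t. 1 / (f t + g t)) pos_freq pos_freq"
  by (intro ext) (simp add: P_mat_def sym_mat_def fourier_def chr_def pos_freq_def mult.commute)

lemma R_mat_eq: "R_mat f g = sym_mat (\<lambda>t. f t / (f t + g t)) pos_freq neg_freq"
  by (intro ext) (simp add: R_mat_def sym_mat_def fourier_def chr_def pos_freq_def neg_freq_def mult.commute algebra_simps)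

lemma Q_mat_eq: "Q_mat f g = sym_mat (\<lambda>t. f t * g t / (f t + g t)) neg_freq neg_freq"
  by (intro ext) (simp add: Q_mat_def sym_mat_def fourier_def chr_def neg_freq_def mult.commute algebra_simps)

lemma sqint_symbol:
  assumes "F \<in> sqint freq" "w \<in> borel_measurable freq" "AE t in freq. \<bar>w t\<bar> \<le> K"
  shows "(\<lambda>t. F t * of_real (w t)) \<in> sqint freq"
proof (rule sqint_bound[OF assms(1), where K = K])
  show "AE t in freq. cmod (F t * of_real (w t)) \<le> K * cmod (F t)"
    using assms(3) by eventually_elim (simp add: norm_mult mult.commute mult_right_mono)
qed (use assms in auto)

text \<open>
  A matrix with bounded symbol \<open>w\<close> is multiplication by \<open>w\<close> between two Fourier bases.
\<close>

lemma mat_app_sym: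
  assumes w: "w \<in> borel_measurable freq" "AE t in freq. \<bar>w t\<bar> \<le> K"
    and F: "synth \<nu> x F"
  shows "(\<lambda>k. sym_mat w \<mu> \<nu> l k * x k) sums fourier (\<lambda>t. F t * of_real (w t)) (\<mu> l)"
proof -
  define G where "G t = chr (\<mu> l) t * of_real (w t)" for t
  have G: "G \<in> sqint freq" unfolding G_def by (intro sqint_symbol[OF sqint_chr w])
  have cG: "cnj (fourier G (\<nu> k)) = sym_mat w \<mu> \<nu> l k" for k
  proof -
    have "cnj (fourier G (\<nu> k)) = 1 / (2 * pi) * (LINT t|freq. cnj (G t * chr (- \<nu> k) t))"
      unfolding fourier_def by (subst Bochner_Integration.integral_cnj) simp
    also have "(\<lambda>t. cnj (G t * chr (- \<nu> k) t)) = (\<lambda>t. of_real (w t) * chr (- (\<mu> l - \<nu> k)) t)"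
      by (auto simp: G_def chr_mult mult_ac simp flip: mult.assoc)
    finally show ?thesis by (simp add: sym_mat_def fourier_def)
  qed
  have "(\<lambda>k. 1 / (2 * pi) * (x k * (2 * pi * cnj (fourier G (\<nu> k)))))
      sums (1 / (2 * pi) * (LINT t|freq. F t * cnj (G t)))"
    by (intro sums_mult synth_inner[OF F G])
  moreover have "1 / (2 * pi) * (LINT t|freq. F t * cnj (G t)) = fourier (\<lambda>t. F t * of_real (w t)) (\<mu> l)"
    by (simp add: fourier_def G_def mult_ac)
  moreover have "1 / (2 * pi) * (x k * (2 * pi * cnj (fourier G (\<nu> k)))) = sym_mat w \<mu> \<nu> l k * x k" for k
    by (simp add: cG)
  ultimately show ?thesis by (simp only:)
qed

lemma mat_app_sym_eq:
  assumes "w \<in> borel_measurable freq" "AE t in freq. \<bar>w t\<bar> \<le> K" "synth \<nu> x F"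
  shows "mat_app (sym_mat w \<mu> \<nu>) x = (\<lambda>l. fourier (\<lambda>t. F t * of_real (w t)) (\<mu> l))"
  using mat_app_sym[OF assms] by (simp add: mat_app_def sums_iff fun_eq_iff)

text \<open>
  Bessel's inequality for \<open>F w\<close> and Parseval's identity for \<open>F\<close>, where \<open>F\<close> is synthesized from \<open>x\<close>.
\<close>

lemma sym_mat_bound:
  assumes w: "w \<in> borel_measurable freq" "AE t in freq. \<bar>w t\<bar> \<le> K" and "0 \<le> K"
    and "inj \<mu>" "inj \<nu>" and x: "x \<in> l2"
  shows "mat_app (sym_mat w \<mu> \<nu>) x \<in> l2"
    and "l2_norm (mat_app (sym_mat w \<mu> \<nu>) x) \<le> K * l2_norm x"
    and "summable (\<lambda>k. sym_mat w \<mu> \<nu> l k * x k)"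
proof -
  obtain F where F: "synth \<nu> x F" using synth_exists[OF x \<open>inj \<nu>\<close>] by blast
  have Fs: "F \<in> sqint freq" using F by (rule synth_sqint)
  have wF: "(\<lambda>t. F t * of_real (w t)) \<in> sqint freq" by (rule sqint_symbol[OF Fs w])
  note eq = mat_app_sym_eq[OF w F, of \<mu>]
  show "mat_app (sym_mat w \<mu> \<nu>) x \<in> l2"
    unfolding eq by (rule bessel(1)[OF wF \<open>inj \<mu>\<close>])
  show "summable (\<lambda>k. sym_mat w \<mu> \<nu> l k * x k)"
    using mat_app_sym[OF w F] by (rule sums_summable)
  have "L2n freq (\<lambda>t. F t * of_real (w t)) \<le> K * L2n freq F"
  proof (rule L2n_mono[OF Fs _ _ \<open>0 \<le> K\<close>])
    show "AE t in freq. cmod (F t * of_real (w t)) \<le> K * cmod (F t)"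
      using w(2) by eventually_elim (simp add: norm_mult mult.commute mult_right_mono)
  qed (use wF in auto)
  then have "(L2n freq (\<lambda>t. F t * of_real (w t)))\<^sup>2 \<le> (K * L2n freq F)\<^sup>2"
    by (intro power_mono) auto
  with bessel(2)[OF wF \<open>inj \<mu>\<close>]
  have "2 * pi * (l2_norm (mat_app (sym_mat w \<mu> \<nu>) x))\<^sup>2 \<le> K\<^sup>2 * (L2n freq F)\<^sup>2"
    unfolding eq by (simp add: power_mult_distrib)
  also have "\<dots> = 2 * pi * (K * l2_norm x)\<^sup>2"
    using synth_norm(2)[OF F \<open>inj \<nu>\<close>] by (simp add: power_mult_distrib mult_ac)
  finally have "(l2_norm (mat_app (sym_mat w \<mu> \<nu>) x))\<^sup>2 \<le> (K * l2_norm x)\<^sup>2" by simp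
  then show "l2_norm (mat_app (sym_mat w \<mu> \<nu>) x) \<le> K * l2_norm x"
  proof (rule power2_le_imp_le)
    show "0 \<le> K * l2_norm x"
      using \<open>0 \<le> K\<close> x by (simp add: l2_norm_def l2_def suminf_nonneg)
  qed
qed

lemma sym_mat_l2_operator:
  assumes w: "w \<in> borel_measurable freq" "AE t in freq. \<bar>w t\<bar> \<le> K"
    and "inj \<mu>" "inj \<nu>"
  shows "l2_operator (sym_mat w \<mu> \<nu>)"
proof -
  have K: "AE t in freq. \<bar>w t\<bar> \<le> \<bar>K\<bar>" using w(2) by eventually_elim auto
  show ?thesis
    unfolding l2_operator_def
    using sym_mat_bound[OF w(1) K _ assms(3,4)] by (auto intro!: exI[of _ "\<bar>K\<bar>"])
qed

lemma l2_diff: "x \<in> l2 \<Longrightarrow> y \<in> l2 \<Longrightarrow> (\<lambda>k. x k - y k) \<in> l2"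
  and l2_cmult: "x \<in> l2 \<Longrightarrow> (\<lambda>k. c * x k) \<in> l2"
  and l2_add: "x \<in> l2 \<Longrightarrow> y \<in> l2 \<Longrightarrow> (\<lambda>k. x k + y k) \<in> l2"
  unfolding l2_eq_sqint by (auto intro: sqint_diff sqint_cmult sqint_add)

lemma l2_norm_nonneg: "x \<in> l2 \<Longrightarrow> 0 \<le> l2_norm x"
  by (simp add: l2_norm_eq_L2n)

lemma mat_app_diff:
  assumes "l2_operator M" "x \<in> l2" "y \<in> l2"
  shows "mat_app M (\<lambda>k. x k - y k) = (\<lambda>l. mat_app M x l - mat_app M y l)"
  using assms unfolding mat_app_def l2_operator_def
  by (simp add: right_diff_distrib suminf_diff fun_eq_iff)

text \<open>
  With \<open>\<delta> \<le> w \<le> K\<close> the matrix of \<open>1 - w / K\<close> is a contraction with constant \<open>1 - \<delta> / K\<close>, and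
  \<open>M x = y\<close> says that \<open>x\<close> is a fixed point of \<open>x \<mapsto> x - M x / K + y / K\<close>.
\<close>

lemma sym_mat_invertible:
  assumes w: "w \<in> borel_measurable freq" "AE t in freq. \<delta> \<le> w t \<and> w t \<le> K"
    and "0 < \<delta>" "\<delta> \<le> K" and \<nu>: "inj \<nu>"
  shows "l2_invertible (sym_mat w \<nu> \<nu>)"
proof -
  define M where "M = sym_mat w \<nu> \<nu>"
  have "K > 0" using assms by auto
  have wK: "AE t in freq. \<bar>w t\<bar> \<le> K" using w(2) by eventually_elim (use assms in auto)
  have op: "l2_operator M" unfolding M_def by (rule sym_mat_l2_operator[OF w(1) wK \<nu> \<nu>])
  have Ml2: "mat_app M x \<in> l2" if "x \<in> l2" for x using op that by (simp add: l2_operator_def)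
  define q where "q = 1 - \<delta> / K"
  have q: "0 \<le> q" "q < 1" using assms \<open>K > 0\<close> by (auto simp: q_def)
  have wq: "AE t in freq. \<bar>1 - w t / K\<bar> \<le> q"
    using w(2) by eventually_elim (use \<open>K > 0\<close> in \<open>auto simp: q_def field_simps\<close>)
  have contr: "(\<lambda>k. x k - mat_app M x k / K) = mat_app (sym_mat (\<lambda>t. 1 - w t / K) \<nu> \<nu>) x"
    if x: "x \<in> l2" for x
  proof -
    obtain F where F: "synth \<nu> x F" using synth_exists[OF x \<nu>] by blast
    have Fs: "F \<in> sqint freq" using F by (rule synth_sqint)
    have i: "integrable freq F" "integrable freq (\<lambda>t. F t * of_real (w t))"
      using Fs sqint_symbol[OF Fs w(1) wK] by (auto intro: sqint_integrable_freq)
    have "fourier (\<lambda>t. F t * of_real (1 - w t / K)) l = fourier F l - fourier (\<lambda>t. F t * of_real (w t)) l / K" for l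
    proof -
      have "fourier (\<lambda>t. F t * of_real (1 - w t / K)) l
          = fourier (\<lambda>t. F t - (1 / complex_of_real K) * (F t * of_real (w t))) l"
        by (simp add: algebra_simps)
      also have "\<dots> = fourier F l - (1 / complex_of_real K) * fourier (\<lambda>t. F t * of_real (w t)) l"
        using i by (simp only: fourier_diff integrable_mult_right fourier_cmult)
      finally show ?thesis by simp
    qed
    then show ?thesis
      unfolding M_def using w(1)
      by (simp add: mat_app_sym_eq[OF w(1) wK F] mat_app_sym_eq[OF _ wq F] synth_fourier[OF F \<nu>])
  qed
  have lip: "l2_norm (\<lambda>k. x k - mat_app M x k / K) \<le> q * l2_norm x"
    and Tl2: "(\<lambda>k. x k - mat_app M x k / K) \<in> l2" if "x \<in> l2" for x
    using sym_mat_bound[of "\<lambda>t. 1 - w t / K", OF _ wq q(1) \<nu> \<nu> that] w(1) by (auto simp: contr[OF that])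
  have low: "l2_norm x \<le> 1 / \<delta> * l2_norm (mat_app M x)" if x: "x \<in> l2" for x
  proof -
    have "L2n (count_space UNIV) (\<lambda>k. (x k - mat_app M x k / K) + (1 / K) * mat_app M x k)
        \<le> L2n (count_space UNIV) (\<lambda>k. x k - mat_app M x k / K)
          + L2n (count_space UNIV) (\<lambda>k. (1 / K) * mat_app M x k)"
      by (intro L2n_triangle Tl2[OF x, unfolded l2_eq_sqint] l2_cmult[OF Ml2[OF x], unfolded l2_eq_sqint])
    moreover have "L2n (count_space UNIV) (\<lambda>k. (1 / K) * mat_app M x k)
        \<le> (1 / K) * L2n (count_space UNIV) (mat_app M x)"
      using Ml2[OF x] \<open>K > 0\<close> by (intro L2n_mono) (auto simp: l2_eq_sqint norm_mult norm_divide)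
    ultimately have "l2_norm x \<le> q * l2_norm x + (1 / K) * l2_norm (mat_app M x)"
      using lip[OF x] by (simp add: l2_norm_eq_L2n Tl2 x Ml2)
    then show ?thesis using \<open>K > 0\<close> \<open>\<delta> > 0\<close> by (simp add: q_def field_simps)
  qed
  have inj: "inj_on (mat_app M) l2"
  proof (rule inj_onI)
    fix x y assume xy: "x \<in> l2" "y \<in> l2" "mat_app M x = mat_app M y"
    have "mat_app M (\<lambda>k. x k - y k) = (\<lambda>l. 0)"
      using mat_app_diff[OF op xy(1,2)] xy(3) by simp
    with low[OF l2_diff[OF xy(1,2)]] have "l2_norm (\<lambda>k. x k - y k) \<le> 0"
      by (simp add: l2_norm_def)
    then have "L2n (count_space UNIV) (\<lambda>k. x k - y k) = 0"
      using l2_norm_eq_L2n[OF l2_diff[OF xy(1,2)]]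
        L2n_nonneg[of "count_space UNIV" "\<lambda>k. x k - y k"] by linarith
    then show "x = y" using l2.zero[OF xy(1,2)] by simp
  qed
  have surj: "\<exists>x\<in>l2. mat_app M x = y" if y: "y \<in> l2" for y
  proof -
    define T where "T x = (\<lambda>k. (x k - mat_app M x k / K) + (1 / K) * y k)" for x
    have "\<exists>x. x \<in> l2 \<and> T x = x"
    proof (rule l2.Banach_fixedpoint_thm[OF l2_mcomplete])
      show "l2 \<noteq> {}" using y by auto
      show "T \<in> l2 \<rightarrow> l2"
        unfolding T_def by (intro funcsetI l2_add Tl2 l2_cmult y)
      show "q < 1" by (fact q)
      fix x z assume xz: "x \<in> l2" "z \<in> l2"
      have "(\<lambda>k. T x k - T z k) = (\<lambda>k. (x k - z k) - mat_app M (\<lambda>k. x k - z k) k / K)"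
        by (simp add: T_def mat_app_diff[OF op xz] diff_divide_distrib algebra_simps)
      then show "L2n (count_space UNIV) (\<lambda>k. T x k - T z k) \<le> q * L2n (count_space UNIV) (\<lambda>k. x k - z k)"
        using lip[OF l2_diff[OF xz]] Tl2[OF l2_diff[OF xz]] l2_diff[OF xz]
        by (simp add: l2_norm_eq_L2n)
    qed blast
    then obtain x where x: "x \<in> l2" "T x = x" by blast
    have "mat_app M x k = y k" for k
      using fun_cong[OF x(2), of k] \<open>K > 0\<close> by (simp add: T_def)
    then show ?thesis using x(1) by blast
  qed
  show ?thesis
    unfolding l2_invertible_def M_def[symmetric] bij_betw_def
    using inj surj Ml2 low by blast
qed

section \<open>Trigonometric approximation\<close>

text \<open>Counting the pairs with a given difference, by induction on the size of the square.\<close>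

lemma sum_differences:
  fixes F :: "int \<Rightarrow> 'a::comm_ring_1"
  shows "(\<Sum>j<N. \<Sum>k<N. F (int j - int k)) = (\<Sum>m\<in>{-int N..int N}. of_int (int N - \<bar>m\<bar>) * F m)"
proof (induction N)
  case (Suc N)
  have row: "(\<Sum>k<N. F (int N - int k)) = (\<Sum>m\<in>{1..int N}. F m)"
    by (rule sum.reindex_bij_witness[of _ "\<lambda>m. nat (int N - m)" "\<lambda>k. int N - int k"]) auto
  have col: "(\<Sum>j<N. F (int j - int N)) = (\<Sum>m\<in>{-int N..-1}. F m)"
    by (rule sum.reindex_bij_witness[of _ "\<lambda>m. nat (int N + m)" "\<lambda>j. int j - int N"]) auto
  have "{-int N..int N} = {-int N..-1} \<union> {0..int N}" "{0..int N} = insert 0 {1..int N}" by auto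
  then have all: "(\<Sum>m\<in>{-int N..int N}. F m) = (\<Sum>m\<in>{-int N..-1}. F m) + (F 0 + (\<Sum>m\<in>{1..int N}. F m))"
    using sum.union_disjoint[of "{-int N..-1}" "{0..int N}" F] by auto
  have "(\<Sum>j<Suc N. \<Sum>k<Suc N. F (int j - int k))
     = (\<Sum>j<N. \<Sum>k<N. F (int j - int k)) + (\<Sum>m\<in>{-int N..int N}. F m)"
    unfolding all by (simp add: sum.distrib row col add_ac)
  also have "\<dots> = (\<Sum>m\<in>{-int N..int N}. of_int (int (Suc N) - \<bar>m\<bar>) * F m)"
    unfolding Suc.IH by (simp add: sum.distrib[symmetric] algebra_simps)
  also have "\<dots> = (\<Sum>m\<in>{-int (Suc N)..int (Suc N)}. of_int (int (Suc N) - \<bar>m\<bar>) * F m)"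
  proof (rule sum.mono_neutral_left)
    have "\<bar>i\<bar> = int (Suc N)" if "i \<in> {-int (Suc N)..int (Suc N)} - {-int N..int N}" for i
      using that by auto
    then show "\<forall>i\<in>{-int (Suc N)..int (Suc N)} - {-int N..int N}. of_int (int (Suc N) - \<bar>i\<bar>) * F i = 0"
      by simp
  qed auto
  finally show ?case .
qed simp

text \<open>
  The Cesaro means of the partial Fourier sums. The sum over frequencies shows which frequencies
  occur; the integral against the kernel shows positivity and bounds.
\<close>

definition fejer :: "nat \<Rightarrow> (real \<Rightarrow> complex) \<Rightarrow> real \<Rightarrow> complex" where
  "fejer N h x = (\<Sum>m\<in>{-int N..int N}. of_real (1 - \<bar>of_int m\<bar> / N) * fourier h m * chr m x)"

definition fejer_kernel :: "nat \<Rightarrow> real \<Rightarrow> real \<Rightarrow> real" where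
  "fejer_kernel N x t = (cmod (\<Sum>j<N. chr (int j) (x - t)))\<^sup>2 / N"

lemma chr_arg_diff: "chr k (x - t) = chr k x * chr (- k) t"
  by (simp add: chr_def cis_mult algebra_simps)

lemma fejer_kernel_eq:
  assumes "N > 0"
  shows "of_real (fejer_kernel N x t)
    = (\<Sum>m\<in>{-int N..int N}. of_real (1 - \<bar>of_int m\<bar> / N) * (chr m x * chr (- m) t))"
proof -
  have "complex_of_real (fejer_kernel N x t)
      = (\<Sum>j<N. \<Sum>k<N. chr (int j - int k) (x - t)) / N"
    by (simp add: fejer_kernel_def complex_norm_square sum_product chr_mult del: of_real_power)
  also have "\<dots> = (\<Sum>m\<in>{-int N..int N}. of_int (int N - \<bar>m\<bar>) * chr m (x - t) / N)"
    by (simp only: sum_differences[of "\<lambda>m. chr m (x - t)"] sum_divide_distrib)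
  also have "\<dots> = (\<Sum>m\<in>{-int N..int N}. of_real (1 - \<bar>of_int m\<bar> / N) * (chr m x * chr (- m) t))"
  proof (intro sum.cong refl)
    fix m :: int
    have "real_of_int (int N - \<bar>m\<bar>) = (1 - \<bar>of_int m\<bar> / N) * N"
      using assms by (simp add: field_simps)
    then have "complex_of_int (int N - \<bar>m\<bar>) = of_real ((1 - \<bar>of_int m\<bar> / N) * N)"
      by (metis of_real_of_int_eq)
    then show "of_int (int N - \<bar>m\<bar>) * chr m (x - t) / N
        = of_real (1 - \<bar>of_int m\<bar> / N) * (chr m x * chr (- m) t)"
      using assms by (simp only: chr_arg_diff) simp
  qed
  finally show ?thesis .
qed

lemma fejer_kernel_nonneg [simp]: "0 \<le> fejer_kernel N x t"
  by (simp add: fejer_kernel_def)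

lemma continuous_on_fejer_kernel: "continuous_on A (fejer_kernel N x)"
  unfolding fejer_kernel_def chr_def divide_inverse by (intro continuous_intros)

lemma fejer_kernel_measurable [measurable]: "fejer_kernel N x \<in> borel_measurable freq"
  by (intro continuous_on_freq_measurable continuous_on_fejer_kernel)

lemma fejer_eq_integral:
  fixes h :: "real \<Rightarrow> complex"
  assumes "N > 0" "integrable freq h"
  shows "fejer N h x = 1 / (2 * pi) * (LINT t|freq. h t * of_real (fejer_kernel N x t))"
    and "integrable freq (\<lambda>t. h t * of_real (fejer_kernel N x t))"
proof -
  have eq: "h t * of_real (fejer_kernel N x t)
     = (\<Sum>m\<in>{-int N..int N}. of_real (1 - \<bar>of_int m\<bar> / N) * chr m x * (h t * chr (- m) t))" for t
    by (simp add: fejer_kernel_eq[OF assms(1)] sum_distrib_left mult_ac)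
  have i: "integrable freq (\<lambda>t. of_real (1 - \<bar>of_int m\<bar> / N) * chr m x * (h t * chr (- m) t))" for m
    by (intro integrable_mult_right integrable_mult_chr assms(2))
  show "integrable freq (\<lambda>t. h t * of_real (fejer_kernel N x t))"
    unfolding eq by (intro Bochner_Integration.integrable_sum i)
  show "fejer N h x = 1 / (2 * pi) * (LINT t|freq. h t * of_real (fejer_kernel N x t))"
    unfolding eq by (subst Bochner_Integration.integral_sum[OF i])
      (simp only: fejer_def fourier_def sum_distrib_left integral_mult_right_zero, simp only: mult_ac)
qed

lemma fejer_1:
  assumes "N > 0" shows "fejer N (\<lambda>_. 1) x = 1"
proof -
  have "fourier (\<lambda>_. 1) m = (if m = 0 then 1 else 0)" for m
    using fourier_chr[of 0 m] by (simp add: chr_0[abs_def] fourier_def)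
  then have "fejer N (\<lambda>_. 1) x = (\<Sum>m\<in>{-int N..int N}. if m = 0 then 1 else 0)"
    unfolding fejer_def by (intro sum.cong) auto
  then show ?thesis by simp
qed

lemma fejer_kernel_integral:
  assumes "N > 0"
  shows "integrable freq (fejer_kernel N x)" "(LINT t|freq. fejer_kernel N x t) = 2 * pi"
proof -
  have 1: "integrable freq (\<lambda>t. 1 :: complex)" using sqint_integrable_freq[OF sqint_chr[of 0]] by simp
  have "integrable freq (\<lambda>t. Re (1 * of_real (fejer_kernel N x t)))"
    using fejer_eq_integral(2)[OF assms 1] by (rule integrable_Re)
  then show i: "integrable freq (fejer_kernel N x)" by simp
  have "1 / (2 * pi) * (LINT t|freq. complex_of_real (fejer_kernel N x t)) = 1"
    using fejer_eq_integral(1)[OF assms 1, of x] fejer_1[OF assms] by simp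
  then have "complex_of_real (1 / (2 * pi) * (LINT t|freq. fejer_kernel N x t)) = of_real 1"
    by simp
  then have "1 / (2 * pi) * (LINT t|freq. fejer_kernel N x t) = 1"
    by (simp only: of_real_eq_iff)
  then show "(LINT t|freq. fejer_kernel N x t) = 2 * pi" by (simp add: field_simps)
qed

text \<open>
  Averaging against a nonnegative kernel of total mass \<open>2 \<pi>\<close> does not increase the bound.
\<close>

lemma fejer_bounded:
  fixes h :: "real \<Rightarrow> complex"
  assumes "N > 0" "integrable freq h" "AE t in freq. cmod (h t) \<le> B"
  shows "cmod (fejer N h x) \<le> B"
proof -
  have "cmod (LINT t|freq. h t * of_real (fejer_kernel N x t))
     \<le> (LINT t|freq. cmod (h t * of_real (fejer_kernel N x t)))"
    by (rule integral_norm_bound)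
  also have "\<dots> \<le> (LINT t|freq. B * fejer_kernel N x t)"
  proof (rule integral_mono_AE)
    show "AE t in freq. cmod (h t * of_real (fejer_kernel N x t)) \<le> B * fejer_kernel N x t"
      using assms(3) by eventually_elim (simp add: norm_mult mult_right_mono)
  qed (use fejer_eq_integral(2)[OF assms(1,2)] fejer_kernel_integral(1)[OF assms(1)] in auto)
  also have "\<dots> = B * (2 * pi)" by (simp add: fejer_kernel_integral[OF assms(1)])
  finally show ?thesis
    unfolding fejer_eq_integral(1)[OF assms(1,2)] by (simp add: norm_mult norm_divide field_simps)
qed

lemma fejer_integrable: "integrable freq (fejer N h)"
  unfolding fejer_def by (intro sqint_integrable_freq sqint_trig_sum)

lemma fejer_diff:
  "integrable freq f \<Longrightarrow> integrable freq g \<Longrightarrow> fejer N (\<lambda>t. f t - g t) x = fejer N f x - fejer N g x"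
  by (simp only: fejer_def fourier_diff left_diff_distrib right_diff_distrib sum_subtractf)

text \<open>
  The kernel is a finite sum of products \<open>e\<^sup>i\<^sup>m\<^sup>x e\<^sup>-\<^sup>i\<^sup>m\<^sup>t\<close>, so after replacing \<open>h\<close> by \<open>cmod h\<close> the integral
  over \<open>x\<close> leaves only the frequency \<open>0\<close>, and integrating over a product space is avoided.
\<close>

lemma fejer_L1:
  fixes h :: "real \<Rightarrow> complex"
  assumes "N > 0" "integrable freq h"
  shows "(LINT x|freq. cmod (fejer N h x)) \<le> (LINT t|freq. cmod (h t))"
proof -
  have i: "integrable freq (\<lambda>t. complex_of_real (cmod (h t)))"
    using assms(2) by (intro integrable_of_real integrable_norm)
  have le: "cmod (fejer N h x) \<le> Re (fejer N (\<lambda>t. of_real (cmod (h t))) x)" for x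
  proof -
    have "cmod (LINT t|freq. h t * of_real (fejer_kernel N x t))
       \<le> (LINT t|freq. cmod (h t * of_real (fejer_kernel N x t)))"
      by (rule integral_norm_bound)
    also have "\<dots> = (LINT t|freq. cmod (h t) * fejer_kernel N x t)"
      by (simp add: norm_mult)
    finally show ?thesis
      unfolding fejer_eq_integral(1)[OF assms] fejer_eq_integral(1)[OF assms(1) i]
      by (simp add: norm_mult norm_divide field_simps flip: of_real_mult)
  qed
  have "(LINT x|freq. cmod (fejer N h x)) \<le> (LINT x|freq. Re (fejer N (\<lambda>t. of_real (cmod (h t))) x))"
    using le by (intro integral_mono integrable_Re integrable_norm fejer_integrable)
  also have "\<dots> = Re (LINT x|freq. fejer N (\<lambda>t. of_real (cmod (h t))) x)"
    by (rule integral_Re[OF fejer_integrable])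
  also have "(LINT x|freq. fejer N (\<lambda>t. of_real (cmod (h t))) x)
     = (\<Sum>m\<in>{-int N..int N}. of_real (1 - \<bar>of_int m\<bar> / N) * fourier (\<lambda>t. of_real (cmod (h t))) m
          * (LINT x|freq. chr m x))"
    unfolding fejer_def
    by (subst Bochner_Integration.integral_sum)
       (auto intro!: sqint_integrable_freq[OF sqint_cmult] sqint_chr)
  also have "\<dots> = (\<Sum>m\<in>{-int N..int N}. if m = 0 then 2 * pi * fourier (\<lambda>t. of_real (cmod (h t))) 0 else 0)"
    by (intro sum.cong refl) (simp add: integral_chr)
  also have "\<dots> = of_real (LINT t|freq. cmod (h t))"
    by (simp add: fourier_def)
  finally show ?thesis by simp
qed

inductive trig_poly :: "(real \<Rightarrow> complex) \<Rightarrow> bool" where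
  monomial: "trig_poly (\<lambda>t. c * chr k t)"
| add: "trig_poly p \<Longrightarrow> trig_poly q \<Longrightarrow> trig_poly (\<lambda>t. p t + q t)"

lemma trig_poly_mult:
  assumes "trig_poly p" "trig_poly q"
  shows "trig_poly (\<lambda>t. p t * q t)"
  using assms(1)
proof induction
  case (monomial c k)
  show ?case using assms(2)
  proof induction
    case (monomial d l)
    have "(\<lambda>t. c * chr k t * (d * chr l t)) = (\<lambda>t. (c * d) * chr (k + l) t)"
      by (auto simp: chr_add)
    then show ?case by (simp only: trig_poly.monomial)
  next
    case (add p q)
    from trig_poly.add[OF add.IH] show ?case by (simp only: distrib_left)
  qed
next
  case (add p q)
  from trig_poly.add[OF add.IH] show ?case by (simp only: distrib_right)
qed

lemma trig_poly_sqint: "trig_poly p \<Longrightarrow> p \<in> sqint freq"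
proof (induction rule: trig_poly.induct)
  case (monomial c k) show ?case by (intro sqint_cmult sqint_chr)
next
  case (add p q) then show ?case by (intro sqint_add)
qed

lemma real_polynomial_cis_trig_poly:
  assumes "real_polynomial_function (q :: complex \<Rightarrow> real)"
  shows "trig_poly (\<lambda>t. complex_of_real (q (cis t)))"
  using assms
proof induction
  case (linear f)
  have "complex_of_real (f (cis t))
      = Complex (f 1 / 2) (- f \<i> / 2) * chr 1 t
        + Complex (f 1 / 2) (f \<i> / 2) * chr (-1) t" for t
  proof -
    have "cis t = cos t *\<^sub>R 1 + sin t *\<^sub>R \<i>" by (simp add: complex_eq_iff)
    then have "f (cis t) = cos t * f 1 + sin t * f \<i>"
      using linear by (simp only: linear_simps real_scaleR_def)
    then show ?thesis by (simp add: complex_eq_iff chr_def)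
  qed
  then have "(\<lambda>t. complex_of_real (f (cis t))) = (\<lambda>t. Complex (f 1 / 2) (- f \<i> / 2) * chr 1 t
        + Complex (f 1 / 2) (f \<i> / 2) * chr (-1) t)" by (rule ext)
  then show ?case by (simp only: trig_poly.intros)
next
  case (const c)
  show ?case using trig_poly.monomial[of "of_real c" 0] by simp
next
  case (add f g)
  from trig_poly.add[OF add.IH] show ?case by (simp only: of_real_add)
next
  case (mult f g)
  from trig_poly_mult[OF mult.IH] show ?case by (simp only: of_real_mult)
qed

text \<open>Stone--Weierstrass on the unit circle, pulled back by \<open>cis\<close>.\<close>

lemma continuous_periodic_trig_approx:
  assumes cont: "continuous_on {-pi..pi} \<psi>" and per: "\<psi> (-pi) = \<psi> pi" and "0 < e"
  shows "\<exists>p. trig_poly p \<and> (\<forall>t\<in>{-pi..pi}. cmod (\<psi> t - p t) < e)"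
proof -
  define \<Psi> where "\<Psi> z = \<psi> (Arg z)" for z
  have Arg_cis': "\<Psi> (cis t) = \<psi> t" if "t \<in> {-pi..pi}" for t
  proof (cases "t = -pi")
    case True
    then have "cis t = cis pi" by (simp add: complex_eq_iff)
    then show ?thesis using True per Arg_cis[of pi] by (simp add: \<Psi>_def)
  next
    case False
    with that show ?thesis by (simp add: \<Psi>_def Arg_cis)
  qed
  have img: "cis ` {-pi..pi} = sphere 0 1"
  proof
    show "sphere 0 1 \<subseteq> cis ` {-pi..pi}"
    proof
      fix z :: complex assume "z \<in> sphere 0 1"
      then have "cmod z = 1" by simp
      moreover from this have "z \<noteq> 0" by auto
      ultimately have "z = cis (Arg z)" using Arg_eq[of z] by (simp add: cis_conv_exp)
      moreover have "Arg z \<in> {-pi..pi}" using mpi_less_Arg[of z] Arg_le_pi[of z] by auto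
      ultimately show "z \<in> cis ` {-pi..pi}" by blast
    qed
  qed auto
  have "continuous_on (sphere 0 1) \<Psi>"
  proof (rule continuous_on_open_gen[THEN iffD2, of _ _ UNIV])
    show "\<forall>U. openin (top_of_set UNIV) U \<longrightarrow> openin (top_of_set (sphere 0 1)) (sphere 0 1 \<inter> \<Psi> -` U)"
    proof (intro allI impI)
      fix U :: "complex set" assume "openin (top_of_set UNIV) U"
      then have "openin (top_of_set {-pi..pi}) ({-pi..pi} \<inter> \<psi> -` U)"
        using cont by (simp add: continuous_openin_preimage_gen)
      moreover have "{-pi..pi} \<inter> cis -` (sphere 0 1 \<inter> \<Psi> -` U) = {-pi..pi} \<inter> \<psi> -` U"
        using Arg_cis' by auto
      ultimately show "openin (top_of_set (sphere 0 1)) (sphere 0 1 \<inter> \<Psi> -` U)"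
        using Abstract_Topology_2.continuous_imp_quotient_map[OF _ img compact_Icc, of "sphere 0 1 \<inter> \<Psi> -` U"]
        by (simp add: continuous_on_cis)
    qed
  qed auto
  then obtain g where g: "polynomial_function g" "\<And>z. z \<in> sphere 0 1 \<Longrightarrow> cmod (\<Psi> z - g z) < e"
    using Stone_Weierstrass_polynomial_function[OF compact_sphere _ \<open>0 < e\<close>, of 0 1 \<Psi>] by auto
  have "trig_poly (\<lambda>t. of_real (Re (g (cis t))) + \<i> * of_real (Im (g (cis t))))"
  proof (rule trig_poly.add)
    show "trig_poly (\<lambda>t. of_real (Re (g (cis t))))"
      using g(1) bounded_linear_Re unfolding polynomial_function_def
      by (intro real_polynomial_cis_trig_poly) (auto simp: o_def)
    have "trig_poly (\<lambda>t. of_real (Im (g (cis t))))"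
      using g(1) bounded_linear_Im unfolding polynomial_function_def
      by (intro real_polynomial_cis_trig_poly) (auto simp: o_def)
    then show "trig_poly (\<lambda>t. \<i> * of_real (Im (g (cis t))))"
      using trig_poly_mult[OF trig_poly.monomial[of \<i> 0]] by simp
  qed
  then have "trig_poly (\<lambda>t. g (cis t))" by (simp add: complex_eq[symmetric])
  moreover have "cmod (\<psi> t - g (cis t)) < e" if "t \<in> {-pi..pi}" for t
    using g(2)[of "cis t"] Arg_cis'[OF that] by simp
  ultimately show ?thesis by blast
qed

lemma AE_freq_interior: "AE t in freq. -pi < t \<and> t < pi"
proof -
  have "AE t in lebesgue. t \<noteq> -pi" "AE t in lebesgue. t \<noteq> pi"
    using AE_not_in[of "{-pi}" lebesgue] AE_not_in[of "{pi}" lebesgue]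
    by (simp_all flip: negligible_iff_null_sets)
  then show ?thesis
    by (subst AE_restrict_space_iff) (auto elim!: eventually_elim2 simp: less_le)
qed

text \<open>
  A bounded function is an almost everywhere limit of continuous functions; projecting these to the
  ball of radius \<open>B\<close> and cutting them off near the end points keeps the limit and makes them
  periodic.
\<close>

lemma bounded_periodic_approx:
  assumes h: "h \<in> borel_measurable freq" "AE t in freq. cmod (h t) \<le> B"
  shows "\<exists>\<psi>. (\<forall>n. continuous_on {-pi..pi} (\<psi> n) \<and> \<psi> n (-pi) = \<psi> n pi \<and> (\<forall>t\<in>{-pi..pi}. cmod (\<psi> n t) \<le> \<bar>B\<bar>))
    \<and> (AE t in freq. (\<lambda>n. \<psi> n t) \<longlonglongrightarrow> h t)"
proof -
  have "h measurable_on {-pi..pi}"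
    using h(1) by (simp add: measurable_on_iff_borel_measurable)
  then obtain N g where N: "negligible N" and g: "\<And>n. continuous_on UNIV (g n)"
    and lim: "\<And>t. t \<notin> N \<Longrightarrow> (\<lambda>n. g n t) \<longlonglongrightarrow> (if t \<in> {-pi..pi} then h t else 0)"
    unfolding measurable_on_def by blast
  define \<theta> where "\<theta> n t = min 1 (real n * (pi - \<bar>t\<bar>))" for n t
  define \<psi> where "\<psi> n t = \<theta> n t *\<^sub>R closest_point (cball 0 \<bar>B\<bar>) (g n t)" for n t
  have cp: "continuous_on A (closest_point (cball (0::complex) \<bar>B\<bar>))" for A
    by (intro continuous_on_closest_point) auto
  have "continuous_on {-pi..pi} (\<psi> n)" for n
    unfolding \<psi>_def \<theta>_def
    by (intro continuous_intros continuous_on_compose2[OF cp[of UNIV]] continuous_on_subset[OF g]) auto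
  moreover have "\<psi> n (-pi) = \<psi> n pi" for n by (simp add: \<psi>_def \<theta>_def)
  moreover have "cmod (\<psi> n t) \<le> \<bar>B\<bar>" if "t \<in> {-pi..pi}" for n t
  proof -
    have "\<bar>\<theta> n t\<bar> \<le> 1" using that by (auto simp: \<theta>_def)
    moreover have "cmod (closest_point (cball 0 \<bar>B\<bar>) (g n t)) \<le> \<bar>B\<bar>"
      using closest_point_in_set[of "cball 0 \<bar>B\<bar>" "g n t"] by (auto simp: dist_norm)
    ultimately show ?thesis
      using mult_mono[of "\<bar>\<theta> n t\<bar>" 1] by (fastforce simp: \<psi>_def)
  qed
  moreover have "AE t in freq. (\<lambda>n. \<psi> n t) \<longlonglongrightarrow> h t"
  proof -
    have "AE t in lebesgue. t \<notin> N"
      using N by (auto simp: negligible_iff_null_sets intro: AE_not_in)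
    then have "AE t in freq. t \<notin> N" by (subst AE_restrict_space_iff) (auto elim: eventually_mono)
    then show ?thesis using h(2) AE_freq_interior
    proof eventually_elim
      case (elim t)
      have "(\<lambda>n. closest_point (cball 0 \<bar>B\<bar>) (g n t)) \<longlonglongrightarrow> closest_point (cball 0 \<bar>B\<bar>) (h t)"
        using lim[OF elim(1)] elim(3) cp[of UNIV]
        by (auto simp: continuous_on_eq_continuous_at intro: isCont_tendsto_compose)
      moreover have "closest_point (cball 0 \<bar>B\<bar>) (h t) = h t"
        using elim(2) by (intro closest_point_self) (auto simp: dist_norm)
      moreover have "(\<lambda>n. \<theta> n t) \<longlonglongrightarrow> 1"
      proof (rule tendsto_eventually)
        obtain n0 :: nat where n0: "1 < real n0 * (pi - \<bar>t\<bar>)"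
          using ex_less_of_nat_mult[of "pi - \<bar>t\<bar>" 1] elim(3) by (auto simp: abs_less_iff)
        show "\<forall>\<^sub>F n in sequentially. \<theta> n t = 1"
          using eventually_ge_at_top[of n0]
        proof eventually_elim
          case (elim n)
          then have "real n0 * (pi - \<bar>t\<bar>) \<le> real n * (pi - \<bar>t\<bar>)"
            using \<open>- pi < t \<and> t < pi\<close> by (intro mult_right_mono) auto
          then show ?case using n0 by (simp add: \<theta>_def)
        qed
      qed
      ultimately have "(\<lambda>n. \<psi> n t) \<longlonglongrightarrow> 1 *\<^sub>R h t"
        unfolding \<psi>_def by (intro tendsto_scaleR) auto
      then show ?case by simp
    qed
  qed
  ultimately show ?thesis by blast
qed

lemma trig_poly_dense_L1:
  assumes h: "h \<in> borel_measurable freq" "AE t in freq. cmod (h t) \<le> B" and "0 < e"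
  shows "\<exists>p. trig_poly p \<and> (LINT t|freq. cmod (h t - p t)) < e"
proof -
  obtain \<psi> where cont: "\<And>n. continuous_on {-pi..pi} (\<psi> n)" and per: "\<And>n. \<psi> n (-pi) = \<psi> n pi"
    and bd: "\<And>n t. t \<in> {-pi..pi} \<Longrightarrow> cmod (\<psi> n t) \<le> \<bar>B\<bar>"
    and lim: "AE t in freq. (\<lambda>n. \<psi> n t) \<longlonglongrightarrow> h t"
    using bounded_periodic_approx[OF h] by blast
  have [measurable]: "\<psi> n \<in> borel_measurable freq" "h \<in> borel_measurable freq" for n
    using continuous_on_freq_measurable[OF cont] h(1) by blast+
  have hi: "integrable freq h" using sqint_freq_bounded[OF h] by (rule sqint_integrable_freq)
  have \<psi>i: "integrable freq (\<psi> n)" for n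
    using bd by (intro sqint_integrable_freq sqint_freq_bounded[where K = "\<bar>B\<bar>"]) (auto intro!: AE_I2)
  have "(\<lambda>n. LINT t|freq. cmod (h t - \<psi> n t)) \<longlonglongrightarrow> (LINT t|freq. 0)"
  proof (rule integral_dominated_convergence[where w = "\<lambda>_. 2 * \<bar>B\<bar>"])
    show "AE t in freq. (\<lambda>n. cmod (h t - \<psi> n t)) \<longlonglongrightarrow> 0"
      using lim
    proof eventually_elim
      case (elim t)
      have "(\<lambda>n. cmod (h t - \<psi> n t)) \<longlonglongrightarrow> cmod (h t - h t)"
        by (intro tendsto_intros elim)
      then show ?case by simp
    qed
    show "AE t in freq. norm (cmod (h t - \<psi> n t)) \<le> 2 * \<bar>B\<bar>" for n
      using h(2) AE_freq_interior
    proof eventually_elim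
      case (elim t)
      then show ?case using norm_triangle_ineq4[of "h t" "\<psi> n t"] bd[of t n] by auto
    qed
  qed auto
  then have "(\<lambda>n. LINT t|freq. cmod (h t - \<psi> n t)) \<longlonglongrightarrow> 0" by simp
  then obtain n where n: "(LINT t|freq. cmod (h t - \<psi> n t)) < e / 2"
    using LIMSEQ_D[of "\<lambda>n. LINT t|freq. cmod (h t - \<psi> n t)" 0 "e / 2"] \<open>0 < e\<close> by auto
  obtain p where p: "trig_poly p" "\<And>t. t \<in> {-pi..pi} \<Longrightarrow> cmod (\<psi> n t - p t) < e / (4 * pi)"
    using continuous_periodic_trig_approx[OF cont[of n] per[of n], of "e / (4 * pi)"] \<open>0 < e\<close> by auto
  have pi': "integrable freq p" using trig_poly_sqint[OF p(1)] by (rule sqint_integrable_freq)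
  have "(LINT t|freq. cmod (h t - p t)) \<le> (LINT t|freq. cmod (h t - \<psi> n t) + e / (4 * pi))"
  proof (rule integral_mono)
    show "cmod (h t - p t) \<le> cmod (h t - \<psi> n t) + e / (4 * pi)" if "t \<in> space freq" for t
      using norm_triangle_ineq[of "h t - \<psi> n t" "\<psi> n t - p t"] p(2)[of t] that by auto
  qed (use hi \<psi>i pi' in auto)
  also have "\<dots> = (LINT t|freq. cmod (h t - \<psi> n t)) + e / 2"
    using hi \<psi>i by (subst Bochner_Integration.integral_add) auto
  also have "\<dots> < e" using n by simp
  finally show ?thesis using p(1) by blast
qed

lemma fejer_add:
  "integrable freq f \<Longrightarrow> integrable freq g \<Longrightarrow> fejer N (\<lambda>t. f t + g t) x = fejer N f x + fejer N g x"
  by (simp only: fejer_def fourier_add distrib_left distrib_right sum.distrib)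

lemma fejer_monomial:
  "fejer N (\<lambda>t. c * chr k t) x = (if \<bar>k\<bar> \<le> int N then of_real (1 - \<bar>of_int k\<bar> / N) * c * chr k x else 0)"
proof -
  have "fejer N (\<lambda>t. c * chr k t) x = (\<Sum>m\<in>{-int N..int N}. if k = m then of_real (1 - \<bar>of_int k\<bar> / N) * c * chr k x else 0)"
    unfolding fejer_def by (intro sum.cong refl) (simp add: fourier_cmult fourier_chr)
  also have "\<dots> = (if k \<in> {-int N..int N} then of_real (1 - \<bar>of_int k\<bar> / N) * c * chr k x else 0)"
    by (rule sum.delta') simp
  also have "(k \<in> {-int N..int N}) = (\<bar>k\<bar> \<le> int N)" by auto
  finally show ?thesis .
qed

lemma trig_poly_fejer_L1:
  assumes "trig_poly p"
  shows "(\<lambda>N. LINT t|freq. cmod (fejer N p t - p t)) \<longlonglongrightarrow> 0"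
  using assms
proof induction
  case (monomial c k)
  have "(\<lambda>N. cmod c * (\<bar>of_int k\<bar> / real N) * (2 * pi)) \<longlonglongrightarrow> cmod c * 0 * (2 * pi)"
    by (intro tendsto_intros lim_const_over_n)
  moreover have "(LINT t|freq. cmod (fejer N (\<lambda>t. c * chr k t) t - c * chr k t))
      = cmod c * (\<bar>of_int k\<bar> / real N) * (2 * pi)" if "N \<ge> nat \<bar>k\<bar>" for N
  proof -
    have "\<bar>k\<bar> \<le> int N" using that by simp
    then have "fejer N (\<lambda>t. c * chr k t) t - c * chr k t = - (of_real (\<bar>of_int k\<bar> / N) * c * chr k t)" for t
      by (simp add: fejer_monomial left_diff_distrib)
    then show ?thesis by (simp add: norm_mult norm_divide)
  qed
  ultimately show ?case
    by (subst tendsto_cong[where g = "\<lambda>N. cmod c * (\<bar>of_int k\<bar> / real N) * (2 * pi)"])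
       (auto simp: eventually_at_top_linorder)
next
  case (add p q)
  have i: "integrable freq p" "integrable freq q"
    using add.hyps by (auto intro: sqint_integrable_freq trig_poly_sqint)
  have le: "(LINT t|freq. cmod (fejer N (\<lambda>t. p t + q t) t - (p t + q t)))
      \<le> (LINT t|freq. cmod (fejer N p t - p t)) + (LINT t|freq. cmod (fejer N q t - q t))" for N
  proof -
    have "(LINT t|freq. cmod (fejer N (\<lambda>t. p t + q t) t - (p t + q t)))
      \<le> (LINT t|freq. cmod (fejer N p t - p t) + cmod (fejer N q t - q t))"
    proof (rule integral_mono)
      show "cmod (fejer N (\<lambda>t. p t + q t) t - (p t + q t))
          \<le> cmod (fejer N p t - p t) + cmod (fejer N q t - q t)" for t
        using norm_triangle_ineq[of "fejer N p t - p t" "fejer N q t - q t"]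
        by (simp add: fejer_add[OF i] algebra_simps)
    qed (intro integrable_norm Bochner_Integration.integrable_diff
        Bochner_Integration.integrable_add fejer_integrable i)+
    also have "\<dots> = (LINT t|freq. cmod (fejer N p t - p t)) + (LINT t|freq. cmod (fejer N q t - q t))"
      by (intro Bochner_Integration.integral_add integrable_norm Bochner_Integration.integrable_diff
          fejer_integrable i)
    finally show ?thesis .
  qed
  show ?case
  proof (rule Lim_null_comparison)
    show "(\<lambda>N. (LINT t|freq. cmod (fejer N p t - p t)) + (LINT t|freq. cmod (fejer N q t - q t))) \<longlonglongrightarrow> 0"
      using tendsto_add[OF add.IH] by simp
  qed (use le in \<open>auto intro!: always_eventually\<close>)
qed

text \<open>
  The Fejer means contract the \<open>L\<^sub>1\<close> norm, so convergence extends from the dense set of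
  trigonometric polynomials.
\<close>

lemma fejer_tendsto_L1:
  assumes h: "h \<in> borel_measurable freq" "AE t in freq. cmod (h t) \<le> B"
  shows "(\<lambda>N. LINT t|freq. cmod (fejer N h t - h t)) \<longlonglongrightarrow> 0"
proof (rule LIMSEQ_I)
  fix e :: real assume "0 < e"
  have hi: "integrable freq h" using sqint_freq_bounded[OF h] by (rule sqint_integrable_freq)
  obtain p where p: "trig_poly p" "(LINT t|freq. cmod (h t - p t)) < e / 3"
    using trig_poly_dense_L1[OF h, of "e / 3"] \<open>0 < e\<close> by auto
  have pi': "integrable freq p" using trig_poly_sqint[OF p(1)] by (rule sqint_integrable_freq)
  obtain N0 where N0: "\<And>N. N \<ge> N0 \<Longrightarrow> (LINT t|freq. cmod (fejer N p t - p t)) < e / 3"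
    using LIMSEQ_D[OF trig_poly_fejer_L1[OF p(1)], of "e / 3"] \<open>0 < e\<close> by auto
  have "(LINT t|freq. cmod (fejer N h t - h t)) < e" if N: "N \<ge> Suc N0" for N
  proof -
    note int = integrable_norm Bochner_Integration.integrable_diff Bochner_Integration.integrable_add fejer_integrable hi pi'
    have "(LINT t|freq. cmod (fejer N h t - h t))
       \<le> (LINT t|freq. cmod (fejer N (\<lambda>t. h t - p t) t) + (cmod (fejer N p t - p t) + cmod (h t - p t)))"
    proof (rule integral_mono)
      fix t
      have "fejer N h t - h t = fejer N (\<lambda>t. h t - p t) t + ((fejer N p t - p t) - (h t - p t))"
        by (simp add: fejer_diff[OF hi pi'])
      also have "cmod \<dots> \<le> cmod (fejer N (\<lambda>t. h t - p t) t) + cmod ((fejer N p t - p t) - (h t - p t))"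
        by (rule norm_triangle_ineq)
      also have "\<dots> \<le> cmod (fejer N (\<lambda>t. h t - p t) t) + (cmod (fejer N p t - p t) + cmod (h t - p t))"
        by (intro add_left_mono norm_triangle_ineq4)
      finally show "cmod (fejer N h t - h t)
        \<le> cmod (fejer N (\<lambda>t. h t - p t) t) + (cmod (fejer N p t - p t) + cmod (h t - p t))" .
    qed (intro int)+
    also have "\<dots> = (LINT t|freq. cmod (fejer N (\<lambda>t. h t - p t) t))
        + ((LINT t|freq. cmod (fejer N p t - p t)) + (LINT t|freq. cmod (h t - p t)))"
      by (subst Bochner_Integration.integral_add, (intro int)+)+ simp
    also have "(LINT t|freq. cmod (fejer N (\<lambda>t. h t - p t) t)) \<le> (LINT t|freq. cmod (h t - p t))"
      using N by (intro fejer_L1 Bochner_Integration.integrable_diff hi pi') auto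
    finally show ?thesis using p(2) N0[of N] N by simp
  qed
  then show "\<exists>no. \<forall>n\<ge>no. norm ((LINT t|freq. cmod (fejer n h t - h t)) - 0) < e"
    by (intro exI[of _ "Suc N0"]) simp
qed

lemma fejer_subseq:
  assumes h: "h \<in> borel_measurable freq" "AE t in freq. cmod (h t) \<le> B"
  shows "\<exists>r. (\<forall>n. r n > 0) \<and> (AE t in freq. (\<lambda>n. fejer (r n) h t) \<longlonglongrightarrow> h t)"
proof -
  have hi: "integrable freq h" using sqint_freq_bounded[OF h] by (rule sqint_integrable_freq)
  have "(\<lambda>N. LINT t|freq. norm (fejer (Suc N) h t - h t)) \<longlonglongrightarrow> 0"
    using LIMSEQ_Suc[OF fejer_tendsto_L1[OF h]] .
  then obtain r where "AE t in freq. (\<lambda>n. fejer (Suc (r n)) h t - h t) \<longlonglongrightarrow> 0"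
    using tendsto_L1_AE_subseq[of freq "\<lambda>N t. fejer (Suc N) h t - h t"] fejer_integrable hi by auto
  then have "AE t in freq. (\<lambda>n. fejer (Suc (r n)) h t) \<longlonglongrightarrow> h t"
    by eventually_elim (rule LIM_zero_cancel)
  then show ?thesis by (intro exI[of _ "\<lambda>n. Suc (r n)"]) auto
qed

text \<open>
  Multiplication by a character leaves the modulus alone and moves all frequencies to the
  nonnegative ones.
\<close>

lemma fejer_shift:
  "fejer N h t * chr (int N) t
    = (\<Sum>k<2 * N + 1. of_real (1 - \<bar>of_int (int k - int N)\<bar> / N) * fourier h (int k - int N) * chr (int k) t)"
  unfolding fejer_def sum_distrib_right
  by (rule sum.reindex_bij_witness[of _ "\<lambda>k. int k - int N" "\<lambda>m. nat (m + int N)"])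
     (auto simp: chr_mult mult.assoc)

text \<open>
  The Fejer means of the indicator of \<open>{t. w t < 0}\<close> are bounded by \<open>1\<close> and, after a shift, of the tested
  form; in the limit they show that the integral of \<open>w\<close> over this set is nonnegative.
\<close>

lemma nonneg_of_analytic_tests:
  fixes w :: "real \<Rightarrow> real"
  assumes w: "integrable freq w"
    and test: "\<And>n c. 0 \<le> (LINT t|freq. w t * (cmod (\<Sum>k<n. c k * chr (int k) t))\<^sup>2)"
  shows "AE t in freq. 0 \<le> w t"
proof -
  have [measurable]: "w \<in> borel_measurable freq" using w by auto
  define h where "h t = complex_of_real (if w t < 0 then 1 else 0)" for t
  have [measurable]: "h \<in> borel_measurable freq" unfolding h_def by measurable
  have h: "h \<in> borel_measurable freq" "AE t in freq. cmod (h t) \<le> 1" by (auto simp: h_def)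
  have hi: "integrable freq h" using sqint_freq_bounded[OF h] by (rule sqint_integrable_freq)
  obtain r where r: "\<And>n. r n > 0" "AE t in freq. (\<lambda>n. fejer (r n) h t) \<longlonglongrightarrow> h t"
    using fejer_subseq[OF h] by blast
  have [measurable]: "fejer N h \<in> borel_measurable freq" for N
    by (rule borel_measurable_integrable[OF fejer_integrable])
  have "(\<lambda>n. LINT t|freq. w t * (cmod (fejer (r n) h t))\<^sup>2) \<longlonglongrightarrow> (LINT t|freq. w t * (cmod (h t))\<^sup>2)"
  proof (rule integral_dominated_convergence[where w = "\<lambda>t. \<bar>w t\<bar>"])
    show "AE t in freq. (\<lambda>n. w t * (cmod (fejer (r n) h t))\<^sup>2) \<longlonglongrightarrow> w t * (cmod (h t))\<^sup>2"
      using r(2) by eventually_elim (intro tendsto_intros)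
    show "AE t in freq. norm (w t * (cmod (fejer (r n) h t))\<^sup>2) \<le> \<bar>w t\<bar>" for n
    proof (rule AE_I2)
      fix t
      have "(cmod (fejer (r n) h t))\<^sup>2 \<le> 1"
        using fejer_bounded[OF r(1) hi h(2)] by (simp add: power_le_one)
      then show "norm (w t * (cmod (fejer (r n) h t))\<^sup>2) \<le> \<bar>w t\<bar>"
        by (simp add: abs_mult mult_left_le)
    qed
  qed (use w in auto)
  moreover have "0 \<le> (LINT t|freq. w t * (cmod (fejer N h t))\<^sup>2)" for N
  proof -
    have "cmod (fejer N h t) = cmod (fejer N h t * chr (int N) t)" for t by (simp add: norm_mult)
    then show ?thesis using test unfolding fejer_shift by presburger
  qed
  ultimately have "0 \<le> (LINT t|freq. w t * (cmod (h t))\<^sup>2)"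
    by (intro LIMSEQ_le_const[of _ _ 0]) auto
  moreover have eq: "w t * (cmod (h t))\<^sup>2 = - max 0 (- w t)" for t by (simp add: h_def)
  moreover have "0 \<le> (LINT t|freq. max 0 (- w t))" by simp
  ultimately have "(LINT t|freq. max 0 (- w t)) = 0" by (simp add: eq)
  then have "AE t in freq. max 0 (- w t) = 0"
    using w by (subst (asm) integral_nonneg_eq_0_iff_AE) auto
  then show ?thesis by eventually_elim auto
qed

section \<open>Admissible pairs of densities\<close>

lemma fourier_shift: "fourier (\<lambda>t. h t * chr k t) l = fourier h (l - k)"
proof -
  have "h t * chr k t * chr (- l) t = h t * chr (- (l - k)) t" for t
    by (simp add: mult.assoc chr_mult)
  then show ?thesis by (simp only: fourier_def)
qed

lemma integrable_mult_trig:
  fixes w :: "real \<Rightarrow> real"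
  assumes "integrable freq w"
  shows "integrable freq (\<lambda>t. of_real (w t) * (\<Sum>k<n. c k * chr (\<nu> k) t))"
proof -
  have "of_real (w t) * (\<Sum>k<n. c k * chr (\<nu> k) t) = (\<Sum>k<n. c k * (of_real (w t) * chr (\<nu> k) t))" for t
    by (simp add: sum_distrib_left mult_ac)
  then show ?thesis
    using assms by (simp only:) (intro Bochner_Integration.integrable_sum integrable_mult_right
        integrable_mult_chr integrable_of_real)
qed

definition trunc :: "nat \<Rightarrow> (nat \<Rightarrow> complex) \<Rightarrow> nat \<Rightarrow> complex" where
  "trunc n c k = (if k < n then c k else 0)"

lemma trunc_l2: "trunc n c \<in> l2"
  unfolding l2_def by (auto intro!: summable_finite[of "{..<n}"] simp: trunc_def split: if_splits)

lemma trunc_norm: "2 * pi * (l2_norm (trunc n c))\<^sup>2 = (LINT t|freq. (cmod (\<Sum>k<n. c k * chr (int k) t))\<^sup>2)"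
proof -
  have "(l2_norm (trunc n c))\<^sup>2 = (\<Sum>k<n. (cmod (c k))\<^sup>2)"
    unfolding l2_norm_power2[OF trunc_l2]
    by (subst suminf_finite[of "{..<n}"]) (auto simp: trunc_def)
  then show ?thesis by (subst trig_sum_norm) auto
qed

lemma mat_app_trunc:
  assumes "integrable freq w"
  shows "mat_app (sym_mat w int int) (trunc n c) l
    = fourier (\<lambda>t. of_real (w t) * (\<Sum>k<n. c k * chr (int k) t)) (int l)"
proof -
  have "mat_app (sym_mat w int int) (trunc n c) l = (\<Sum>k<n. sym_mat w int int l k * c k)"
    unfolding mat_app_def by (subst suminf_finite[of "{..<n}"]) (auto simp: trunc_def)
  also have "\<dots> = (\<Sum>k<n. fourier (\<lambda>t. c k * (of_real (w t) * chr (int k) t)) (int l))"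
    by (simp add: sym_mat_def fourier_cmult fourier_shift mult.commute)
  also have "\<dots> = fourier (\<lambda>t. \<Sum>k<n. c k * (of_real (w t) * chr (int k) t)) (int l)"
    using assms by (intro fourier_sum[symmetric] integrable_mult_right integrable_mult_chr integrable_of_real)
  finally show ?thesis by (simp add: sum_distrib_left mult_ac)
qed

text \<open>
  The quadratic form of a Toeplitz matrix is integration of \<open>w\<close> against the squared modulus of a
  polynomial. Here \<open>w\<close> is only integrable, so the identity is restricted to finite sequences.
\<close>

lemma inner_trunc:
  fixes w :: "real \<Rightarrow> real"
  assumes "integrable freq w"
  defines "C \<equiv> \<lambda>n c t. \<Sum>k<n. c k * chr (int k) t"
  shows "2 * pi * l2_inner (mat_app (sym_mat w int int) (trunc n c)) (trunc n c)
    = of_real (LINT t|freq. w t * (cmod (C n c t))\<^sup>2)"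
proof -
  have i: "integrable freq (\<lambda>t. of_real (w t) * C n c t)"
    unfolding C_def by (rule integrable_mult_trig[OF assms(1)])
  have "2 * pi * l2_inner (mat_app (sym_mat w int int) (trunc n c)) (trunc n c)
     = (\<Sum>l<n. 2 * pi * fourier (\<lambda>t. of_real (w t) * C n c t) (int l) * cnj (c l))"
    unfolding l2_inner_def C_def
    by (subst suminf_finite[of "{..<n}"]) (auto simp: trunc_def mat_app_trunc[OF assms(1)] sum_distrib_left mult_ac)
  also have "\<dots> = (\<Sum>l<n. LINT t|freq. of_real (w t) * C n c t * chr (- int l) t * cnj (c l))"
    by (simp add: fourier_def)
  also have "\<dots> = (LINT t|freq. (\<Sum>l<n. of_real (w t) * C n c t * chr (- int l) t * cnj (c l)))"
    by (intro Bochner_Integration.integral_sum[symmetric] integrable_mult_left integrable_mult_chr i)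
  also have "\<dots> = (LINT t|freq. complex_of_real (w t * (cmod (C n c t))\<^sup>2))"
  proof (intro Bochner_Integration.integral_cong refl)
    fix t
    have "(\<Sum>l<n. of_real (w t) * C n c t * chr (- int l) t * cnj (c l)) = of_real (w t) * (C n c t * cnj (C n c t))"
      by (simp add: C_def sum_distrib_left mult_ac)
    also have "\<dots> = complex_of_real (w t * (cmod (C n c t))\<^sup>2)"
      by (simp only: complex_norm_square[symmetric] of_real_mult)
    finally show "(\<Sum>l<n. of_real (w t) * C n c t * chr (- int l) t * cnj (c l)) = complex_of_real (w t * (cmod (C n c t))\<^sup>2)" .
  qed
  finally show ?thesis by (simp only: integral_complex_of_real)
qed

lemma integrable_mult_trig_norm:
  fixes w :: "real \<Rightarrow> real"
  assumes "integrable freq w"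
  shows "integrable freq (\<lambda>t. w t * (cmod (\<Sum>k<n. c k * chr (\<nu> k) t))\<^sup>2)"
proof (rule Bochner_Integration.integrable_bound)
  have [measurable]: "w \<in> borel_measurable freq" using assms by auto
  show "(\<lambda>t. w t * (cmod (\<Sum>k<n. c k * chr (\<nu> k) t))\<^sup>2) \<in> borel_measurable freq" by measurable
  show "integrable freq (\<lambda>t. (\<Sum>k<n. cmod (c k))\<^sup>2 * w t)" using assms by simp
  have "cmod (\<Sum>k<n. c k * chr (\<nu> k) t) \<le> (\<Sum>k<n. cmod (c k))" for t
    by (rule order_trans[OF norm_sum]) (simp add: norm_mult)
  then have "(cmod (\<Sum>k<n. c k * chr (\<nu> k) t))\<^sup>2 \<le> (\<Sum>k<n. cmod (c k))\<^sup>2" for t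
    by (intro power_mono) auto
  then show "AE t in freq. norm (w t * (cmod (\<Sum>k<n. c k * chr (\<nu> k) t))\<^sup>2)
      \<le> norm ((\<Sum>k<n. cmod (c k))\<^sup>2 * w t)"
    by (auto simp: abs_mult mult.commute intro!: mult_left_mono)
qed

lemma trig_norm_integrable: "integrable freq (\<lambda>t. (cmod (\<Sum>k<n. c k * chr (\<nu> k) t))\<^sup>2)"
  by (rule sqint_integrable[OF sqint_trig_sum])

text \<open>
  Bounding the quadratic form by \<open>K\<close> times the squared norm says that \<open>K - w\<close> is nonnegative on all
  tests.
\<close>

lemma toeplitz_bounded_symbol:
  fixes w :: "real \<Rightarrow> real"
  assumes w: "integrable freq w" and op: "l2_operator (sym_mat w int int)"
  shows "\<exists>K. AE t in freq. w t \<le> K"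
proof -
  define M where "M = sym_mat w int int"
  obtain K where K: "\<And>x. x \<in> l2 \<Longrightarrow> l2_norm (mat_app M x) \<le> K * l2_norm x"
    and Ml2: "\<And>x. x \<in> l2 \<Longrightarrow> mat_app M x \<in> l2"
    using op unfolding l2_operator_def M_def by blast
  have "AE t in freq. 0 \<le> K - w t"
  proof (rule nonneg_of_analytic_tests)
    show "integrable freq (\<lambda>t. K - w t)" using w by auto
    fix n c
    define C where "C t = (\<Sum>k<n. c k * chr (int k) t)" for t
    have eq: "complex_of_real (LINT t|freq. w t * (cmod (C t))\<^sup>2)
        = 2 * pi * l2_inner (mat_app M (trunc n c)) (trunc n c)"
      unfolding C_def M_def by (rule inner_trunc[OF w, symmetric])
    have "\<bar>LINT t|freq. w t * (cmod (C t))\<^sup>2\<bar> = 2 * pi * cmod (l2_inner (mat_app M (trunc n c)) (trunc n c))"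
      using arg_cong[OF eq, of cmod] by (simp only: norm_mult norm_of_real) simp
    also have "\<dots> \<le> 2 * pi * (l2_norm (mat_app M (trunc n c)) * l2_norm (trunc n c))"
      by (intro mult_left_mono l2_inner_le Ml2 trunc_l2) auto
    also have "\<dots> \<le> 2 * pi * ((K * l2_norm (trunc n c)) * l2_norm (trunc n c))"
      by (intro mult_left_mono mult_right_mono K trunc_l2 l2_norm_nonneg) auto
    also have "\<dots> = K * (2 * pi * (l2_norm (trunc n c))\<^sup>2)"
      by (simp add: power2_eq_square mult_ac)
    also have "\<dots> = K * (LINT t|freq. (cmod (C t))\<^sup>2)"
      unfolding trunc_norm C_def ..
    finally have "(LINT t|freq. w t * (cmod (C t))\<^sup>2) \<le> K * (LINT t|freq. (cmod (C t))\<^sup>2)"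
      by simp
    moreover have "(LINT t|freq. (K - w t) * (cmod (C t))\<^sup>2)
        = K * (LINT t|freq. (cmod (C t))\<^sup>2) - (LINT t|freq. w t * (cmod (C t))\<^sup>2)"
      unfolding left_diff_distrib C_def
      by (subst Bochner_Integration.integral_diff)
         (simp_all only: integrable_mult_trig_norm[OF w] trig_norm_integrable integrable_mult_right
           integral_mult_right_zero)
    ultimately show "0 \<le> (LINT t|freq. (K - w t) * (cmod (\<Sum>k<n. c k * chr (int k) t))\<^sup>2)"
      by (simp add: C_def)
  qed
  then show ?thesis by (intro exI[of _ K]) (auto elim: eventually_mono)
qed

text \<open>
  For a finite sequence \<open>c\<close> with polynomial \<open>C\<close>, Bessel's inequality bounds the squared norm of the
  image by the integral of \<open>w\<^sup>2 |C|\<^sup>2 \<le> K w |C|\<^sup>2\<close>. With a bounded inverse, the integral of \<open>|C|\<^sup>2\<close> is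
  then at most a constant times that of \<open>w |C|\<^sup>2\<close>.
\<close>

lemma toeplitz_invertible_symbol:
  fixes w :: "real \<Rightarrow> real"
  assumes w: "integrable freq w" "AE t in freq. 0 \<le> w t \<and> w t \<le> K" "0 \<le> K"
    and inv: "l2_invertible (sym_mat w int int)"
  shows "\<exists>L. AE t in freq. 1 \<le> L * w t"
proof -
  define M where "M = sym_mat w int int"
  have [measurable]: "w \<in> borel_measurable freq" using w by auto
  obtain B where B: "\<And>x. x \<in> l2 \<Longrightarrow> l2_norm x \<le> B * l2_norm (mat_app M x)"
    using inv unfolding l2_invertible_def M_def by blast
  have "AE t in freq. 0 \<le> B\<^sup>2 * K * w t - 1"
  proof (rule nonneg_of_analytic_tests)
    show "integrable freq (\<lambda>t. B\<^sup>2 * K * w t - 1)" using w by auto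
    fix n c
    define C where "C t = (\<Sum>k<n. c k * chr (int k) t)" for t
    have C: "C \<in> sqint freq" unfolding C_def by (rule sqint_trig_sum)
    have wC: "(\<lambda>t. of_real (w t) * C t) \<in> sqint freq"
    proof -
      have "AE t in freq. \<bar>w t\<bar> \<le> K" using w(2) by eventually_elim auto
      from sqint_symbol[OF C _ this] show ?thesis by (simp add: mult.commute)
    qed
    have "2 * pi * (l2_norm (mat_app M (trunc n c)))\<^sup>2 \<le> (L2n freq (\<lambda>t. of_real (w t) * C t))\<^sup>2"
    proof -
      have "mat_app M (trunc n c) = (\<lambda>l. fourier (\<lambda>t. of_real (w t) * C t) (int l))"
        unfolding M_def C_def by (rule ext, rule mat_app_trunc[OF w(1)])
      then show ?thesis using bessel(2)[OF wC, of int] by (simp add: inj_def)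
    qed
    also have "\<dots> = (LINT t|freq. (cmod (of_real (w t) * C t))\<^sup>2)" by (rule L2n_power2)
    also have "\<dots> \<le> (LINT t|freq. K * (w t * (cmod (C t))\<^sup>2))"
    proof (rule integral_mono_AE)
      show "AE t in freq. (cmod (of_real (w t) * C t))\<^sup>2 \<le> K * (w t * (cmod (C t))\<^sup>2)"
        using w(2) by eventually_elim
          (auto simp: norm_mult power_mult_distrib power2_eq_square[of "w _"] mult.assoc intro!: mult_right_mono mult_nonneg_nonneg)
    qed (use wC integrable_mult_trig_norm[OF w(1)] in \<open>auto simp: sqint_integrable C_def\<close>)
    finally have 1: "2 * pi * (l2_norm (mat_app M (trunc n c)))\<^sup>2 \<le> K * (LINT t|freq. w t * (cmod (C t))\<^sup>2)"
      by simp
    have "(LINT t|freq. (cmod (C t))\<^sup>2) = 2 * pi * (l2_norm (trunc n c))\<^sup>2"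
      unfolding trunc_norm C_def ..
    also have "\<dots> \<le> 2 * pi * (B * l2_norm (mat_app M (trunc n c)))\<^sup>2"
      by (intro mult_left_mono power_mono B trunc_l2 l2_norm_nonneg) auto
    also have "\<dots> = B\<^sup>2 * (2 * pi * (l2_norm (mat_app M (trunc n c)))\<^sup>2)"
      by (simp add: power_mult_distrib)
    also have "\<dots> \<le> B\<^sup>2 * (K * (LINT t|freq. w t * (cmod (C t))\<^sup>2))"
      by (intro mult_left_mono 1) auto
    finally have "(LINT t|freq. (cmod (C t))\<^sup>2) \<le> B\<^sup>2 * (K * (LINT t|freq. w t * (cmod (C t))\<^sup>2))" .
    moreover have "(LINT t|freq. (B\<^sup>2 * K * w t - 1) * (cmod (C t))\<^sup>2)
        = B\<^sup>2 * (K * (LINT t|freq. w t * (cmod (C t))\<^sup>2)) - (LINT t|freq. (cmod (C t))\<^sup>2)"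
      unfolding left_diff_distrib C_def mult_1_left mult.assoc
      by (subst Bochner_Integration.integral_diff)
         (simp_all only: integrable_mult_trig_norm[OF w(1)] trig_norm_integrable integrable_mult_right
           integral_mult_right_zero)
    ultimately show "0 \<le> (LINT t|freq. (B\<^sup>2 * K * w t - 1) * (cmod (\<Sum>k<n. c k * chr (int k) t))\<^sup>2)"
      by (simp add: C_def)
  qed
  then show ?thesis by (intro exI[of _ "B\<^sup>2 * K"]) (auto elim: eventually_mono)
qed

definition bounded_pair :: "(real \<Rightarrow> real) \<Rightarrow> (real \<Rightarrow> real) \<Rightarrow> bool" where
  "bounded_pair f g \<longleftrightarrow> spectral_density f \<and> spectral_density g \<and>
     (\<exists>m>0. \<exists>M. AE t in freq. m \<le> f t + g t \<and> f t + g t \<le> M)"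

lemma sym_mat_pos_freq: "sym_mat w pos_freq pos_freq = sym_mat w int int"
  by (simp add: fun_eq_iff sym_mat_def pos_freq_def)

lemma inverse_integrable_AE_pos:
  assumes "f \<in> borel_measurable freq" "g \<in> borel_measurable freq" "inverse_integrable f g"
  shows "AE t in freq. 0 < f t + g t" "integrable freq (\<lambda>t. 1 / (f t + g t))"
proof -
  have [measurable]: "f \<in> borel_measurable freq" "g \<in> borel_measurable freq" by fact+
  have "AE t in freq. inverse (ennreal (f t + g t)) \<noteq> \<infinity>"
    using assms(3) by (intro nn_integral_noteq_infinite) (auto simp: inverse_integrable_def)
  then show pos: "AE t in freq. 0 < f t + g t"
    by eventually_elim (auto simp: not_less[symmetric] ennreal_inverse_eq_top_iff ennreal_eq_0_iff not_le)
  have "(\<integral>\<^sup>+t. ennreal (norm (1 / (f t + g t))) \<partial>freq) = (\<integral>\<^sup>+t. inverse (ennreal (f t + g t)) \<partial>freq)"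
    by (rule nn_integral_cong_AE)
       (use pos in eventually_elim, simp add: inverse_ennreal divide_inverse abs_of_pos)
  then show "integrable freq (\<lambda>t. 1 / (f t + g t))"
    using assms(3) by (simp add: integrable_iff_bounded inverse_integrable_def)
qed

text \<open>
  An upper bound of the symbol \<open>1 / (f + g)\<close> of \<open>P\<close> bounds \<open>f + g\<close> from below, and a lower bound of the
  symbol, which comes from the inverse of \<open>P\<close>, bounds \<open>f + g\<close> from above.
\<close>

lemma admissible_bounded_pair:
  assumes sd: "spectral_density f" "spectral_density g" and adm: "admissible f g"
  shows "bounded_pair f g"
proof -
  define w where "w t = 1 / (f t + g t)" for t
  have meas: "f \<in> borel_measurable freq" "g \<in> borel_measurable freq"
    using sd by (auto simp: spectral_density_def)
  have "inverse_integrable f g" using adm by (simp add: admissible_def)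
  note pos = inverse_integrable_AE_pos[OF meas this]
  have wi: "integrable freq w" using pos(2) by (simp add: w_def[abs_def])
  have P: "P_mat f g = sym_mat w int int" unfolding P_mat_eq sym_mat_pos_freq w_def[abs_def] ..
  have ops: "l2_operator (sym_mat w int int)" "l2_invertible (sym_mat w int int)"
    using adm unfolding P[symmetric] admissible_def operators_defined_def by auto
  obtain K0 where K0: "AE t in freq. w t \<le> K0" using toeplitz_bounded_symbol[OF wi ops(1)] by blast
  define K where "K = max K0 1"
  have "K > 0" by (simp add: K_def)
  have wK: "AE t in freq. 0 \<le> w t \<and> w t \<le> K"
    using K0 pos(1) by eventually_elim (auto simp: w_def K_def)
  obtain L where L: "AE t in freq. 1 \<le> L * w t"
    using toeplitz_invertible_symbol[OF wi wK _ ops(2)] \<open>K > 0\<close> by auto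
  have "AE t in freq. 1 / K \<le> f t + g t \<and> f t + g t \<le> L"
    using wK L pos(1) by eventually_elim (use \<open>K > 0\<close> in \<open>auto simp: w_def field_simps\<close>)
  then show ?thesis
    unfolding bounded_pair_def using sd \<open>K > 0\<close> by (intro conjI exI[of _ "1 / K"] exI[of _ L]) auto
qed

lemma bounded_pairE:
  assumes "bounded_pair f g"
  obtains m M where "0 < m" "m \<le> M" "f \<in> borel_measurable freq" "g \<in> borel_measurable freq"
    "AE t in freq. 0 \<le> f t \<and> 0 \<le> g t \<and> m \<le> f t + g t \<and> f t + g t \<le> M"
proof -
  obtain m M where m: "m > 0" "AE t in freq. m \<le> f t + g t \<and> f t + g t \<le> M"
    using assms by (auto simp: bounded_pair_def)
  have "AE t in freq. m \<le> f t + g t \<and> f t + g t \<le> max m M"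
    using m(2) by eventually_elim auto
  moreover have "AE t in freq. 0 \<le> f t" "AE t in freq. 0 \<le> g t"
    using assms by (auto simp: bounded_pair_def spectral_density_def)
  ultimately have "AE t in freq. 0 \<le> f t \<and> 0 \<le> g t \<and> m \<le> f t + g t \<and> f t + g t \<le> max m M"
    by eventually_elim auto
  then show thesis
    using assms m(1) by (intro that[of m "max m M"]) (auto simp: bounded_pair_def spectral_density_def)
qed

lemma symbols_bounded:
  fixes f g m M :: real
  assumes "0 \<le> f \<and> 0 \<le> g \<and> m \<le> f + g \<and> f + g \<le> M" "0 < m"
  shows "1 / M \<le> 1 / (f + g)" "1 / (f + g) \<le> 1 / m" "\<bar>1 / (f + g)\<bar> \<le> 1 / m"
    "\<bar>f / (f + g)\<bar> \<le> 1" "\<bar>f * g / (f + g)\<bar> \<le> M"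
proof -
  have s: "0 < f + g" using assms by linarith
  show "1 / M \<le> 1 / (f + g)" using assms s by (intro divide_left_mono) auto
  show 1: "1 / (f + g) \<le> 1 / m" using assms s by (intro divide_left_mono) auto
  show "\<bar>1 / (f + g)\<bar> \<le> 1 / m" using 1 s by (simp add: abs_of_pos)
  show "\<bar>f / (f + g)\<bar> \<le> 1" using assms s by simp
  have "f * g \<le> M * (f + g)"
    using assms s by (intro mult_mono) auto
  then show "\<bar>f * g / (f + g)\<bar> \<le> M" using assms s by (simp add: abs_mult field_simps)
qed

lemma bounded_pair_admissible:
  assumes "bounded_pair f g"
  shows "admissible f g"
proof -
  obtain m M where mM: "0 < m" "m \<le> M"
    and [measurable]: "f \<in> borel_measurable freq" "g \<in> borel_measurable freq"
    and ae: "AE t in freq. 0 \<le> f t \<and> 0 \<le> g t \<and> m \<le> f t + g t \<and> f t + g t \<le> M"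
    using assms by (rule bounded_pairE)
  have P: "AE t in freq. \<bar>1 / (f t + g t)\<bar> \<le> 1 / m"
    using ae by eventually_elim (erule symbols_bounded[OF _ mM(1)])
  have P': "AE t in freq. 1 / M \<le> 1 / (f t + g t) \<and> 1 / (f t + g t) \<le> 1 / m"
    using ae by eventually_elim (intro conjI; erule symbols_bounded[OF _ mM(1)])
  have R: "AE t in freq. \<bar>f t / (f t + g t)\<bar> \<le> 1"
    using ae by eventually_elim (erule symbols_bounded[OF _ mM(1)])
  have Q: "AE t in freq. \<bar>f t * g t / (f t + g t)\<bar> \<le> M"
    using ae by eventually_elim (erule symbols_bounded[OF _ mM(1)])
  have "(\<integral>\<^sup>+t. inverse (ennreal (f t + g t)) \<partial>freq) \<le> (\<integral>\<^sup>+t. ennreal (1 / m) \<partial>freq)"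
  proof (rule nn_integral_mono_AE)
    show "AE t in freq. inverse (ennreal (f t + g t)) \<le> ennreal (1 / m)"
      using ae
    proof eventually_elim
      case (elim t)
      then have "f t + g t > 0" using mM by linarith
      then show ?case using symbols_bounded(2)[OF elim mM(1)]
        by (simp add: inverse_ennreal divide_inverse ennreal_leI)
    qed
  qed
  also have "\<dots> < \<infinity>"
    using finite_measure.emeasure_finite[OF finite_measure_freq, of "space freq"]
    by (simp add: less_top ennreal_mult_less_top)
  finally have "inverse_integrable f g" by (simp add: inverse_integrable_def)
  moreover have "operators_defined f g"
    unfolding operators_defined_def P_mat_eq R_mat_eq Q_mat_eq
  proof (intro conjI)
    show "l2_operator (sym_mat (\<lambda>t. 1 / (f t + g t)) pos_freq pos_freq)"
      by (rule sym_mat_l2_operator[OF _ P]) simp_all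
    show "l2_operator (sym_mat (\<lambda>t. f t / (f t + g t)) pos_freq neg_freq)"
      by (rule sym_mat_l2_operator[OF _ R]) simp_all
    show "l2_operator (sym_mat (\<lambda>t. f t * g t / (f t + g t)) neg_freq neg_freq)"
      by (rule sym_mat_l2_operator[OF _ Q]) simp_all
    show "l2_invertible (sym_mat (\<lambda>t. 1 / (f t + g t)) pos_freq pos_freq)"
    proof (rule sym_mat_invertible[OF _ P'])
      show "1 / M \<le> 1 / m" using mM by (intro divide_left_mono) auto
    qed (use mM in auto)
  qed
  ultimately show ?thesis by (simp add: admissible_def)
qed

section \<open>The spectral characteristic and its error\<close>

lemma sqint_diff_cancel:
  assumes "(\<lambda>t. F t - G t) \<in> sqint M" "G \<in> sqint M" shows "F \<in> sqint M"
  using sqint_add[OF assms] by simp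

text \<open>
  The choice in \<open>l2_series\<close> is made among the mean-square limits, which exist by \<open>synth_exists\<close>.
\<close>

lemma l2_series_synth:
  assumes "c \<in> l2"
  shows "synth pos_freq c (l2_series c)"
proof -
  define S where "S n t = (\<Sum>k<n. c k * cis (t * (real k + 1)))" for n t
  have S_eq: "S n t = (\<Sum>k<n. c k * chr (pos_freq k) t)" for n t
    by (simp add: S_def chr_def pos_freq_def)
  have Ss: "S n \<in> sqint freq" for n unfolding S_eq[abs_def] by (rule sqint_trig_sum)
  define Q where "Q C \<longleftrightarrow> C \<in> borel_measurable freq \<and>
     (\<lambda>n. \<integral>\<^sup>+t. ennreal ((cmod (C t - S n t))\<^sup>2) \<partial>freq) \<longlonglongrightarrow> 0" for C
  have ex: "Q F" if F: "synth pos_freq c F" for F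
  proof -
    have Fs: "F \<in> sqint freq" using F by (rule synth_sqint)
    have "(\<lambda>n. ennreal ((L2n freq (\<lambda>t. S n t - F t))\<^sup>2)) \<longlonglongrightarrow> ennreal (0\<^sup>2)"
      using F unfolding synth_def S_eq[symmetric] by (intro tendsto_ennrealI tendsto_power) auto
    moreover have "(\<integral>\<^sup>+t. ennreal ((cmod (F t - S n t))\<^sup>2) \<partial>freq) = ennreal ((L2n freq (\<lambda>t. S n t - F t))\<^sup>2)" for n
      using nn_integral_sqint[OF sqint_diff[OF Fs Ss]] L2n_minus_commute[of freq F "S n"] by simp
    ultimately show ?thesis using Fs by (auto simp: Q_def)
  qed
  obtain F where "synth pos_freq c F" using synth_exists[OF assms inj_pos_freq] by blast
  then have "Q F" by (rule ex)
  then have "Q (SOME C. Q C)" by (rule someI[of Q])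
  moreover have "(SOME C. Q C) = l2_series c" unfolding Q_def S_def l2_series_def ..
  ultimately have "Q (l2_series c)" by simp
  then have meas: "l2_series c \<in> borel_measurable freq"
    and lim: "(\<lambda>n. \<integral>\<^sup>+t. ennreal ((cmod (l2_series c t - S n t))\<^sup>2) \<partial>freq) \<longlonglongrightarrow> 0"
    by (auto simp: Q_def)
  have "\<forall>\<^sub>F n in sequentially. (\<integral>\<^sup>+t. ennreal ((cmod (l2_series c t - S n t))\<^sup>2) \<partial>freq) < 1"
    using lim by (rule order_tendstoD) simp
  then obtain n where "(\<integral>\<^sup>+t. ennreal ((cmod (l2_series c t - S n t))\<^sup>2) \<partial>freq) < 1"
    by (auto simp: eventually_at_top_linorder)
  then have "(\<lambda>t. l2_series c t - S n t) \<in> sqint freq"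
    using meas Ss by (intro sqint_nn_integral) (auto intro: less_trans[OF _ ennreal_one_less_top])
  then have Cs: "l2_series c \<in> sqint freq" using Ss by (rule sqint_diff_cancel)
  have eq: "(\<integral>\<^sup>+t. ennreal ((cmod (l2_series c t - S n t))\<^sup>2) \<partial>freq) = ennreal ((L2n freq (\<lambda>t. S n t - l2_series c t))\<^sup>2)" for n
    using nn_integral_sqint[OF sqint_diff[OF Cs Ss]] L2n_minus_commute[of freq "l2_series c" "S n"] by simp
  have "(\<lambda>n. (L2n freq (\<lambda>t. S n t - l2_series c t))\<^sup>2) \<longlonglongrightarrow> 0"
    using lim unfolding eq by (subst (asm) tendsto_ennreal_iff[of _ _ 0, simplified]) auto
  then have "(\<lambda>n. sqrt ((L2n freq (\<lambda>t. S n t - l2_series c t))\<^sup>2)) \<longlonglongrightarrow> sqrt 0"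
    by (rule tendsto_real_sqrt)
  then show ?thesis using Cs unfolding synth_def S_eq[symmetric] by simp
qed

lemma A_fun_bounded:
  assumes "summable (\<lambda>k. cmod (a k))"
  shows "cmod (A_fun a t) \<le> (\<Sum>k. cmod (a k))"
proof -
  have "summable (\<lambda>k. cmod (a k * cis (- t * real k)))" using assms by (simp add: norm_mult)
  from summable_norm[OF this] show ?thesis by (simp add: A_fun_def norm_mult)
qed

lemma A_fun_measurable [measurable]: "A_fun a \<in> borel_measurable freq"
proof -
  have "(\<lambda>t. a k * cis (- t * real k)) \<in> borel_measurable freq" for k
    by (intro continuous_on_freq_measurable continuous_intros)
  then show ?thesis unfolding A_fun_def[abs_def] by (intro borel_measurable_suminf)
qed

lemma A_fun_synth:
  assumes a: "summable (\<lambda>k. cmod (a k))"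
  shows "synth neg_freq a (A_fun a)"
proof -
  define S where "S n t = (\<Sum>k<n. a k * chr (neg_freq k) t)" for n t
  have A: "A_fun a \<in> sqint freq"
    using A_fun_bounded[OF a] by (intro sqint_freq_bounded) auto
  have Ss: "S n \<in> sqint freq" for n unfolding S_def by (rule sqint_trig_sum)
  have [measurable]: "S n \<in> borel_measurable freq" for n using Ss by auto
  have lim: "(\<lambda>n. S n t) \<longlonglongrightarrow> A_fun a t" for t
  proof -
    have "summable (\<lambda>k. cmod (a k * cis (- t * real k)))" using a by (simp add: norm_mult)
    then have "summable (\<lambda>k. a k * cis (- t * real k))" by (rule summable_norm_cancel)
    from summable_LIMSEQ[OF this] show ?thesis
      by (simp add: S_def A_fun_def chr_def neg_freq_def)
  qed
  have Sb: "cmod (S n t) \<le> (\<Sum>k. cmod (a k))" for n t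
  proof -
    have "cmod (S n t) \<le> (\<Sum>k<n. cmod (a k))"
      unfolding S_def by (rule order_trans[OF norm_sum]) (simp add: norm_mult)
    also have "\<dots> \<le> (\<Sum>k. cmod (a k))" by (rule sum_le_suminf[OF a]) auto
    finally show ?thesis .
  qed
  have "(\<lambda>n. LINT t|freq. (cmod (S n t - A_fun a t))\<^sup>2) \<longlonglongrightarrow> (LINT t|freq. 0)"
  proof (rule integral_dominated_convergence[where w = "\<lambda>_. (2 * (\<Sum>k. cmod (a k)))\<^sup>2"])
    show "AE t in freq. (\<lambda>n. (cmod (S n t - A_fun a t))\<^sup>2) \<longlonglongrightarrow> 0"
    proof (rule AE_I2)
      fix t
      have "(\<lambda>n. (cmod (S n t - A_fun a t))\<^sup>2) \<longlonglongrightarrow> (cmod (A_fun a t - A_fun a t))\<^sup>2"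
        by (intro tendsto_intros lim)
      then show "(\<lambda>n. (cmod (S n t - A_fun a t))\<^sup>2) \<longlonglongrightarrow> 0" by simp
    qed
    show "AE t in freq. norm ((cmod (S n t - A_fun a t))\<^sup>2) \<le> (2 * (\<Sum>k. cmod (a k)))\<^sup>2" for n
    proof (rule AE_I2)
      fix t
      have "cmod (S n t - A_fun a t) \<le> 2 * (\<Sum>k. cmod (a k))"
        using norm_triangle_ineq4[of "S n t" "A_fun a t"] Sb[of n t] A_fun_bounded[OF a, of t] by linarith
      then show "norm ((cmod (S n t - A_fun a t))\<^sup>2) \<le> (2 * (\<Sum>k. cmod (a k)))\<^sup>2"
        using power_mono[of "cmod (S n t - A_fun a t)" "2 * (\<Sum>k. cmod (a k))" 2] by simp
    qed
  qed auto
  then have "(\<lambda>n. sqrt (LINT t|freq. (cmod (S n t - A_fun a t))\<^sup>2)) \<longlonglongrightarrow> sqrt 0"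
    by (intro tendsto_real_sqrt) simp
  then show ?thesis using A unfolding synth_def L2n_def S_def by simp
qed

text \<open>
  The functions whose frequencies are all \<open>\<le> 0\<close>: a Hardy space.
\<close>

definition past :: "(real \<Rightarrow> complex) \<Rightarrow> bool" where
  "past h \<longleftrightarrow> h \<in> sqint freq \<and> (\<forall>k. fourier h (pos_freq k) = 0)"

lemma past_diff: "past f \<Longrightarrow> past g \<Longrightarrow> past (\<lambda>t. f t - g t)"
  by (auto simp: past_def sqint_diff fourier_diff sqint_integrable_freq)

text \<open>
  The error as a real Bochner integral, to which linearity applies; it agrees with \<open>mse\<close> for bounded
  densities and square-integrable \<open>h\<close>.
\<close>

definition err :: "(nat \<Rightarrow> complex) \<Rightarrow> (real \<Rightarrow> real) \<Rightarrow> (real \<Rightarrow> real) \<Rightarrow> (real \<Rightarrow> complex) \<Rightarrow> real" where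
  "err a f g h = 1 / (2 * pi) * (LINT t|freq. (cmod (A_fun a t - h t))\<^sup>2 * f t + (cmod (h t))\<^sup>2 * g t)"

lemma weighted_sqint_integrable:
  assumes h: "h \<in> sqint freq" and f: "f \<in> borel_measurable freq" "AE t in freq. \<bar>f t\<bar> \<le> M"
  shows "integrable freq (\<lambda>t. (cmod (h t))\<^sup>2 * f t)"
proof (rule Bochner_Integration.integrable_bound)
  show "integrable freq (\<lambda>t. M * (cmod (h t))\<^sup>2)"
    using sqint_integrable[OF h] by simp
  show "AE t in freq. norm ((cmod (h t))\<^sup>2 * f t) \<le> norm (M * (cmod (h t))\<^sup>2)"
    using f(2)
  proof eventually_elim
    case (elim t)
    then have "\<bar>f t\<bar> * (cmod (h t))\<^sup>2 \<le> \<bar>M\<bar> * (cmod (h t))\<^sup>2" by (intro mult_right_mono) auto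
    then show ?case by (simp add: abs_mult mult.commute)
  qed
qed (use h f in measurable)

lemma A_fun_sqint: "summable (\<lambda>k. cmod (a k)) \<Longrightarrow> A_fun a \<in> sqint freq"
  using A_fun_synth by (rule synth_sqint)

lemma mse_eq_err:
  assumes a: "summable (\<lambda>k. cmod (a k))" and h: "h \<in> sqint freq"
    and f: "f \<in> borel_measurable freq" "AE t in freq. 0 \<le> f t \<and> f t \<le> M"
    and g: "g \<in> borel_measurable freq" "AE t in freq. 0 \<le> g t \<and> g t \<le> M"
  shows "mse a h f g = ennreal (err a f g h)"
    and "integrable freq (\<lambda>t. (cmod (A_fun a t - h t))\<^sup>2 * f t)"
    and "integrable freq (\<lambda>t. (cmod (h t))\<^sup>2 * g t)"
    and "0 \<le> err a f g h"
proof -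
  have fM: "AE t in freq. \<bar>f t\<bar> \<le> M" using f(2) by eventually_elim auto
  have gM: "AE t in freq. \<bar>g t\<bar> \<le> M" using g(2) by eventually_elim auto
  show i1: "integrable freq (\<lambda>t. (cmod (A_fun a t - h t))\<^sup>2 * f t)"
    by (intro weighted_sqint_integrable[OF _ f(1) fM] sqint_diff A_fun_sqint a h)
  show i2: "integrable freq (\<lambda>t. (cmod (h t))\<^sup>2 * g t)"
    by (intro weighted_sqint_integrable[OF h g(1) gM])
  have n1: "AE t in freq. 0 \<le> (cmod (A_fun a t - h t))\<^sup>2 * f t"
    using f(2) by eventually_elim simp
  have n2: "AE t in freq. 0 \<le> (cmod (h t))\<^sup>2 * g t"
    using g(2) by eventually_elim simp
  have I: "0 \<le> (LINT t|freq. (cmod (A_fun a t - h t))\<^sup>2 * f t)" "0 \<le> (LINT t|freq. (cmod (h t))\<^sup>2 * g t)"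
    using n1 n2 by (auto intro: integral_nonneg_AE)
  have e: "err a f g h = 1 / (2 * pi) * (LINT t|freq. (cmod (A_fun a t - h t))\<^sup>2 * f t)
      + 1 / (2 * pi) * (LINT t|freq. (cmod (h t))\<^sup>2 * g t)"
    unfolding err_def by (subst Bochner_Integration.integral_add[OF i1 i2]) (simp add: distrib_left)
  show "0 \<le> err a f g h" unfolding e using I by simp
  show "mse a h f g = ennreal (err a f g h)"
    unfolding e mse_def nn_integral_eq_integral[OF i1 n1] nn_integral_eq_integral[OF i2 n2]
    using I by (subst ennreal_plus, simp, simp) (simp only: ennreal_mult' zero_le_divide_1_iff
        mult_nonneg_nonneg zero_le_numeral pi_ge_zero)
qed

lemma bounded_pair_bounds:
  assumes "bounded_pair f g"
  shows "\<exists>M. f \<in> borel_measurable freq \<and> g \<in> borel_measurable freq \<and>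
    (AE t in freq. 0 \<le> f t \<and> f t \<le> M) \<and> (AE t in freq. 0 \<le> g t \<and> g t \<le> M)"
proof -
  obtain m M where "f \<in> borel_measurable freq" "g \<in> borel_measurable freq"
    and ae: "AE t in freq. 0 \<le> f t \<and> 0 \<le> g t \<and> m \<le> f t + g t \<and> f t + g t \<le> M"
    using assms by (rule bounded_pairE)
  moreover have "AE t in freq. 0 \<le> f t \<and> f t \<le> M" "AE t in freq. 0 \<le> g t \<and> g t \<le> M"
    using ae by (eventually_elim, auto)+
  ultimately show ?thesis by blast
qed

context
  fixes a :: "nat \<Rightarrow> complex" and f g :: "real \<Rightarrow> real"
  assumes a: "summable (\<lambda>k. cmod (a k))" and bp: "bounded_pair f g"
begin

lemma measurable_densities [measurable]: "f \<in> borel_measurable freq" "g \<in> borel_measurable freq"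
  using bp by (auto simp: bounded_pair_def spectral_density_def)

lemma a_l2: "a \<in> l2"
  using synth_norm(1)[OF A_fun_synth[OF a]] by simp

lemma pair_bounds: "\<exists>m M. 0 < m \<and> m \<le> M \<and>
    (AE t in freq. 0 \<le> f t \<and> 0 \<le> g t \<and> m \<le> f t + g t \<and> f t + g t \<le> M)"
  by (rule bounded_pairE[OF bp]) blast

lemma P_symbol: "\<exists>K. AE t in freq. \<bar>1 / (f t + g t)\<bar> \<le> K"
  and R_symbol: "AE t in freq. \<bar>f t / (f t + g t)\<bar> \<le> 1"
  and Q_symbol: "\<exists>K. AE t in freq. \<bar>f t * g t / (f t + g t)\<bar> \<le> K"
proof -
  obtain m M where mM: "0 < m" "AE t in freq. 0 \<le> f t \<and> 0 \<le> g t \<and> m \<le> f t + g t \<and> f t + g t \<le> M"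
    using pair_bounds by blast
  note s = symbols_bounded[OF _ mM(1)]
  have "AE t in freq. \<bar>1 / (f t + g t)\<bar> \<le> 1 / m" using mM(2) by eventually_elim (erule s)
  then show "\<exists>K. AE t in freq. \<bar>1 / (f t + g t)\<bar> \<le> K" by blast
  show "AE t in freq. \<bar>f t / (f t + g t)\<bar> \<le> 1" using mM(2) by eventually_elim (erule s)
  have "AE t in freq. \<bar>f t * g t / (f t + g t)\<bar> \<le> M" using mM(2) by eventually_elim (erule s)
  then show "\<exists>K. AE t in freq. \<bar>f t * g t / (f t + g t)\<bar> \<le> K" by blast
qed

definition "c_opt = mat_inv_app (P_mat f g) (mat_app (R_mat f g) a)"

lemma c_opt: "c_opt \<in> l2" "mat_app (P_mat f g) c_opt = mat_app (R_mat f g) a"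
proof -
  have ops: "operators_defined f g"
    using bounded_pair_admissible[OF bp] by (simp add: admissible_def)
  then have "mat_app (R_mat f g) a \<in> l2"
    using a_l2 by (auto simp: operators_defined_def l2_operator_def)
  moreover have "mat_app (P_mat f g) ` l2 = l2"
    using ops by (auto simp: operators_defined_def l2_invertible_def bij_betw_def)
  ultimately have "mat_app (R_mat f g) a \<in> mat_app (P_mat f g) ` l2" by simp
  then show "c_opt \<in> l2" "mat_app (P_mat f g) c_opt = mat_app (R_mat f g) a"
    unfolding c_opt_def mat_inv_app_def by (rule inv_into_into, rule f_inv_into_f)
qed

lemma C_synth: "synth pos_freq c_opt (C_fun a f g)"
  unfolding C_fun_def c_opt_def[symmetric] by (rule l2_series_synth[OF c_opt(1)])

lemma C_sqint: "C_fun a f g \<in> sqint freq"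
  using C_synth by (rule synth_sqint)

lemma C_measurable [measurable]: "C_fun a f g \<in> borel_measurable freq"
  using C_sqint by auto

lemma C_P_sqint: "(\<lambda>t. C_fun a f g t * of_real (1 / (f t + g t))) \<in> sqint freq"
proof -
  obtain K where K: "AE t in freq. \<bar>1 / (f t + g t)\<bar> \<le> K" using P_symbol by blast
  show ?thesis by (rule sqint_symbol[OF C_sqint _ K]) measurable
qed

lemma A_R_sqint: "(\<lambda>t. A_fun a t * of_real (f t / (f t + g t))) \<in> sqint freq"
  by (rule sqint_symbol[OF A_fun_sqint[OF a] _ R_symbol]) measurable

lemma Ra_eq: "mat_app (R_mat f g) a = (\<lambda>l. fourier (\<lambda>t. A_fun a t * of_real (f t / (f t + g t))) (pos_freq l))"
  unfolding R_mat_eq by (rule mat_app_sym_eq[OF _ R_symbol A_fun_synth[OF a]]) measurable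

lemma Pc_eq: "mat_app (P_mat f g) c_opt = (\<lambda>l. fourier (\<lambda>t. C_fun a f g t * of_real (1 / (f t + g t))) (pos_freq l))"
proof -
  obtain K where K: "AE t in freq. \<bar>1 / (f t + g t)\<bar> \<le> K" using P_symbol by blast
  show ?thesis unfolding P_mat_eq by (rule mat_app_sym_eq[OF _ K C_synth]) measurable
qed

lemma h_opt_eq: "h_opt a f g = (\<lambda>t. A_fun a t * of_real (f t / (f t + g t)) - C_fun a f g t * of_real (1 / (f t + g t)))"
  by (simp add: fun_eq_iff h_opt_def)

text \<open>The equation \<open>P c = R a\<close> says exactly that the positive frequencies cancel.\<close>

lemma h_opt_past: "past (h_opt a f g)"
  unfolding past_def h_opt_eq
proof (intro conjI allI)
  show "(\<lambda>t. A_fun a t * of_real (f t / (f t + g t)) - C_fun a f g t * of_real (1 / (f t + g t))) \<in> sqint freq"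
    by (rule sqint_diff[OF A_R_sqint C_P_sqint])
  fix k
  have "fourier (\<lambda>t. A_fun a t * of_real (f t / (f t + g t)) - C_fun a f g t * of_real (1 / (f t + g t))) (pos_freq k)
    = mat_app (R_mat f g) a k - mat_app (P_mat f g) c_opt k"
    unfolding Ra_eq Pc_eq by (intro fourier_diff sqint_integrable_freq A_R_sqint C_P_sqint)
  then show "fourier (\<lambda>t. A_fun a t * of_real (f t / (f t + g t)) - C_fun a f g t * of_real (1 / (f t + g t))) (pos_freq k) = 0"
    by (simp add: c_opt(2))
qed

lemma h_opt_sqint: "h_opt a f g \<in> sqint freq"
  using h_opt_past by (simp add: past_def)

text \<open>
  Both sides are the integral of \<open>|A|\<^sup>2 f g / (f + g) + |C|\<^sup>2 / (f + g)\<close>: on the left by Parseval, on the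
  right because the mixed terms \<open>A C\<close> of the two parts of the error cancel.
\<close>

lemma objective_eq_err: "objective a f g = err a f g (h_opt a f g)"
proof -
  define s where "s t = f t + g t" for t
  define A where "A = A_fun a"
  define C where "C = C_fun a f g"
  have [measurable]: "A \<in> borel_measurable freq" "C \<in> borel_measurable freq"
    by (auto simp: A_def C_def)
  have As: "A \<in> sqint freq" unfolding A_def by (rule A_fun_sqint[OF a])
  obtain K where K: "AE t in freq. \<bar>f t * g t / s t\<bar> \<le> K" using Q_symbol unfolding s_def by blast
  have AQ: "(\<lambda>t. A t * of_real (f t * g t / s t)) \<in> sqint freq"
    by (rule sqint_symbol[OF As _ K]) (simp add: s_def)
  have CP: "(\<lambda>t. C t * of_real (1 / s t)) \<in> sqint freq"
    using C_P_sqint by (simp add: s_def C_def)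
  have Qa: "mat_app (Q_mat f g) a = (\<lambda>l. fourier (\<lambda>t. A t * of_real (f t * g t / s t)) (neg_freq l))"
    unfolding Q_mat_eq A_def s_def
    by (rule mat_app_sym_eq[OF _ K[unfolded s_def] A_fun_synth[OF a]]) measurable
  have 1: "l2_inner (mat_app (Q_mat f g) a) a = of_real (1 / (2 * pi) * (LINT t|freq. (cmod (A t))\<^sup>2 * (f t * g t / s t)))"
  proof -
    have "l2_inner (mat_app (Q_mat f g) a) a = 1 / (2 * pi) * (LINT t|freq. A t * of_real (f t * g t / s t) * cnj (A t))"
      unfolding Qa using synth_parseval[OF A_fun_synth[OF a] AQ] by (simp add: A_def)
    also have "(\<lambda>t. A t * of_real (f t * g t / s t) * cnj (A t)) = (\<lambda>t. of_real ((cmod (A t))\<^sup>2 * (f t * g t / s t)))"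
      by (simp only: of_real_mult complex_norm_square mult_ac)
    finally show ?thesis unfolding integral_complex_of_real by simp
  qed
  have 2: "l2_inner (mat_app (R_mat f g) a) c_opt = of_real (1 / (2 * pi) * (LINT t|freq. (cmod (C t))\<^sup>2 * (1 / s t)))"
  proof -
    have "l2_inner (mat_app (R_mat f g) a) c_opt = 1 / (2 * pi) * (LINT t|freq. C t * of_real (1 / s t) * cnj (C t))"
      unfolding c_opt(2)[symmetric] Pc_eq
      using synth_parseval[OF C_synth CP] by (simp add: C_def s_def)
    also have "(\<lambda>t. C t * of_real (1 / s t) * cnj (C t)) = (\<lambda>t. of_real ((cmod (C t))\<^sup>2 * (1 / s t)))"
      by (simp only: of_real_mult complex_norm_square mult_ac)
    finally show ?thesis unfolding integral_complex_of_real by simp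
  qed
  obtain K' where K': "AE t in freq. \<bar>1 / s t\<bar> \<le> K'" using P_symbol unfolding s_def by blast
  have i1: "integrable freq (\<lambda>t. (cmod (A t))\<^sup>2 * (f t * g t / s t))"
    by (rule weighted_sqint_integrable[OF As _ K]) (simp add: s_def)
  have i2: "integrable freq (\<lambda>t. (cmod (C t))\<^sup>2 * (1 / s t))"
    by (rule weighted_sqint_integrable[OF _ _ K']) (auto simp: s_def C_def C_sqint)
  have "objective a f g = 1 / (2 * pi) * (LINT t|freq. (cmod (C t))\<^sup>2 * (1 / s t))
      + 1 / (2 * pi) * (LINT t|freq. (cmod (A t))\<^sup>2 * (f t * g t / s t))"
    unfolding objective_def c_opt_def[symmetric] 1 2 by (simp only: Re_complex_of_real plus_complex.sel)
  also have "\<dots> = 1 / (2 * pi) * (LINT t|freq. (cmod (A t))\<^sup>2 * (f t * g t / s t) + (cmod (C t))\<^sup>2 * (1 / s t))"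
    by (subst Bochner_Integration.integral_add[OF i1 i2]) (simp add: distrib_left)
  also have "(LINT t|freq. (cmod (A t))\<^sup>2 * (f t * g t / s t) + (cmod (C t))\<^sup>2 * (1 / s t))
      = (LINT t|freq. (cmod (A_fun a t - h_opt a f g t))\<^sup>2 * f t + (cmod (h_opt a f g t))\<^sup>2 * g t)"
  proof (rule integral_cong_AE)
    obtain m M where mM: "0 < m" "AE t in freq. 0 \<le> f t \<and> 0 \<le> g t \<and> m \<le> f t + g t \<and> f t + g t \<le> M"
      using pair_bounds by blast
    show "AE t in freq. (cmod (A t))\<^sup>2 * (f t * g t / s t) + (cmod (C t))\<^sup>2 * (1 / s t)
      = (cmod (A_fun a t - h_opt a f g t))\<^sup>2 * f t + (cmod (h_opt a f g t))\<^sup>2 * g t"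
      using mM(2)
    proof eventually_elim
      case (elim t)
      then have s: "s t > 0" using mM(1) by (simp add: s_def)
      have h: "h_opt a f g t = (A t * f t - C t) / s t"
        by (simp add: h_opt_def A_def C_def s_def diff_divide_distrib)
      have Ah: "A_fun a t - h_opt a f g t = (A t * g t + C t) / s t"
      proof -
        have "complex_of_real (s t) \<noteq> 0" using s by simp
        then show ?thesis unfolding h A_def[symmetric]
          by (simp add: field_simps) (simp add: s_def algebra_simps)
      qed
      have "(cmod (A_fun a t - h_opt a f g t))\<^sup>2 * f t + (cmod (h_opt a f g t))\<^sup>2 * g t
         = ((cmod (A t * g t + C t))\<^sup>2 * f t + (cmod (A t * f t - C t))\<^sup>2 * g t) / (s t)\<^sup>2"
      proof -
        have "(cmod (A_fun a t - h_opt a f g t))\<^sup>2 = (cmod (A t * g t + C t))\<^sup>2 / (s t)\<^sup>2"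
          unfolding Ah by (simp add: norm_divide power_divide)
        moreover have "(cmod (h_opt a f g t))\<^sup>2 = (cmod (A t * f t - C t))\<^sup>2 / (s t)\<^sup>2"
          unfolding h by (simp add: norm_divide power_divide)
        ultimately show ?thesis by (simp add: add_divide_distrib)
      qed
      also have "(cmod (A t * g t + C t))\<^sup>2 * f t + (cmod (A t * f t - C t))\<^sup>2 * g t
         = ((cmod (A t))\<^sup>2 * (f t * g t) + (cmod (C t))\<^sup>2) * s t"
        by (simp add: cmod_power2 s_def) (simp add: power2_eq_square algebra_simps)
      also have "\<dots> / (s t)\<^sup>2 = (cmod (A t))\<^sup>2 * (f t * g t / s t) + (cmod (C t))\<^sup>2 * (1 / s t)"
        using s by (simp add: power2_eq_square field_simps)
      finally show ?case ..
    qed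
  qed (use h_opt_sqint in \<open>auto simp: s_def\<close>)
  finally show ?thesis by (simp add: err_def)
qed

text \<open>
  Since \<open>(A - h) f - h g = C\<close> for the optimal \<open>h\<close> and \<open>C\<close> has only positive frequencies, the error
  is a Pythagorean sum on the functions with frequencies in the past.
\<close>

lemma err_pythagoras:
  assumes "past h"
  shows "err a f g h = err a f g (h_opt a f g)
    + 1 / (2 * pi) * (LINT t|freq. (cmod (h t - h_opt a f g t))\<^sup>2 * (f t + g t))"
proof -
  define h0 where "h0 = h_opt a f g"
  define d where "d t = h t - h0 t" for t
  have d: "past d" unfolding d_def h0_def by (rule past_diff[OF assms h_opt_past])
  then have ds: "d \<in> sqint freq" by (simp add: past_def)
  have h0s: "h0 \<in> sqint freq" unfolding h0_def by (rule h_opt_sqint)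
  obtain m M where mM: "0 < m" "AE t in freq. 0 \<le> f t \<and> 0 \<le> g t \<and> m \<le> f t + g t \<and> f t + g t \<le> M"
    using pair_bounds by blast
  have b: "AE t in freq. 0 \<le> f t \<and> f t \<le> M" "AE t in freq. 0 \<le> g t \<and> g t \<le> M" "AE t in freq. \<bar>f t + g t\<bar> \<le> M"
    using mM(2) by (eventually_elim, auto)+
  note i = mse_eq_err(2,3)[OF a h0s _ b(1) _ b(2)]
  have i3: "integrable freq (\<lambda>t. (cmod (d t))\<^sup>2 * (f t + g t))"
    by (rule weighted_sqint_integrable[OF ds _ b(3)]) measurable
  have i4: "integrable freq (\<lambda>t. C_fun a f g t * cnj (d t))"
    by (rule sqint_inner_integrable[OF C_sqint ds])
  have "(\<lambda>k. c_opt k * (2 * pi * cnj (fourier d (pos_freq k)))) sums (LINT t|freq. C_fun a f g t * cnj (d t))"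
    by (rule synth_inner[OF C_synth ds])
  then have C0: "(LINT t|freq. C_fun a f g t * cnj (d t)) = 0"
    using d by (simp add: past_def sums_iff)
  define p where "p t = Re (C_fun a f g t * cnj (d t))" for t
  have p: "integrable freq p" "(LINT t|freq. p t) = 0"
    unfolding p_def using i4 C0 by (auto simp del: complex_cnj_mult times_complex.sel)
  have "(LINT t|freq. (cmod (A_fun a t - h t))\<^sup>2 * f t + (cmod (h t))\<^sup>2 * g t)
     = (LINT t|freq. (((cmod (A_fun a t - h0 t))\<^sup>2 * f t + (cmod (h0 t))\<^sup>2 * g t) - 2 * p t) + (cmod (d t))\<^sup>2 * (f t + g t))"
  proof (rule integral_cong_AE)
    show "AE t in freq. (cmod (A_fun a t - h t))\<^sup>2 * f t + (cmod (h t))\<^sup>2 * g t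
       = (((cmod (A_fun a t - h0 t))\<^sup>2 * f t + (cmod (h0 t))\<^sup>2 * g t) - 2 * p t) + (cmod (d t))\<^sup>2 * (f t + g t)"
      using mM(2)
    proof eventually_elim
      case (elim t)
      then have s: "complex_of_real (f t + g t) \<noteq> 0" using mM(1) by (auto simp del: of_real_add)
      have "h0 t = (A_fun a t * f t - C_fun a f g t) / complex_of_real (f t + g t)"
        by (simp add: h0_def h_opt_def diff_divide_distrib)
      then have "h0 t * complex_of_real (f t + g t) = A_fun a t * f t - C_fun a f g t"
        using s by simp
      then have C: "C_fun a f g t = A_fun a t * f t - h0 t * (f t + g t)"
        by (simp add: algebra_simps)
      have h: "h t = h0 t + d t" by (simp add: d_def)
      show ?case
        unfolding p_def C h by (simp add: cmod_power2) (simp add: power2_eq_square algebra_simps)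
    qed
  qed (use assms h0s ds p in \<open>auto simp: past_def\<close>)
  also have "\<dots> = (LINT t|freq. (cmod (A_fun a t - h0 t))\<^sup>2 * f t + (cmod (h0 t))\<^sup>2 * g t)
     + (LINT t|freq. (cmod (d t))\<^sup>2 * (f t + g t))"
    using i i3 p by simp
  finally show ?thesis unfolding err_def h0_def[symmetric] d_def[symmetric] by (simp only: distrib_left)
qed

end

section \<open>Functions with frequencies in the past\<close>

text \<open>
  As \<open>f + g\<close> is bounded away from \<open>0\<close>, approximation in \<open>L\<^sub>2(f + g)\<close> is approximation in \<open>L\<^sub>2\<close>, where
  Fourier coefficients are continuous.
\<close>

lemma L2_past_imp_past:
  assumes "bounded_pair f g" and h: "h \<in> L2_past (\<lambda>t. f t + g t)"
  shows "past h"
proof -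
  obtain m M where m: "0 < m" and meas [measurable]: "f \<in> borel_measurable freq" "g \<in> borel_measurable freq"
    and ae: "AE t in freq. 0 \<le> f t \<and> 0 \<le> g t \<and> m \<le> f t + g t \<and> f t + g t \<le> M"
    using assms(1) by (rule bounded_pairE)
  have hm [measurable]: "h \<in> borel_measurable freq" using h by (simp add: L2_past_def)
  have weight: "ennreal m * (\<integral>\<^sup>+t. ennreal ((cmod (d t))\<^sup>2) \<partial>freq)
      \<le> (\<integral>\<^sup>+t. ennreal ((cmod (d t))\<^sup>2 * (f t + g t)) \<partial>freq)"
    if [measurable]: "d \<in> borel_measurable freq" for d
  proof -
    have "ennreal m * (\<integral>\<^sup>+t. ennreal ((cmod (d t))\<^sup>2) \<partial>freq) = (\<integral>\<^sup>+t. ennreal m * ennreal ((cmod (d t))\<^sup>2) \<partial>freq)"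
      by (rule nn_integral_cmult[symmetric]) measurable
    also have "\<dots> \<le> (\<integral>\<^sup>+t. ennreal ((cmod (d t))\<^sup>2 * (f t + g t)) \<partial>freq)"
    proof (rule nn_integral_mono_AE)
      show "AE t in freq. ennreal m * ennreal ((cmod (d t))\<^sup>2) \<le> ennreal ((cmod (d t))\<^sup>2 * (f t + g t))"
        using ae
      proof eventually_elim
        case (elim t)
        then have "m * (cmod (d t))\<^sup>2 \<le> (f t + g t) * (cmod (d t))\<^sup>2" by (intro mult_right_mono) auto
        then show ?case using m by (simp add: ennreal_mult'[symmetric] mult.commute ennreal_leI)
      qed
    qed
    finally show ?thesis .
  qed
  have sq: "d \<in> sqint freq" if "d \<in> borel_measurable freq"
    "(\<integral>\<^sup>+t. ennreal ((cmod (d t))\<^sup>2 * (f t + g t)) \<partial>freq) < \<infinity>" for d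
  proof (rule sqint_nn_integral[OF that(1)])
    have "ennreal m * (\<integral>\<^sup>+t. ennreal ((cmod (d t))\<^sup>2) \<partial>freq) < \<infinity>"
      using weight[OF that(1)] that(2) by (rule le_less_trans)
    then show "(\<integral>\<^sup>+t. ennreal ((cmod (d t))\<^sup>2) \<partial>freq) < \<infinity>"
      using m by (auto simp: ennreal_mult_less_top)
  qed
  have hs: "h \<in> sqint freq" using h by (intro sq hm) (simp add: L2_past_def)
  have "fourier h (pos_freq k) = 0" for k
  proof (rule ccontr)
    assume nz: "fourier h (pos_freq k) \<noteq> 0"
    define e where "e = m * (cmod (fourier h (pos_freq k)))\<^sup>2"
    have "e > 0" using nz m by (simp add: e_def)
    then obtain N c where N: "(\<integral>\<^sup>+t. ennreal ((cmod (h t - (\<Sum>k\<le>N. c k * cis (- t * real k))))\<^sup>2 * (f t + g t)) \<partial>freq) < ennreal e"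
      using h unfolding L2_past_def by blast
    define p where "p t = (\<Sum>k\<le>N. c k * chr (neg_freq k) t)" for t
    have p_eq: "(\<Sum>k\<le>N. c k * cis (- t * real k)) = p t" for t
      by (simp add: p_def chr_def neg_freq_def)
    have ps: "p \<in> sqint freq" unfolding p_def by (rule sqint_trig_sum)
    have ds: "(\<lambda>t. h t - p t) \<in> sqint freq" by (rule sqint_diff[OF hs ps])
    have "fourier p (pos_freq k) = 0"
      unfolding p_def
      by (subst fourier_sum) (auto intro!: sqint_integrable_freq sqint_cmult sqint_chr simp: fourier_cmult fourier_chr neg_freq_def pos_freq_def)
    then have "cmod (fourier h (pos_freq k)) = cmod (fourier (\<lambda>t. h t - p t) (pos_freq k))"
      using hs ps by (simp add: fourier_diff sqint_integrable_freq)
    also have "\<dots> \<le> L2n freq (\<lambda>t. h t - p t)" by (rule fourier_norm_le[OF ds])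
    finally have "e \<le> m * (L2n freq (\<lambda>t. h t - p t))\<^sup>2"
      unfolding e_def using m by (intro mult_left_mono power_mono) auto
    then have "ennreal e \<le> ennreal m * (\<integral>\<^sup>+t. ennreal ((cmod (h t - p t))\<^sup>2) \<partial>freq)"
      unfolding nn_integral_sqint[OF ds] using m by (simp add: ennreal_mult'[symmetric] ennreal_leI)
    also have "\<dots> \<le> (\<integral>\<^sup>+t. ennreal ((cmod (h t - p t))\<^sup>2 * (f t + g t)) \<partial>freq)"
      using ds by (intro weight) auto
    also have "\<dots> < ennreal e" using N unfolding p_eq .
    finally show False by simp
  qed
  then show ?thesis using hs by (simp add: past_def)
qed

lemma past_fejer_poly:
  assumes "past h"
  shows "\<exists>c. \<forall>t. fejer N h t = (\<Sum>k\<le>N. c k * cis (- t * real k))"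
proof -
  have z: "fourier h m = 0" if "m > 0" for m
  proof -
    have "m = pos_freq (nat (m - 1))" using that by (simp add: pos_freq_def)
    then show ?thesis using assms unfolding past_def by metis
  qed
  define c where "c k = of_real (1 - \<bar>of_int (- int k)\<bar> / N) * fourier h (- int k)" for k
  have "fejer N h t = (\<Sum>k\<le>N. c k * cis (- t * real k))" for t
  proof -
    have "fejer N h t = (\<Sum>m\<in>{-int N..0}. of_real (1 - \<bar>of_int m\<bar> / N) * fourier h m * chr m t)"
      unfolding fejer_def by (rule sum.mono_neutral_right) (auto simp: z)
    also have "\<dots> = (\<Sum>k\<le>N. c k * cis (- t * real k))"
      by (rule sum.reindex_bij_witness[of _ "\<lambda>k. - int k" "\<lambda>m. nat (- m)"])
         (auto simp: c_def chr_def)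
    finally show ?thesis .
  qed
  then show ?thesis by blast
qed

text \<open>
  The Fejer means of \<open>h\<close> are dominated by a constant, so they converge in \<open>L\<^sub>2(w)\<close> for every integrable
  weight \<open>w\<close>, bounded or not.
\<close>

lemma past_bounded_imp_L2_past:
  fixes w :: "real \<Rightarrow> real"
  assumes h: "past h" "AE t in freq. cmod (h t) \<le> B"
    and w: "integrable freq w" "AE t in freq. 0 \<le> w t"
  shows "h \<in> L2_past w"
proof -
  have hm [measurable]: "h \<in> borel_measurable freq" using h by (auto simp: past_def)
  have [measurable]: "w \<in> borel_measurable freq" using w by auto
  have hi: "integrable freq h" using h by (auto simp: past_def intro: sqint_integrable_freq)
  have [measurable]: "fejer N h \<in> borel_measurable freq" for N
    by (rule borel_measurable_integrable[OF fejer_integrable])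
  obtain r where r: "\<And>n. r n > 0" "AE t in freq. (\<lambda>n. fejer (r n) h t) \<longlonglongrightarrow> h t"
    using fejer_subseq[OF hm h(2)] by blast
  have bd: "integrable freq (\<lambda>t. (cmod (d t))\<^sup>2 * w t)" "AE t in freq. norm ((cmod (d t))\<^sup>2 * w t) \<le> (2 * B)\<^sup>2 * w t"
    if [measurable]: "d \<in> borel_measurable freq" and d: "AE t in freq. cmod (d t) \<le> 2 * B" for d
  proof -
    show 1: "AE t in freq. norm ((cmod (d t))\<^sup>2 * w t) \<le> (2 * B)\<^sup>2 * w t"
      using d w(2)
    proof eventually_elim
      case (elim t)
      have "(cmod (d t))\<^sup>2 * w t \<le> (2 * B)\<^sup>2 * w t"
        using elim by (intro mult_right_mono power_mono) auto
      then show ?case using elim(2) by simp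
    qed
    show "integrable freq (\<lambda>t. (cmod (d t))\<^sup>2 * w t)"
    proof (rule Bochner_Integration.integrable_bound)
      show "integrable freq (\<lambda>t. (2 * B)\<^sup>2 * w t)" using w(1) by simp
      show "AE t in freq. norm ((cmod (d t))\<^sup>2 * w t) \<le> norm ((2 * B)\<^sup>2 * w t)"
        using 1 by eventually_elim auto
    qed measurable
  qed
  have hB: "AE t in freq. cmod (h t) \<le> 2 * B"
    using h(2)
  proof eventually_elim
    case (elim t) then show ?case using norm_ge_zero[of "h t"] by linarith
  qed
  have dB: "AE t in freq. cmod (h t - fejer (r n) h t) \<le> 2 * B" for n
    using h(2)
  proof eventually_elim
    case (elim t)
    then show ?case
      using norm_triangle_ineq4[of "h t" "fejer (r n) h t"] fejer_bounded[OF r(1) hi h(2), of n t] by linarith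
  qed
  have n: "AE t in freq. 0 \<le> (cmod (d t))\<^sup>2 * w t" for d :: "real \<Rightarrow> complex"
    using w(2) by eventually_elim simp
  have fin: "(\<integral>\<^sup>+t. ennreal ((cmod (h t))\<^sup>2 * w t) \<partial>freq) < \<infinity>"
    using bd(1)[OF hm hB] by (subst nn_integral_eq_integral[OF _ n]) auto
  have lim: "(\<lambda>k. LINT t|freq. (cmod (h t - fejer (r k) h t))\<^sup>2 * w t) \<longlonglongrightarrow> (LINT t|freq. 0)"
  proof (rule integral_dominated_convergence[where w = "\<lambda>t. (2 * B)\<^sup>2 * w t"])
    show "AE t in freq. (\<lambda>k. (cmod (h t - fejer (r k) h t))\<^sup>2 * w t) \<longlonglongrightarrow> 0"
      using r(2)
    proof eventually_elim
      case (elim t)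
      have "(\<lambda>k. (cmod (h t - fejer (r k) h t))\<^sup>2 * w t) \<longlonglongrightarrow> (cmod (h t - h t))\<^sup>2 * w t"
        by (intro tendsto_intros elim)
      then show ?case by simp
    qed
    show "AE t in freq. norm ((cmod (h t - fejer (r k) h t))\<^sup>2 * w t) \<le> (2 * B)\<^sup>2 * w t" for k
      by (rule bd(2)[OF _ dB]) measurable
  qed (use w in auto)
  have "\<exists>N c. (\<integral>\<^sup>+t. ennreal ((cmod (h t - (\<Sum>k\<le>N. c k * cis (- t * real k))))\<^sup>2 * w t) \<partial>freq) < ennreal e"
    if "e > 0" for e
  proof -
    obtain k where k: "\<bar>LINT t|freq. (cmod (h t - fejer (r k) h t))\<^sup>2 * w t\<bar> < e"
      using LIMSEQ_D[OF lim \<open>e > 0\<close>] by auto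
    obtain c where c: "\<And>t. fejer (r k) h t = (\<Sum>j\<le>r k. c j * cis (- t * real j))"
      using past_fejer_poly[OF h(1)] by blast
    have "integrable freq (\<lambda>t. (cmod (h t - fejer (r k) h t))\<^sup>2 * w t)"
      by (rule bd(1)[OF _ dB]) measurable
    then have "(\<integral>\<^sup>+t. ennreal ((cmod (h t - fejer (r k) h t))\<^sup>2 * w t) \<partial>freq) < ennreal e"
      using k that by (subst nn_integral_eq_integral[OF _ n]) (auto intro!: ennreal_lessI)
    then show ?thesis unfolding c by blast
  qed
  then show ?thesis using fin hm by (auto simp: L2_past_def)
qed

section \<open>The saddle point\<close>

lemma norm_add_power2_le_weighted:
  assumes "\<eta> > 0"
  shows "(cmod (x + y))\<^sup>2 \<le> (1 + \<eta>) * (cmod x)\<^sup>2 + (1 + 1 / \<eta>) * (cmod y)\<^sup>2"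
proof -
  have "0 \<le> (\<eta> * cmod x - cmod y)\<^sup>2 / \<eta>" using assms by simp
  also have "\<dots> = \<eta> * (cmod x)\<^sup>2 + 1 / \<eta> * (cmod y)\<^sup>2 - 2 * cmod x * cmod y"
    using assms by (simp add: power2_diff power2_eq_square field_simps)
  finally have "2 * cmod x * cmod y \<le> \<eta> * (cmod x)\<^sup>2 + 1 / \<eta> * (cmod y)\<^sup>2" by simp
  moreover have "(cmod (x + y))\<^sup>2 \<le> (cmod x + cmod y)\<^sup>2"
    by (intro power_mono norm_triangle_ineq) auto
  ultimately show ?thesis by (simp add: power2_sum algebra_simps)
qed

definition mix :: "real \<Rightarrow> (real \<Rightarrow> real) \<Rightarrow> (real \<Rightarrow> real) \<Rightarrow> real \<Rightarrow> real" where
  "mix s f0 f t = (1 - s) * f0 t + s * f t"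

lemma spectral_density_mix:
  assumes "spectral_density f0" "spectral_density f" "0 \<le> s" "s \<le> 1"
  shows "spectral_density (mix s f0 f)"
proof -
  have n: "AE t in freq. 0 \<le> f0 t" "AE t in freq. 0 \<le> f t" and i: "integrable freq f0" "integrable freq f"
    using assms by (auto simp: spectral_density_def)
  from n have "AE t in freq. 0 \<le> mix s f0 f t"
    by eventually_elim (use assms(3,4) in \<open>auto simp: mix_def\<close>)
  with i show ?thesis by (auto simp: spectral_density_def mix_def[abs_def])
qed

lemma bounded_pair_mix:
  assumes "bounded_pair f0 g0" "spectral_density f" "spectral_density g"
    and "AE t in freq. f t \<le> K" "AE t in freq. g t \<le> K" and s: "0 < s" "s < 1"
  shows "bounded_pair (mix s f0 f) (mix s g0 g)"
proof -
  obtain m M where m: "0 < m" 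
    and ae: "AE t in freq. 0 \<le> f0 t \<and> 0 \<le> g0 t \<and> m \<le> f0 t + g0 t \<and> f0 t + g0 t \<le> M"
    using assms(1) by (rule bounded_pairE)
  have "AE t in freq. 0 \<le> f t" "AE t in freq. 0 \<le> g t"
    using assms(2,3) by (auto simp: spectral_density_def)
  with ae assms(4,5)
  have "AE t in freq. (1 - s) * m \<le> mix s f0 f t + mix s g0 g t \<and> mix s f0 f t + mix s g0 g t \<le> (1 - s) * M + s * (K + K)"
  proof eventually_elim
    case (elim t)
    have eq: "mix s f0 f t + mix s g0 g t = (1 - s) * (f0 t + g0 t) + s * (f t + g t)"
      by (simp add: mix_def algebra_simps)
    have "(1 - s) * m + s * 0 \<le> (1 - s) * (f0 t + g0 t) + s * (f t + g t)"
      using elim s by (intro add_mono mult_left_mono) auto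
    moreover have "(1 - s) * (f0 t + g0 t) + s * (f t + g t) \<le> (1 - s) * M + s * (K + K)"
      using elim s by (intro add_mono mult_left_mono) auto
    ultimately show ?case unfolding eq by simp
  qed
  moreover have "0 < (1 - s) * m" using m s by simp
  moreover have "spectral_density (mix s f0 f)" "spectral_density (mix s g0 g)"
    using assms(1-3) s by (auto simp: bounded_pair_def intro!: spectral_density_mix)
  ultimately show ?thesis unfolding bounded_pair_def by blast
qed

lemma err_mix:
  assumes "integrable freq (\<lambda>t. (cmod (A_fun a t - h t))\<^sup>2 * f0 t)" "integrable freq (\<lambda>t. (cmod (h t))\<^sup>2 * g0 t)"
    and "integrable freq (\<lambda>t. (cmod (A_fun a t - h t))\<^sup>2 * f t)" "integrable freq (\<lambda>t. (cmod (h t))\<^sup>2 * g t)"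
  shows "err a (mix s f0 f) (mix s g0 g) h = (1 - s) * err a f0 g0 h + s * err a f g h"
proof -
  have "(LINT t|freq. (cmod (A_fun a t - h t))\<^sup>2 * mix s f0 f t + (cmod (h t))\<^sup>2 * mix s g0 g t)
     = (LINT t|freq. (1 - s) * ((cmod (A_fun a t - h t))\<^sup>2 * f0 t + (cmod (h t))\<^sup>2 * g0 t)
        + s * ((cmod (A_fun a t - h t))\<^sup>2 * f t + (cmod (h t))\<^sup>2 * g t))"
    by (intro Bochner_Integration.integral_cong refl) (simp add: mix_def algebra_simps)
  also have "\<dots> = (1 - s) * (LINT t|freq. (cmod (A_fun a t - h t))\<^sup>2 * f0 t + (cmod (h t))\<^sup>2 * g0 t)
        + s * (LINT t|freq. (cmod (A_fun a t - h t))\<^sup>2 * f t + (cmod (h t))\<^sup>2 * g t)"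
    by (subst Bochner_Integration.integral_add)
       (intro integrable_mult_right Bochner_Integration.integrable_add assms, intro integrable_mult_right Bochner_Integration.integrable_add assms,
        simp only: integral_mult_right_zero)
  finally show ?thesis unfolding err_def by (simp only: distrib_left mult.left_commute)
qed

text \<open>
  The error is a squared seminorm of the pair \<open>(A - h, h)\<close>, and the two pairs differ by \<open>h - h0\<close>.
\<close>

lemma err_perturb:
  assumes a: "summable (\<lambda>k. cmod (a k))" and h: "h \<in> sqint freq" and h0: "h0 \<in> sqint freq"
    and f: "f \<in> borel_measurable freq" "AE t in freq. 0 \<le> f t \<and> f t \<le> K"
    and g: "g \<in> borel_measurable freq" "AE t in freq. 0 \<le> g t \<and> g t \<le> K"
    and "\<eta> > 0"
  shows "err a f g h0 \<le> (1 + \<eta>) * err a f g h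
    + (1 + 1 / \<eta>) * (2 * K * (1 / (2 * pi) * (L2n freq (\<lambda>t. h t - h0 t))\<^sup>2))"
proof -
  note i0 = mse_eq_err(2,3)[OF a h0 f g]
  note i = mse_eq_err(2,3)[OF a h f g]
  have d: "integrable freq (\<lambda>t. (cmod (h t - h0 t))\<^sup>2)" using sqint_integrable[OF sqint_diff[OF h h0]] .
  have "(LINT t|freq. (cmod (A_fun a t - h0 t))\<^sup>2 * f t + (cmod (h0 t))\<^sup>2 * g t)
     \<le> (LINT t|freq. (1 + \<eta>) * ((cmod (A_fun a t - h t))\<^sup>2 * f t + (cmod (h t))\<^sup>2 * g t)
        + (1 + 1 / \<eta>) * (2 * K) * (cmod (h t - h0 t))\<^sup>2)"
  proof (rule integral_mono_AE)
    show "integrable freq (\<lambda>t. (cmod (A_fun a t - h0 t))\<^sup>2 * f t + (cmod (h0 t))\<^sup>2 * g t)"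
      by (intro Bochner_Integration.integrable_add i0)
    show "integrable freq (\<lambda>t. (1 + \<eta>) * ((cmod (A_fun a t - h t))\<^sup>2 * f t + (cmod (h t))\<^sup>2 * g t)
        + (1 + 1 / \<eta>) * (2 * K) * (cmod (h t - h0 t))\<^sup>2)"
      by (intro Bochner_Integration.integrable_add integrable_mult_right i d)
    show "AE t in freq. (cmod (A_fun a t - h0 t))\<^sup>2 * f t + (cmod (h0 t))\<^sup>2 * g t
       \<le> (1 + \<eta>) * ((cmod (A_fun a t - h t))\<^sup>2 * f t + (cmod (h t))\<^sup>2 * g t)
        + (1 + 1 / \<eta>) * (2 * K) * (cmod (h t - h0 t))\<^sup>2"
      using f(2) g(2)
    proof eventually_elim
      case (elim t)
      define D where "D = (1 + 1 / \<eta>) * (cmod (h t - h0 t))\<^sup>2"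
      have D: "0 \<le> D" using \<open>\<eta> > 0\<close> by (simp add: D_def)
      have "(cmod (A_fun a t - h0 t))\<^sup>2 \<le> (1 + \<eta>) * (cmod (A_fun a t - h t))\<^sup>2 + D"
        using norm_add_power2_le_weighted[OF \<open>\<eta> > 0\<close>, of "A_fun a t - h t" "h t - h0 t"] by (simp add: D_def)
      then have 1: "(cmod (A_fun a t - h0 t))\<^sup>2 * f t \<le> ((1 + \<eta>) * (cmod (A_fun a t - h t))\<^sup>2 + D) * f t"
        using elim by (intro mult_right_mono) auto
      have "(cmod (h0 t))\<^sup>2 \<le> (1 + \<eta>) * (cmod (h t))\<^sup>2 + D"
        using norm_add_power2_le_weighted[OF \<open>\<eta> > 0\<close>, of "h t" "h0 t - h t"] by (simp add: D_def norm_minus_commute)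
      then have 2: "(cmod (h0 t))\<^sup>2 * g t \<le> ((1 + \<eta>) * (cmod (h t))\<^sup>2 + D) * g t"
        using elim by (intro mult_right_mono) auto
      have 3: "D * f t + D * g t \<le> D * K + D * K"
        using elim D by (intro add_mono mult_left_mono) auto
      have "D * K + D * K = (1 + 1 / \<eta>) * (2 * K) * (cmod (h t - h0 t))\<^sup>2" by (simp add: D_def)
      with 1 2 3 show ?case by (simp add: distrib_left distrib_right mult.assoc)
    qed
  qed
  also have "\<dots> = (1 + \<eta>) * (LINT t|freq. (cmod (A_fun a t - h t))\<^sup>2 * f t + (cmod (h t))\<^sup>2 * g t)
      + (1 + 1 / \<eta>) * (2 * K) * (L2n freq (\<lambda>t. h t - h0 t))\<^sup>2"
    unfolding L2n_power2
    by (subst Bochner_Integration.integral_add)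
       (intro integrable_mult_right Bochner_Integration.integrable_add i, intro integrable_mult_right d,
        simp only: integral_mult_right_zero)
  finally have "1 / (2 * pi) * (LINT t|freq. (cmod (A_fun a t - h0 t))\<^sup>2 * f t + (cmod (h0 t))\<^sup>2 * g t)
    \<le> 1 / (2 * pi) * ((1 + \<eta>) * (LINT t|freq. (cmod (A_fun a t - h t))\<^sup>2 * f t + (cmod (h t))\<^sup>2 * g t)
      + (1 + 1 / \<eta>) * (2 * K) * (L2n freq (\<lambda>t. h t - h0 t))\<^sup>2)"
    by (intro mult_left_mono) auto
  then show ?thesis unfolding err_def distrib_left[of "1 / (2 * pi)"] by (simp only: mult_ac)
qed

text \<open>
  With \<open>h\<close> optimal for the mixture, \<open>(1 - s) * err a f0 g0 h + s * err a f g h\<close> is at most the maximum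
  \<open>L0\<close>; the Pythagorean formula for the first term then gives both \<open>err a f g h \<le> L0\<close> and
  \<open>h = h0 + O(sqrt s)\<close> in mean square, and \<open>err_perturb\<close> passes from \<open>h\<close> to \<open>h0\<close>.
\<close>

lemma saddle_bounded:
  assumes a: "summable (\<lambda>k. cmod (a k))" and bp: "bounded_pair f0 g0"
    and sd: "spectral_density f" "spectral_density g"
    and bd: "AE t in freq. f t \<le> K" "AE t in freq. g t \<le> K"
    and max: "\<And>s. 0 < s \<Longrightarrow> s < 1 \<Longrightarrow> objective a (mix s f0 f) (mix s g0 g) \<le> objective a f0 g0"
  shows "err a f g (h_opt a f0 g0) \<le> err a f0 g0 (h_opt a f0 g0)"
proof (rule ccontr)
  define h0 where "h0 = h_opt a f0 g0"
  define L0 where "L0 = err a f0 g0 h0"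
  define Y where "Y = err a f g h0"
  assume "\<not> ?thesis"
  then have "Y > L0" by (simp add: Y_def L0_def h0_def)
  obtain m M where m: "0 < m" "m \<le> M" and meas: "f0 \<in> borel_measurable freq" "g0 \<in> borel_measurable freq"
    and ae: "AE t in freq. 0 \<le> f0 t \<and> 0 \<le> g0 t \<and> m \<le> f0 t + g0 t \<and> f0 t + g0 t \<le> M"
    using bp by (rule bounded_pairE)
  have f0M: "AE t in freq. 0 \<le> f0 t \<and> f0 t \<le> M" and g0M: "AE t in freq. 0 \<le> g0 t \<and> g0 t \<le> M"
    and sM: "AE t in freq. \<bar>f0 t + g0 t\<bar> \<le> M"
    using ae by (eventually_elim, auto)+
  have f: "f \<in> borel_measurable freq" and g: "g \<in> borel_measurable freq"
    and fn: "AE t in freq. 0 \<le> f t" and gn: "AE t in freq. 0 \<le> g t"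
    using sd by (auto simp: spectral_density_def)
  from fn bd(1) have fK: "AE t in freq. 0 \<le> f t \<and> f t \<le> K" by eventually_elim simp
  from gn bd(2) have gK: "AE t in freq. 0 \<le> g t \<and> g t \<le> K" by eventually_elim simp
  have "K \<ge> 0"
  proof (rule ccontr)
    assume "\<not> K \<ge> 0"
    from fK have "AE t in freq. False" by eventually_elim (use \<open>\<not> K \<ge> 0\<close> in auto)
    then have "AE t in freq. 1 = (0 :: real)" by eventually_elim simp
    then have "(LINT t|freq. (1 :: real)) = (LINT t|freq. 0)" by (intro integral_cong_AE) auto
    then show False by simp
  qed
  have h0s: "h0 \<in> sqint freq" unfolding h0_def by (rule h_opt_sqint[OF a bp])
  have L0: "0 \<le> L0" unfolding L0_def by (rule mse_eq_err(4)[OF a h0s meas(1) f0M meas(2) g0M])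
  have key: "Y \<le> L0 + \<eta> * (L0 + 8 * K * L0 / m)" if \<eta>: "0 < \<eta>" "\<eta> \<le> 1 / 2" for \<eta>
  proof -
    \<comment> \<open>The squared distance of \<open>h\<close> and \<open>h0\<close> is of order \<open>s\<close> and gets multiplied by \<open>1 / \<eta>\<close>.\<close>
    define s where "s = \<eta>\<^sup>2"
    have s: "0 < s" "s \<le> 1 / 4"
      using \<eta> power_mono[of \<eta> "1/2" 2] by (auto simp: s_def power2_eq_square)
    then have "s < 1" by simp
    have bps: "bounded_pair (mix s f0 f) (mix s g0 g)"
      by (rule bounded_pair_mix[OF bp sd bd \<open>0 < s\<close> \<open>s < 1\<close>])
    define h where "h = h_opt a (mix s f0 f) (mix s g0 g)"
    have hp: "past h" unfolding h_def by (rule h_opt_past[OF a bps])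
    then have hs: "h \<in> sqint freq" by (simp add: past_def)
    define e where "e = 1 / (2 * pi) * (L2n freq (\<lambda>t. h t - h0 t))\<^sup>2"
    define X where "X = err a f g h"
    have e: "0 \<le> e" by (simp add: e_def)
    have X: "0 \<le> X" unfolding X_def by (rule mse_eq_err(4)[OF a hs f fK g gK])
    have ds: "(\<lambda>t. h t - h0 t) \<in> sqint freq" by (rule sqint_diff[OF hs h0s])
    have "err a (mix s f0 f) (mix s g0 g) h \<le> L0"
      using max[OF \<open>0 < s\<close> \<open>s < 1\<close>] unfolding objective_eq_err[OF a bps] objective_eq_err[OF a bp]
        h_def[symmetric] h0_def[symmetric] L0_def .
    then have 1: "(1 - s) * err a f0 g0 h + s * X \<le> L0"
      unfolding X_def
      using mse_eq_err(2,3)[OF a hs meas(1) f0M meas(2) g0M] mse_eq_err(2,3)[OF a hs f fK g gK]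
      by (simp only: err_mix)
    have "m * e \<le> 1 / (2 * pi) * (LINT t|freq. (cmod (h t - h0 t))\<^sup>2 * (f0 t + g0 t))"
    proof -
      have "(LINT t|freq. m * (cmod (h t - h0 t))\<^sup>2) \<le> (LINT t|freq. (cmod (h t - h0 t))\<^sup>2 * (f0 t + g0 t))"
      proof (rule integral_mono_AE)
        show "integrable freq (\<lambda>t. m * (cmod (h t - h0 t))\<^sup>2)"
          by (intro integrable_mult_right sqint_integrable ds)
        show "integrable freq (\<lambda>t. (cmod (h t - h0 t))\<^sup>2 * (f0 t + g0 t))"
          by (intro weighted_sqint_integrable[OF ds _ sM] borel_measurable_add meas)
        show "AE t in freq. m * (cmod (h t - h0 t))\<^sup>2 \<le> (cmod (h t - h0 t))\<^sup>2 * (f0 t + g0 t)"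
          using ae by eventually_elim (simp add: mult.commute[of _ "f0 _ + g0 _"] mult_right_mono)
      qed
      then have "1 / (2 * pi) * (LINT t|freq. m * (cmod (h t - h0 t))\<^sup>2)
          \<le> 1 / (2 * pi) * (LINT t|freq. (cmod (h t - h0 t))\<^sup>2 * (f0 t + g0 t))"
        by (intro mult_left_mono) auto
      then show ?thesis unfolding e_def L2n_power2 by (simp add: mult_ac)
    qed
    then have 2: "L0 + m * e \<le> err a f0 g0 h"
      using err_pythagoras[OF a bp hp] unfolding L0_def h0_def by simp
    have "(1 - s) * (L0 + m * e) \<le> (1 - s) * err a f0 g0 h"
      using 2 s by (intro mult_left_mono) auto
    with 1 have 3: "(1 - s) * (m * e) + s * X \<le> s * L0" by (simp add: algebra_simps)
    have me: "0 \<le> m * e" using m e by simp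
    then have "0 \<le> (1 - s) * (m * e)" using s by simp
    with 3 have "s * X \<le> s * L0" by linarith
    then have XL: "X \<le> L0" using s by simp
    have "(1 / 2) * (m * e) \<le> (1 - s) * (m * e)" using s me by (intro mult_right_mono) auto
    moreover have "0 \<le> s * X" using s X by simp
    ultimately have "(1 / 2) * (m * e) \<le> s * L0" using 3 by linarith
    then have eL: "e \<le> 2 * s * L0 / m" using m by (simp add: field_simps)
    have "Y \<le> (1 + \<eta>) * X + (1 + 1 / \<eta>) * (2 * K * e)"
      unfolding Y_def X_def e_def by (rule err_perturb[OF a hs h0s f fK g gK \<eta>(1)])
    also have "\<dots> \<le> (1 + \<eta>) * L0 + (1 + 1 / \<eta>) * (2 * K * (2 * s * L0 / m))"
      using XL eL \<eta> \<open>K \<ge> 0\<close> by (intro add_mono mult_left_mono) auto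
    also have "(1 + 1 / \<eta>) * (2 * K * (2 * s * L0 / m)) = (\<eta>\<^sup>2 + \<eta>) * (4 * K * L0 / m)"
      using \<eta> m by (simp add: s_def field_simps power2_eq_square)
    also have "\<dots> \<le> (2 * \<eta>) * (4 * K * L0 / m)"
    proof (rule mult_right_mono)
      have "\<eta> * \<eta> \<le> \<eta> * 1" using \<eta> by (intro mult_left_mono) auto
      then show "\<eta>\<^sup>2 + \<eta> \<le> 2 * \<eta>" by (simp add: power2_eq_square)
    qed (use \<open>K \<ge> 0\<close> L0 m in simp)
    finally show ?thesis by (simp add: algebra_simps)
  qed
  define c where "c = L0 + 8 * K * L0 / m"
  have c: "0 \<le> c" using L0 \<open>K \<ge> 0\<close> m by (simp add: c_def)
  \<comment> \<open>Small enough for \<open>\<eta> c < Y - L0\<close>.\<close>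
  define \<eta> where "\<eta> = min (1 / 2) ((Y - L0) / (2 * (c + 1)))"
  have "0 < \<eta>" using \<open>Y > L0\<close> c by (simp add: \<eta>_def)
  moreover have "\<eta> \<le> 1 / 2" unfolding \<eta>_def by (rule min.cobounded1)
  ultimately have "Y \<le> L0 + \<eta> * c" using key unfolding c_def by blast
  also have "\<eta> * c \<le> (Y - L0) / (2 * (c + 1)) * c" using c by (intro mult_right_mono) (auto simp: \<eta>_def)
  also have "\<dots> < Y - L0"
  proof -
    have "(Y - L0) * c < (Y - L0) * (2 * (c + 1))" using \<open>Y > L0\<close> c by (intro mult_strict_left_mono) auto
    then show ?thesis using c by (simp add: field_simps)
  qed
  finally show False by simp
qed

section \<open>Band and contamination classes\<close>

lemma LINT_mix:
  assumes "integrable freq f0" "integrable freq f"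
  shows "(LINT t|freq. mix s f0 f t) = (1 - s) * (LINT t|freq. f0 t) + s * (LINT t|freq. f t)"
  using assms by (simp add: mix_def)

lemma mean_mix_le:
  assumes "integrable freq f0" "integrable freq f" "0 \<le> s" "s \<le> 1"
    and "1 / (2 * pi) * (LINT t|freq. f0 t) \<le> P" "1 / (2 * pi) * (LINT t|freq. f t) \<le> P"
  shows "1 / (2 * pi) * (LINT t|freq. mix s f0 f t) \<le> P"
proof -
  have "1 / (2 * pi) * (LINT t|freq. mix s f0 f t)
      = (1 - s) * (1 / (2 * pi) * (LINT t|freq. f0 t)) + s * (1 / (2 * pi) * (LINT t|freq. f t))"
    unfolding LINT_mix[OF assms(1,2)] by (simp only: distrib_left mult.left_commute)
  also have "\<dots> \<le> (1 - s) * P + s * P"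
    using assms by (intro add_mono mult_left_mono) auto
  finally show ?thesis by (simp add: algebra_simps)
qed

lemma D_band_mix:
  assumes "f0 \<in> D_band v u P" "f \<in> D_band v u P" and s: "0 \<le> s" "s \<le> 1"
  shows "mix s f0 f \<in> D_band v u P"
proof -
  have f0: "spectral_density f0" "AE t in freq. v t \<le> f0 t \<and> f0 t \<le> u t" "1 / (2 * pi) * (LINT t|freq. f0 t) \<le> P"
    and f: "spectral_density f" "AE t in freq. v t \<le> f t \<and> f t \<le> u t" "1 / (2 * pi) * (LINT t|freq. f t) \<le> P"
    using assms(1,2) by (auto simp: D_band_def)
  have "AE t in freq. v t \<le> mix s f0 f t \<and> mix s f0 f t \<le> u t"
    using f0(2) f(2)
  proof eventually_elim
    case (elim t)
    have "(1 - s) * v t + s * v t \<le> mix s f0 f t" "mix s f0 f t \<le> (1 - s) * u t + s * u t"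
      unfolding mix_def using elim s by (auto intro!: add_mono mult_left_mono)
    then show ?case by (simp add: algebra_simps)
  qed
  moreover have "1 / (2 * pi) * (LINT t|freq. mix s f0 f t) \<le> P"
    using f0 f s by (intro mean_mix_le) (auto simp: spectral_density_def)
  ultimately show ?thesis
    unfolding D_band_def using spectral_density_mix[OF f0(1) f(1) s] by blast
qed

lemma D_contam_mix:
  assumes "g0 \<in> D_contam g1 \<epsilon> P" "g \<in> D_contam g1 \<epsilon> P" and s: "0 \<le> s" "s \<le> 1"
  shows "mix s g0 g \<in> D_contam g1 \<epsilon> P"
proof -
  obtain w0 w where g0: "spectral_density g0" "1 / (2 * pi) * (LINT t|freq. g0 t) \<le> P"
      "spectral_density w0" "AE t in freq. g0 t = (1 - \<epsilon>) * g1 t + \<epsilon> * w0 t"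
    and g: "spectral_density g" "1 / (2 * pi) * (LINT t|freq. g t) \<le> P"
      "spectral_density w" "AE t in freq. g t = (1 - \<epsilon>) * g1 t + \<epsilon> * w t"
    using assms(1,2) by (auto simp: D_contam_def)
  have "AE t in freq. mix s g0 g t = (1 - \<epsilon>) * g1 t + \<epsilon> * mix s w0 w t"
    using g0(4) g(4)
  proof eventually_elim
    case (elim t)
    show ?case unfolding mix_def elim by (simp add: algebra_simps)
  qed
  moreover have "1 / (2 * pi) * (LINT t|freq. mix s g0 g t) \<le> P"
    using g0 g s by (intro mean_mix_le) (auto simp: spectral_density_def)
  ultimately show ?thesis
    unfolding D_contam_def using spectral_density_mix[OF g0(1) g(1) s] spectral_density_mix[OF g0(3) g(3) s]
    by blast
qed

text \<open>
  Cutting the contaminating density \<open>w\<close> at height \<open>n\<close> stays in the class, gives bounded densities when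
  \<open>g1\<close> is bounded, and reaches \<open>g\<close> at every point after finitely many \<open>n\<close>.
\<close>

lemma D_contam_truncate:
  assumes "g \<in> D_contam g1 \<epsilon> P" and g1: "spectral_density g1" "AE t in freq. g1 t \<le> G" and \<epsilon>: "0 < \<epsilon>" "\<epsilon> < 1"
  shows "\<exists>gn. (\<forall>n. gn n \<in> D_contam g1 \<epsilon> P \<and> (\<exists>K. AE t in freq. gn n t \<le> K)) \<and>
     (\<forall>n. AE t in freq. gn n t \<le> gn (Suc n) t) \<and> (AE t in freq. \<exists>n. gn n t = g t \<and> (\<forall>k. gn k t \<le> g t))"
proof -
  obtain w where g: "spectral_density g" "1 / (2 * pi) * (LINT t|freq. g t) \<le> P"
      and w: "spectral_density w" and gw: "AE t in freq. g t = (1 - \<epsilon>) * g1 t + \<epsilon> * w t"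
    using assms(1) by (auto simp: D_contam_def)
  have [measurable]: "w \<in> borel_measurable freq" "g1 \<in> borel_measurable freq" "g \<in> borel_measurable freq"
    using w g1 g by (auto simp: spectral_density_def)
  have w0: "AE t in freq. 0 \<le> w t" and g10: "AE t in freq. 0 \<le> g1 t"
    using w g1 by (auto simp: spectral_density_def)
  define wn where "wn n t = min (w t) (real n)" for n t
  define gn where "gn n t = (1 - \<epsilon>) * g1 t + \<epsilon> * wn n t" for n t
  have wn: "spectral_density (wn n)" for n
    unfolding spectral_density_def
  proof
    show "integrable freq (wn n)"
    proof (rule Bochner_Integration.integrable_bound[of _ w])
      show "integrable freq w" using w by (simp add: spectral_density_def)
      show "AE t in freq. norm (wn n t) \<le> norm (w t)"
        using w0 by eventually_elim (simp add: wn_def)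
    qed (simp add: wn_def[abs_def])
    show "AE t in freq. 0 \<le> wn n t" using w0 by eventually_elim (simp add: wn_def)
  qed
  have gns: "spectral_density (gn n)" for n
    unfolding spectral_density_def
  proof
    show "integrable freq (gn n)"
      unfolding gn_def using g1(1) wn[of n] by (auto simp: spectral_density_def)
    have "AE t in freq. 0 \<le> wn n t" using wn by (simp add: spectral_density_def)
    with g10 show "AE t in freq. 0 \<le> gn n t"
      by eventually_elim (use \<epsilon> in \<open>simp add: gn_def\<close>)
  qed
  have le: "AE t in freq. gn n t \<le> g t" for n
    using gw by eventually_elim (use \<epsilon> in \<open>simp add: gn_def wn_def\<close>)
  have mean: "1 / (2 * pi) * (LINT t|freq. gn n t) \<le> P" for n
  proof -
    have "(LINT t|freq. gn n t) \<le> (LINT t|freq. g t)"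
      using gns[of n] g(1) le by (intro integral_mono_AE) (auto simp: spectral_density_def)
    then have "1 / (2 * pi) * (LINT t|freq. gn n t) \<le> 1 / (2 * pi) * (LINT t|freq. g t)"
      by (intro mult_left_mono) auto
    then show ?thesis using g(2) by simp
  qed
  have "gn n \<in> D_contam g1 \<epsilon> P" for n
    unfolding D_contam_def using gns wn mean gn_def by blast
  moreover have "AE t in freq. gn n t \<le> (1 - \<epsilon>) * G + \<epsilon> * real n" for n
    using g1(2) by eventually_elim (use \<epsilon> in \<open>auto simp: gn_def wn_def intro!: add_mono mult_left_mono\<close>)
  moreover have "AE t in freq. gn n t \<le> gn (Suc n) t" for n
    by (rule AE_I2) (use \<epsilon> in \<open>auto simp: gn_def wn_def intro!: mult_left_mono min.mono\<close>)
  moreover have "AE t in freq. \<exists>n. gn n t = g t \<and> (\<forall>k. gn k t \<le> g t)"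
    using gw
  proof eventually_elim
    case (elim t)
    obtain n :: nat where "w t \<le> real n" using real_arch_simple by blast
    then have "gn n t = g t" using elim by (simp add: gn_def wn_def)
    moreover have "gn k t \<le> g t" for k using elim \<epsilon> by (simp add: gn_def wn_def)
    ultimately show ?case by blast
  qed
  ultimately show ?thesis by (intro exI[of _ gn]) blast
qed

lemma mse_SUP:
  assumes meas: "h \<in> borel_measurable freq" "\<And>n. gn n \<in> borel_measurable freq"
    and mono: "\<And>n. AE t in freq. gn n t \<le> gn (Suc n) t"
    and lim: "AE t in freq. \<exists>n. gn n t = g t \<and> (\<forall>k. gn k t \<le> g t)"
    and le: "\<And>n. mse a h f (gn n) \<le> L"
  shows "mse a h f g \<le> L"
proof -
  have "(\<integral>\<^sup>+t. ennreal ((cmod (h t))\<^sup>2 * g t) \<partial>freq) = (\<integral>\<^sup>+t. (SUP n. ennreal ((cmod (h t))\<^sup>2 * gn n t)) \<partial>freq)"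
  proof (rule nn_integral_cong_AE)
    show "AE t in freq. ennreal ((cmod (h t))\<^sup>2 * g t) = (SUP n. ennreal ((cmod (h t))\<^sup>2 * gn n t))"
      using lim
    proof eventually_elim
      case (elim t)
      then obtain n where n: "gn n t = g t" "\<And>k. gn k t \<le> g t" by blast
      show ?case
      proof (rule antisym)
        show "ennreal ((cmod (h t))\<^sup>2 * g t) \<le> (SUP n. ennreal ((cmod (h t))\<^sup>2 * gn n t))"
          unfolding n(1)[symmetric] by (rule SUP_upper) simp
        show "(SUP n. ennreal ((cmod (h t))\<^sup>2 * gn n t)) \<le> ennreal ((cmod (h t))\<^sup>2 * g t)"
          by (intro SUP_least ennreal_leI mult_left_mono n) auto
      qed
    qed
  qed
  also have "\<dots> = (SUP n. \<integral>\<^sup>+t. ennreal ((cmod (h t))\<^sup>2 * gn n t) \<partial>freq)"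
  proof (rule nn_integral_monotone_convergence_SUP_AE)
    show "AE t in freq. ennreal ((cmod (h t))\<^sup>2 * gn n t) \<le> ennreal ((cmod (h t))\<^sup>2 * gn (Suc n) t)" for n
      using mono[of n] by eventually_elim (intro ennreal_leI mult_left_mono, auto)
  qed (use meas in measurable)
  finally have "mse a h f g = (SUP n. mse a h f (gn n))"
    unfolding mse_def by (simp add: SUP_mult_left_ennreal ennreal_SUP_add_right)
  then show ?thesis using le by (simp add: SUP_le_iff)
qed

theorem theorem7:
  fixes a :: "nat \<Rightarrow> complex"
    and u v g1 f0 g0 \<gamma>1 \<gamma>2 \<phi> :: "real \<Rightarrow> real"
    and P1 P2 \<epsilon> \<alpha>1 \<alpha>2 :: real
    and D :: density_class
    and C0 :: "real \<Rightarrow> complex"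
  defines "D \<equiv> D_band v u P1 \<times> D_contam g1 \<epsilon> P2"
    and "C0 \<equiv> C_fun a f0 g0"
  assumes "summable (\<lambda>k. cmod (a k))"
    and "summable (\<lambda>k. (real k + 1) * (cmod (a k))\<^sup>2)"
    and "spectral_density u" and "spectral_density v" and "spectral_density g1"
    and "ess_bounded u" and "ess_bounded v"
    and "P1 > 0" and "P2 > 0" and "0 < \<epsilon>" and "\<epsilon> < 1"
    and "f0 \<in> D_band v u P1" and "g0 \<in> D_contam g1 \<epsilon> P2"
    and "inverse_integrable f0 g0" and "operators_defined f0 g0"
    and "ess_bounded (\<lambda>t. cmod (A_fun a t * g0 t + C0 t) / (f0 t + g0 t))"
    and "ess_bounded (\<lambda>t. cmod (A_fun a t * f0 t - C0 t) / (f0 t + g0 t))"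
    and "\<alpha>1 > 0" and "\<alpha>2 > 0"
    and "AE t in freq. cmod (A_fun a t * g0 t + C0 t) = (f0 t + g0 t) * (\<gamma>1 t + \<gamma>2 t + inverse \<alpha>1)"
    and "AE t in freq. cmod (A_fun a t * f0 t - C0 t) = (f0 t + g0 t) * (\<phi> t + inverse \<alpha>2)"
    and "AE t in freq. \<gamma>1 t \<le> 0 \<and> (f0 t > v t \<longrightarrow> \<gamma>1 t = 0)"
    and "AE t in freq. \<gamma>2 t \<ge> 0 \<and> (f0 t < u t \<longrightarrow> \<gamma>2 t = 0)"
    and "AE t in freq. \<phi> t \<le> 0 \<and> (g0 t > (1 - \<epsilon>) * g1 t \<longrightarrow> \<phi> t = 0)"
    and "\<forall>(f, g)\<in>D. admissible f g \<longrightarrow> objective a f g \<le> objective a f0 g0"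
  shows "least_favorable a D f0 g0 \<and> minimax_robust a D (h_opt a f0 g0)"
proof -
  note a = \<open>summable (\<lambda>k. cmod (a k))\<close>
  note f0D = \<open>f0 \<in> D_band v u P1\<close> and g0D = \<open>g0 \<in> D_contam g1 \<epsilon> P2\<close>
  note max = \<open>\<forall>(f, g)\<in>D. admissible f g \<longrightarrow> objective a f g \<le> objective a f0 g0\<close>
  have in_D: "(f, g) \<in> D \<longleftrightarrow> f \<in> D_band v u P1 \<and> g \<in> D_contam g1 \<epsilon> P2" for f g
    by (simp add: D_def)
  have sd: "spectral_density f" "spectral_density g" if "(f, g) \<in> D" for f g
    using that by (auto simp: in_D D_band_def D_contam_def)
  have D0: "(f0, g0) \<in> D" using f0D g0D by (simp add: in_D)
  have adm0: "admissible f0 g0"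
    using \<open>inverse_integrable f0 g0\<close> \<open>operators_defined f0 g0\<close> by (simp add: admissible_def)
  have bp: "bounded_pair f0 g0" by (rule admissible_bounded_pair[OF sd[OF D0] adm0])
  define h0 where "h0 = h_opt a f0 g0"
  define L0 where "L0 = err a f0 g0 h0"
  have opt_value: "mse a (h_opt a f g) f g = ennreal (objective a f g)" if "bounded_pair f g" for f g
  proof -
    obtain M where M: "f \<in> borel_measurable freq" "g \<in> borel_measurable freq"
      "AE t in freq. 0 \<le> f t \<and> f t \<le> M" "AE t in freq. 0 \<le> g t \<and> g t \<le> M"
      using bounded_pair_bounds[OF \<open>bounded_pair f g\<close>] by blast
    show ?thesis
      unfolding objective_eq_err[OF a that]
      by (rule mse_eq_err(1)[OF a h_opt_sqint[OF a that] M(1,3) M(2,4)])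
  qed
  have lf: "least_favorable a D f0 g0"
    unfolding least_favorable_def
  proof (intro conjI D0 adm0, safe)
    fix f g assume fg: "(f, g) \<in> D" "admissible f g"
    have "objective a f g \<le> objective a f0 g0" using max fg by blast
    then show "mse a (h_opt a f g) f g \<le> mse a (h_opt a f0 g0) f0 g0"
      unfolding opt_value[OF admissible_bounded_pair[OF sd[OF fg(1)] fg(2)]] opt_value[OF bp] by (rule ennreal_leI)
  qed
  have mse0: "mse a h0 f0 g0 = ennreal L0"
    unfolding h0_def L0_def opt_value[OF bp] objective_eq_err[OF a bp] ..
  have h0p: "past h0" unfolding h0_def by (rule h_opt_past[OF a bp])
  then have h0s: "h0 \<in> sqint freq" by (simp add: past_def)
  obtain Bu where Bu: "AE t in freq. \<bar>u t\<bar> \<le> Bu" using \<open>ess_bounded u\<close> by (auto simp: ess_bounded_def)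
  obtain m M where m: "0 < m" and ae: "AE t in freq. 0 \<le> f0 t \<and> 0 \<le> g0 t \<and> m \<le> f0 t + g0 t \<and> f0 t + g0 t \<le> M"
    using bp by (rule bounded_pairE)
  \<comment> \<open>Admissibility bounds \<open>g0\<close>, and \<open>g0\<close> dominates \<open>(1 - \<epsilon>) g1\<close>.\<close>
  have g1b: "AE t in freq. g1 t \<le> M / (1 - \<epsilon>)"
  proof -
    obtain w where "spectral_density w" "AE t in freq. g0 t = (1 - \<epsilon>) * g1 t + \<epsilon> * w t"
      using g0D by (auto simp: D_contam_def)
    moreover from this have "AE t in freq. 0 \<le> w t" by (simp add: spectral_density_def)
    ultimately have "AE t in freq. g0 t = (1 - \<epsilon>) * g1 t + \<epsilon> * w t \<and> 0 \<le> w t" by simp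
    then show ?thesis using ae
    proof eventually_elim
      case (elim t)
      then have "0 \<le> \<epsilon> * w t" using \<open>0 < \<epsilon>\<close> by simp
      then have "(1 - \<epsilon>) * g1 t \<le> M" using elim by linarith
      then show ?case using \<open>\<epsilon> < 1\<close> by (simp add: field_simps)
    qed
  qed
  \<comment> \<open>For \<open>g\<close> bounded the whole segment from \<open>(f0, g0)\<close> to \<open>(f, g)\<close> is admissible, except possibly its end.\<close>
  have saddle_bd: "mse a h0 f g \<le> ennreal L0"
    if fg: "(f, g) \<in> D" and gK: "AE t in freq. g t \<le> Kg" for f g Kg
  proof -
    define K where "K = max Bu Kg"
    have "AE t in freq. f t \<le> u t" using fg by (auto simp: in_D D_band_def)
    with Bu have fK: "AE t in freq. f t \<le> K" by eventually_elim (auto simp: K_def)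
    have gK': "AE t in freq. g t \<le> K" using gK by eventually_elim (auto simp: K_def)
    have "objective a (mix s f0 f) (mix s g0 g) \<le> objective a f0 g0" if s: "0 < s" "s < 1" for s
    proof -
      have "(mix s f0 f, mix s g0 g) \<in> D"
        using D0 fg s by (simp add: in_D D_band_mix D_contam_mix)
      moreover have "admissible (mix s f0 f) (mix s g0 g)"
        by (rule bounded_pair_admissible[OF bounded_pair_mix[OF bp sd[OF fg] fK gK' s]])
      ultimately show ?thesis using max by blast
    qed
    then have "err a f g h0 \<le> L0"
      unfolding L0_def h0_def by (rule saddle_bounded[OF a bp sd[OF fg] fK gK'])
    moreover have "mse a h0 f g = ennreal (err a f g h0)"
    proof (rule mse_eq_err(1)[OF a h0s])
      have "AE t in freq. 0 \<le> f t" "AE t in freq. 0 \<le> g t"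
        using sd[OF fg] by (auto simp: spectral_density_def)
      with fK gK' show "AE t in freq. 0 \<le> f t \<and> f t \<le> K" "AE t in freq. 0 \<le> g t \<and> g t \<le> K"
        by auto
    qed (use sd[OF fg] in \<open>auto simp: spectral_density_def\<close>)
    ultimately show ?thesis by (simp add: ennreal_leI)
  qed
  have saddle: "mse a h0 f g \<le> ennreal L0" if fg: "(f, g) \<in> D" for f g
  proof -
    obtain gn where gn: "\<And>n. gn n \<in> D_contam g1 \<epsilon> P2" "\<And>n. \<exists>K. AE t in freq. gn n t \<le> K"
      "\<And>n. AE t in freq. gn n t \<le> gn (Suc n) t" "AE t in freq. \<exists>n. gn n t = g t \<and> (\<forall>k. gn k t \<le> g t)"
      using D_contam_truncate[OF _ \<open>spectral_density g1\<close> g1b \<open>0 < \<epsilon>\<close> \<open>\<epsilon> < 1\<close>] fg unfolding in_D by blast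
    have gnD: "(f, gn n) \<in> D" for n using fg gn(1) by (simp add: in_D)
    show ?thesis
    proof (rule mse_SUP[OF _ _ gn(3,4)])
      show "mse a h0 f (gn n) \<le> ennreal L0" for n
        using saddle_bd[OF gnD] gn(2) by blast
      show "gn n \<in> borel_measurable freq" for n
        using sd(2)[OF gnD] by (auto simp: spectral_density_def)
    qed (use h0s in auto)
  qed
  have h0H: "h0 \<in> H_class D"
  proof -
    obtain B where B: "AE t in freq. \<bar>cmod (A_fun a t * f0 t - C0 t) / (f0 t + g0 t)\<bar> \<le> B"
      using \<open>ess_bounded (\<lambda>t. cmod (A_fun a t * f0 t - C0 t) / (f0 t + g0 t))\<close> by (auto simp: ess_bounded_def)
    have hB: "AE t in freq. cmod (h0 t) \<le> B"
      using B ae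
    proof eventually_elim
      case (elim t)
      have "h0 t = (A_fun a t * f0 t - C0 t) / complex_of_real (f0 t + g0 t)"
        by (simp add: h0_def h_opt_def C0_def diff_divide_distrib)
      then have "cmod (h0 t) = \<bar>cmod (A_fun a t * f0 t - C0 t) / (f0 t + g0 t)\<bar>"
        by (simp add: norm_divide del: of_real_add)
      then show ?case using elim by simp
    qed
    have "h0 \<in> L2_past (\<lambda>t. f t + g t)" if "(f, g) \<in> D" for f g
    proof (rule past_bounded_imp_L2_past[OF h0p hB])
      have "AE t in freq. 0 \<le> f t" "AE t in freq. 0 \<le> g t" "integrable freq f" "integrable freq g"
        using sd[OF that] by (auto simp: spectral_density_def)
      then show "integrable freq (\<lambda>t. f t + g t)" "AE t in freq. 0 \<le> f t + g t"
        by auto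
    qed
    then show ?thesis by (auto simp: H_class_def)
  qed
  have SUP0: "(SUP (f, g)\<in>D. mse a h0 f g) = ennreal L0"
  proof (rule antisym)
    show "(SUP (f, g)\<in>D. mse a h0 f g) \<le> ennreal L0"
      using saddle by (intro SUP_least) auto
    show "ennreal L0 \<le> (SUP (f, g)\<in>D. mse a h0 f g)"
      using SUP_upper[OF D0, of "\<lambda>(f, g). mse a h0 f g"] mse0 by simp
  qed
  have lower: "ennreal L0 \<le> (SUP (f, g)\<in>D. mse a h f g)" if "h \<in> H_class D" for h
  proof -
    have "h \<in> L2_past (\<lambda>t. f0 t + g0 t)" using that D0 by (auto simp: H_class_def)
    then have hp: "past h" by (rule L2_past_imp_past[OF bp])
    then have hs: "h \<in> sqint freq" by (simp add: past_def)
    obtain M where M: "f0 \<in> borel_measurable freq" "g0 \<in> borel_measurable freq"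
      "AE t in freq. 0 \<le> f0 t \<and> f0 t \<le> M" "AE t in freq. 0 \<le> g0 t \<and> g0 t \<le> M"
      using bounded_pair_bounds[OF bp] by blast
    have "AE t in freq. 0 \<le> (cmod (h t - h_opt a f0 g0 t))\<^sup>2 * (f0 t + g0 t)"
      using ae by eventually_elim simp
    then have "0 \<le> (LINT t|freq. (cmod (h t - h_opt a f0 g0 t))\<^sup>2 * (f0 t + g0 t))"
      by (rule integral_nonneg_AE)
    then have "L0 \<le> err a f0 g0 h"
      unfolding err_pythagoras[OF a bp hp] L0_def h0_def by simp
    then have "ennreal L0 \<le> mse a h f0 g0"
      unfolding mse_eq_err(1)[OF a hs M(1,3) M(2,4)] by (rule ennreal_leI)
    also have "\<dots> \<le> (SUP (f, g)\<in>D. mse a h f g)"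
      using SUP_upper[OF D0, of "\<lambda>(f, g). mse a h f g"] by simp
    finally show ?thesis .
  qed
  have "(INF h\<in>H_class D. SUP (f, g)\<in>D. mse a h f g) = (SUP (f, g)\<in>D. mse a h0 f g)"
  proof (rule antisym)
    show "(INF h\<in>H_class D. SUP (f, g)\<in>D. mse a h f g) \<le> (SUP (f, g)\<in>D. mse a h0 f g)"
      by (rule INF_lower[OF h0H])
    show "(SUP (f, g)\<in>D. mse a h0 f g) \<le> (INF h\<in>H_class D. SUP (f, g)\<in>D. mse a h f g)"
      unfolding SUP0 using lower by (rule INF_greatest)
  qed
  then have "minimax_robust a D h0" using h0H by (simp add: minimax_robust_def)
  with lf show ?thesis by (simp add: h0_def)
qed

end
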